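(* Let $G,G_1,G_2$ be digraphs and $i_1\colon G\to G_1$, $i_2\colon G\to G_2$ regular morphisms of digraphs, and let $\mathbb K$ be a field. Then there is a short exact sequence of cochain complexes \[0\to C^*(\nabla_{P(G)}(P(G_1),P(G_2));\mathbb K)\to C^*_\mu(G_1;\mathbb K)\oplus C^*_\mu(G_2;\mathbb K)\to C^*_\mu(G;\mathbb K)\to 0,\] inducing a long exact sequence \[\cdots\to \mathrm{H}^{i-1}_\mu(G;\mathbb K)\to \mathrm{H}^{i}(\nabla_{P(G)}(P(G_1),P(G_2));\mathbb K)\to \mathrm{H}^i_\mu(G_1;\mathbb K)\oplus \mathrm{H}^i_\mu(G_2;\mathbb K)\to \mathrm{H}^i_\mu(G;\mathbb K)\to\cdots.\]
   Context: Digraph: finite vertex set $V$, edges $E\subseteq (V\times V)\setminus\{(v,v)\}$. A morphism of digraphs $G\to G'$ is a map $\phi\colon V(G)\to V(G')$ with $(\phi(v),\phi(w))\in E(G')$ whenever $(v,w)\in E(G)$; it is regular if injective. A multipath of $G$ is a spanning subgraph each of whose connected components is a single vertex or a simple directed path (no repeated vertex, not a cycle); $P(G)$ is the poset of multipaths ordered by inclusion. A regular morphism $G\to G_j$ induces an injective poset map $P(G)\to P(G_j)$ (send a multipath to the spanning subgraph of $G_j$ with the image edges), identifying $P(G)$ with a subposet of $P(G_j)$. The gluing $\nabla_{P(G)}(P(G_1),P(G_2))$ is the poset whose Hasse diagram is obtained from the Hasse diagrams of $P(G_1)$ and $P(G_2)$ by identifying the two copies of the Hasse diagram of $P(G)$.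 A sign assignment on a poset is a function $\epsilon$ from covering pairs to $\mathbb Z/2$ with $\epsilon(x,y)+\epsilon(y,z)\equiv\epsilon(x,y')+\epsilon(y',z)+1\pmod 2$ for each square $x\prec y,y'\prec z$. For a finite poset $P$ with minimum and a sign assignment, $C^*(P;\mathbb K)$ has in degree $n$ basis the elements $x$ of level $n$ (minimal number of coverings from the minimum to $x$) and differential $d b_x=\sum_{x\prec y}(-1)^{\epsilon(x,y)}b_y$; $\mathrm{H}^*(P;\mathbb K)$ is its cohomology. Multipath cohomology: $C^*_\mu(G;\mathbb K)=C^*(P(G);\mathbb K)$ (level = number of edges) and $\mathrm{H}^*_\mu(G;\mathbb K)$ its cohomology, independent of the sign assignment. *)

theory Defs
  imports
    "Graph_Theory.Digraph_Component"
    "Jordan_Normal_Form.Missing_VectorSpace"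
    "HOL-Algebra.AbelCoset"
    "HOL-Library.Z2"
begin

section \<open>Finite posets and sign assignments\<close>

text \<open>
  A poset is given by its reflexive order relation \<open>r\<close>, with \<open>(x, y) \<in> r\<close> for \<open>x \<le> y\<close>; its
  underlying set is \<open>Field r\<close>.
\<close>

definition covers :: "'p rel \<Rightarrow> 'p rel" where
  "covers r = {(x, y) \<in> r. x \<noteq> y \<and> (\<forall>z. (x, z) \<in> r \<and> (z, y) \<in> r \<longrightarrow> z = x \<or> z = y)}"

definition poset_min :: "'p rel \<Rightarrow> 'p" where
  "poset_min r = (THE m. m \<in> Field r \<and> (\<forall>x\<in>Field r. (m, x) \<in> r))"

definition level :: "'p rel \<Rightarrow> 'p \<Rightarrow> nat" where
  "level r x = (LEAST n. (poset_min r, x) \<in> covers r ^^ n)"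

definition level_set :: "'p rel \<Rightarrow> int \<Rightarrow> 'p set" where
  "level_set r n = {x \<in> Field r. int (level r x) = n}"

text \<open>Only the values of a sign assignment on covering pairs matter.\<close>

definition sign_assignment :: "'p rel \<Rightarrow> ('p \<Rightarrow> 'p \<Rightarrow> bit) \<Rightarrow> bool" where
  "sign_assignment r \<epsilon> \<longleftrightarrow>
     (\<forall>x y y' z. (x, y) \<in> covers r \<and> (y, z) \<in> covers r \<and> (x, y') \<in> covers r \<and> (y', z) \<in> covers r
        \<and> y \<noteq> y' \<longrightarrow> \<epsilon> x y + \<epsilon> y z = \<epsilon> x y' + \<epsilon> y' z + 1)"


section \<open>Cochain complexes of vector spaces\<close>

record ('k, 'v) cochains =
  coch :: "int \<Rightarrow> ('k, 'v) module"
  cobd :: "int \<Rightarrow> 'v \<Rightarrow> 'v"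

definition cochain_complex :: "('k, 'm) ring_scheme \<Rightarrow> ('k, 'v) cochains \<Rightarrow> bool" where
  "cochain_complex K C \<longleftrightarrow>
     (\<forall>n. vectorspace K (coch C n) \<and> linear_map K (coch C n) (coch C (n + 1)) (cobd C n) \<and>
        (\<forall>x\<in>carrier (coch C n). cobd C (n + 1) (cobd C n x) = \<zero>\<^bsub>coch C (n + 1 + 1)\<^esub>))"

definition cochain_map ::
    "('k, 'm) ring_scheme \<Rightarrow> ('k, 'v) cochains \<Rightarrow> ('k, 'w) cochains \<Rightarrow> (int \<Rightarrow> 'v \<Rightarrow> 'w) \<Rightarrow> bool" where
  "cochain_map K C D f \<longleftrightarrow>
     (\<forall>n. linear_map K (coch C n) (coch D n) (f n) \<and>
        (\<forall>x\<in>carrier (coch C n). f (n + 1) (cobd C n x) = cobd D n (f n x)))"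

definition csum :: "('k, 'v) cochains \<Rightarrow> ('k, 'w) cochains \<Rightarrow> ('k, 'v \<times> 'w) cochains" where
  "csum C D = \<lparr>coch = (\<lambda>n. direct_sum (coch C n) (coch D n)),
               cobd = (\<lambda>n. map_prod (cobd C n) (cobd D n))\<rparr>"

text \<open>Exactness of \<open>U \<rightarrow> V \<rightarrow> W\<close> at \<open>V\<close>.\<close>

definition exact_at ::
    "('k, 'm) ring_scheme \<Rightarrow> ('k, 'u) module \<Rightarrow> ('k, 'v) module \<Rightarrow> ('k, 'w) module \<Rightarrow>
     ('u \<Rightarrow> 'v) \<Rightarrow> ('v \<Rightarrow> 'w) \<Rightarrow> bool" where
  "exact_at K U V W f g \<longleftrightarrow>
     linear_map K U V f \<and> linear_map K V W g \<and> f ` carrier U = a_kernel V W g"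

definition short_exact_sequence ::
    "('k, 'm) ring_scheme \<Rightarrow> ('k, 'u) cochains \<Rightarrow> ('k, 'v) cochains \<Rightarrow> ('k, 'w) cochains \<Rightarrow>
     (int \<Rightarrow> 'u \<Rightarrow> 'v) \<Rightarrow> (int \<Rightarrow> 'v \<Rightarrow> 'w) \<Rightarrow> bool" where
  "short_exact_sequence K A B C f g \<longleftrightarrow>
     cochain_complex K A \<and> cochain_complex K B \<and> cochain_complex K C \<and>
     cochain_map K A B f \<and> cochain_map K B C g \<and>
     (\<forall>n. inj_on (f n) (carrier (coch A n)) \<and>
          exact_at K (coch A n) (coch B n) (coch C n) (f n) (g n) \<and>
          g n ` carrier (coch B n) = carrier (coch C n))"


section \<open>Cohomology\<close>

text \<open>
  The elements of \<open>V / W\<close> are the cosets of \<open>W\<close>. The two ring components of the record play no role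
  for modules.
\<close>

definition quotient_space :: "('k, 'v) module \<Rightarrow> 'v set \<Rightarrow> ('k, 'v set) module" where
  "quotient_space V W =
     \<lparr>carrier = a_rcosets\<^bsub>V\<^esub> W, mult = undefined, one = undefined,
      zero = W, add = (<+>\<^bsub>V\<^esub>), smult = (\<lambda>k X. \<Union>x\<in>X. W +>\<^bsub>V\<^esub> (k \<odot>\<^bsub>V\<^esub> x))\<rparr>"

definition cocycles :: "('k, 'v) cochains \<Rightarrow> int \<Rightarrow> 'v set" where
  "cocycles C n = a_kernel (coch C n) (coch C (n + 1)) (cobd C n)"

definition coboundaries :: "('k, 'v) cochains \<Rightarrow> int \<Rightarrow> 'v set" where
  "coboundaries C n = cobd C (n - 1) ` carrier (coch C (n - 1))"

definition cohomology :: "('k, 'v) cochains \<Rightarrow> int \<Rightarrow> ('k, 'v set) module" where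
  "cohomology C n = quotient_space ((coch C n)\<lparr>carrier := cocycles C n\<rparr>) (coboundaries C n)"

definition coh_class :: "('k, 'v) cochains \<Rightarrow> int \<Rightarrow> 'v \<Rightarrow> 'v set" where
  "coh_class C n x = coboundaries C n +>\<^bsub>coch C n\<^esub> x"

text \<open>
  The map induced in cohomology by a cochain map \<open>f\<close> with target \<open>D\<close>; the union is over the
  representatives of a class and all its members coincide.
\<close>

definition coh_map ::
    "('k, 'w) cochains \<Rightarrow> (int \<Rightarrow> 'v \<Rightarrow> 'w) \<Rightarrow> int \<Rightarrow> 'v set \<Rightarrow> 'w set" where
  "coh_map D f n X = (\<Union>x\<in>X. coh_class D n (f n x))"

text \<open>
  For cochain maps \<open>f : A \<rightarrow> B\<^sub>1 \<oplus> B\<^sub>2\<close> and \<open>g : B\<^sub>1 \<oplus> B\<^sub>2 \<rightarrow> C\<close>, the induced maps in cohomology,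
  read through the canonical isomorphism of the cohomology of the sum with the sum of the
  cohomologies.
\<close>

definition coh_into_sum ::
    "('k, 'v) cochains \<Rightarrow> ('k, 'w) cochains \<Rightarrow> (int \<Rightarrow> 'u \<Rightarrow> 'v \<times> 'w) \<Rightarrow>
     int \<Rightarrow> 'u set \<Rightarrow> 'v set \<times> 'w set" where
  "coh_into_sum B\<^sub>1 B\<^sub>2 f n X =
     (coh_map B\<^sub>1 (\<lambda>n. fst \<circ> f n) n X, coh_map B\<^sub>2 (\<lambda>n. snd \<circ> f n) n X)"

definition coh_from_sum ::
    "('k, 'v) cochains \<Rightarrow> ('k, 'w) cochains \<Rightarrow> ('k, 'u) cochains \<Rightarrow> (int \<Rightarrow> 'v \<times> 'w \<Rightarrow> 'u) \<Rightarrow>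
     int \<Rightarrow> 'v set \<times> 'w set \<Rightarrow> 'u set" where
  "coh_from_sum B\<^sub>1 B\<^sub>2 C g n XY =
     coh_map C (\<lambda>n. g n \<circ> inj1 (coch B\<^sub>1 n) (coch B\<^sub>2 n)) n (fst XY) \<oplus>\<^bsub>cohomology C n\<^esub>
     coh_map C (\<lambda>n. g n \<circ> inj2 (coch B\<^sub>1 n) (coch B\<^sub>2 n)) n (snd XY)"

text \<open>
  \<open>\<delta>\<close> is the connecting homomorphism of \<open>0 \<rightarrow> A \<rightarrow> B \<rightarrow> C \<rightarrow> 0\<close>: it sends the class of a cocycle
  \<open>g b\<close> to the class of the cochain \<open>a\<close> with \<open>f a = d b\<close>.
\<close>

definition connecting_hom ::
    "('k, 'm) ring_scheme \<Rightarrow> ('k, 'u) cochains \<Rightarrow> ('k, 'v) cochains \<Rightarrow> ('k, 'w) cochains \<Rightarrow>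
     (int \<Rightarrow> 'u \<Rightarrow> 'v) \<Rightarrow> (int \<Rightarrow> 'v \<Rightarrow> 'w) \<Rightarrow> (int \<Rightarrow> 'w set \<Rightarrow> 'u set) \<Rightarrow> bool" where
  "connecting_hom K A B C f g \<delta> \<longleftrightarrow>
     (\<forall>n. linear_map K (cohomology C n) (cohomology A (n + 1)) (\<delta> n) \<and>
        (\<forall>b\<in>carrier (coch B n). \<forall>a\<in>carrier (coch A (n + 1)).
           g n b \<in> cocycles C n \<and> f (n + 1) a = cobd B n b \<longrightarrow>
           \<delta> n (coh_class C n (g n b)) = coh_class A (n + 1) a))"


section \<open>The cochain complex of a poset with a sign assignment\<close>

definition sgn_val :: "('k, 'm) ring_scheme \<Rightarrow> bit \<Rightarrow> 'k" where
  "sgn_val K s = (if s = 0 then \<one>\<^bsub>K\<^esub> else \<ominus>\<^bsub>K\<^esub> \<one>\<^bsub>K\<^esub>)"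

text \<open>
  A cochain of degree \<open>n\<close> is the coefficient function of a linear combination of the basis elements
  \<open>b\<^sub>x\<close> with \<open>x\<close> of level \<open>n\<close>. The differential is the linear extension of
  \<open>d b\<^sub>x = (\<Sum>x \<prec> y. (-1)\<^bsup>\<epsilon> x y\<^esup> b\<^sub>y)\<close>: the coefficient of \<open>d c\<close> at \<open>y\<close> collects
  \<open>(-1)\<^bsup>\<epsilon> x y\<^esup> c\<^sub>x\<close> over all \<open>x\<close> covered by \<open>y\<close>; see \<open>poset_diff_basis\<close> below. In the
  graded posets considered here, an element covering one of level \<open>n\<close> has level \<open>n + 1\<close>. Degrees
  are integers; there are no elements of negative level, so the cochain spaces vanish there.
\<close>

definition poset_diff ::
    "('k, 'm) ring_scheme \<Rightarrow> 'p rel \<Rightarrow> ('p \<Rightarrow> 'p \<Rightarrow> bit) \<Rightarrow> int \<Rightarrow> ('p \<Rightarrow> 'k) \<Rightarrow> ('p \<Rightarrow> 'k)" where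
  "poset_diff K r \<epsilon> n c =
     (\<lambda>y\<in>level_set r (n + 1).
        \<Oplus>\<^bsub>K\<^esub>x\<in>{x \<in> level_set r n. (x, y) \<in> covers r}. sgn_val K (\<epsilon> x y) \<otimes>\<^bsub>K\<^esub> c x)"

definition poset_cochains ::
    "('k, 'm) ring_scheme \<Rightarrow> 'p rel \<Rightarrow> ('p \<Rightarrow> 'p \<Rightarrow> bit) \<Rightarrow> ('k, 'p \<Rightarrow> 'k) cochains" where
  "poset_cochains K r \<epsilon> =
     \<lparr>coch = (\<lambda>n. ring.func_space K (level_set r n)), cobd = poset_diff K r \<epsilon>\<rparr>"

definition basis_cochain :: "('k, 'm) ring_scheme \<Rightarrow> 'p rel \<Rightarrow> int \<Rightarrow> 'p \<Rightarrow> 'p \<Rightarrow> 'k" where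
  "basis_cochain K r n x = (\<lambda>z\<in>level_set r n. if z = x then \<one>\<^bsub>K\<^esub> else \<zero>\<^bsub>K\<^esub>)"

lemma poset_diff_basis:
  assumes "field K" "finite (Field r)" "x \<in> level_set r n"
  shows "poset_diff K r \<epsilon> n (basis_cochain K r n x) =
         (\<lambda>y\<in>level_set r (n + 1). if (x, y) \<in> covers r then sgn_val K (\<epsilon> x y) else \<zero>\<^bsub>K\<^esub>)"
proof -
  interpret field K by fact
  have sgn: "sgn_val K s \<in> carrier K" for s
    by (simp add: sgn_val_def)
  have fin: "finite (level_set r n)"
    using assms(2) by (simp add: level_set_def)
  have "(\<Oplus>\<^bsub>K\<^esub>z\<in>S y. sgn_val K (\<epsilon> z y) \<otimes>\<^bsub>K\<^esub> basis_cochain K r n x z) =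
        (if (x, y) \<in> covers r then sgn_val K (\<epsilon> x y) else \<zero>\<^bsub>K\<^esub>)"
    if S: "S = (\<lambda>y. {z \<in> level_set r n. (z, y) \<in> covers r})" for S y
  proof -
    have "(\<Oplus>\<^bsub>K\<^esub>z\<in>S y. sgn_val K (\<epsilon> z y) \<otimes>\<^bsub>K\<^esub> basis_cochain K r n x z) =
          (\<Oplus>\<^bsub>K\<^esub>z\<in>S y. if x = z then sgn_val K (\<epsilon> z y) else \<zero>\<^bsub>K\<^esub>)"
      by (rule finsum_cong') (auto simp: basis_cochain_def S sgn)
    also have "\<dots> = (if (x, y) \<in> covers r then sgn_val K (\<epsilon> x y) else \<zero>\<^bsub>K\<^esub>)"
    proof (cases "x \<in> S y")
      case True
      then show ?thesis
        using finsum_singleton[of x "S y" "\<lambda>z. sgn_val K (\<epsilon> z y)"] fin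
        by (simp add: S sgn)
    next
      case False
      then have "(\<Oplus>\<^bsub>K\<^esub>z\<in>S y. if x = z then sgn_val K (\<epsilon> z y) else \<zero>\<^bsub>K\<^esub>) = (\<Oplus>\<^bsub>K\<^esub>z\<in>S y. \<zero>\<^bsub>K\<^esub>)"
        by (intro finsum_cong') auto
      then show ?thesis
        using False assms(3) by (simp add: S)
    qed
    finally show ?thesis .
  qed
  then show ?thesis
    by (auto simp: poset_diff_def restrict_def)
qed


section \<open>Digraphs and multipaths\<close>

definition digraph_morphism ::
    "'a pair_pre_digraph \<Rightarrow> 'b pair_pre_digraph \<Rightarrow> ('a \<Rightarrow> 'b) \<Rightarrow> bool" where
  "digraph_morphism G G' \<phi> \<longleftrightarrow>
     \<phi> \<in> pverts G \<rightarrow> pverts G' \<and> (\<forall>(v, w)\<in>parcs G. (\<phi> v, \<phi> w) \<in> parcs G')"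

definition regular_morphism ::
    "'a pair_pre_digraph \<Rightarrow> 'b pair_pre_digraph \<Rightarrow> ('a \<Rightarrow> 'b) \<Rightarrow> bool" where
  "regular_morphism G G' \<phi> \<longleftrightarrow> digraph_morphism G G' \<phi> \<and> inj_on \<phi> (pverts G)"

text \<open>The path \<open>v\<^sub>0 \<rightarrow> \<dots> \<rightarrow> v\<^sub>k\<close> on distinct vertices; \<open>k = 0\<close> is the single vertex.\<close>

definition simple_path_digraph :: "'a pair_pre_digraph \<Rightarrow> bool" where
  "simple_path_digraph C \<longleftrightarrow>
     (\<exists>vs. vs \<noteq> [] \<and> distinct vs \<and> pverts C = set vs \<and> parcs C = set (zip vs (tl vs)))"

text \<open>
  Connected components are the maximal subgraphs whose underlying undirected graph is connected;
  \<open>Digraph_Component.connected\<close> ignores the orientation of the arcs.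
\<close>

definition connected_component :: "'a pair_pre_digraph \<Rightarrow> 'a pair_pre_digraph \<Rightarrow> bool" where
  "connected_component H C \<longleftrightarrow>
     pre_digraph.max_subgraph (with_proj H) Digraph_Component.connected (with_proj C)"

definition multipath :: "'a pair_pre_digraph \<Rightarrow> 'a pair_pre_digraph \<Rightarrow> bool" where
  "multipath G H \<longleftrightarrow>
     spanning (with_proj H) (with_proj G) \<and>
     (\<forall>C. connected_component H C \<longrightarrow> simple_path_digraph C)"

definition path_poset :: "'a pair_pre_digraph \<Rightarrow> 'a pair_pre_digraph rel" where
  "path_poset G =
     {(H, H'). multipath G H \<and> multipath G H' \<and> subgraph (with_proj H) (with_proj H')}"

definition path_poset_map ::
    "'b pair_pre_digraph \<Rightarrow> ('a \<Rightarrow> 'b) \<Rightarrow> 'a pair_pre_digraph \<Rightarrow> 'b pair_pre_digraph" where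
  "path_poset_map G' \<phi> H = \<lparr>pverts = pverts G', parcs = map_prod \<phi> \<phi> ` parcs H\<rparr>"


section \<open>Gluing posets along a common subposet\<close>

text \<open>
  The poset \<open>r\<close> is identified with a subposet of \<open>r\<^sub>1\<close> and of \<open>r\<^sub>2\<close> by means of \<open>j\<^sub>1\<close> and \<open>j\<^sub>2\<close>.
  The equivalence relation on the disjoint union of the vertex sets of the two Hasse diagrams is
  the one generated by identifying \<open>j\<^sub>1 p\<close> with \<open>j\<^sub>2 p\<close>, and the order of the gluing is the
  reflexive transitive closure of the resulting Hasse diagram.
\<close>

definition glue_equiv ::
    "'p rel \<Rightarrow> 'q rel \<Rightarrow> 's rel \<Rightarrow> ('p \<Rightarrow> 'q) \<Rightarrow> ('p \<Rightarrow> 's) \<Rightarrow> ('q + 's) rel" where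
  "glue_equiv r r\<^sub>1 r\<^sub>2 j\<^sub>1 j\<^sub>2 =
     (let I = {(Inl (j\<^sub>1 p), Inr (j\<^sub>2 p)) | p. p \<in> Field r}
      in (I \<union> I\<inverse>)\<^sup>* \<inter> (Field r\<^sub>1 <+> Field r\<^sub>2) \<times> (Field r\<^sub>1 <+> Field r\<^sub>2))"

definition glue_hasse ::
    "'p rel \<Rightarrow> 'q rel \<Rightarrow> 's rel \<Rightarrow> ('p \<Rightarrow> 'q) \<Rightarrow> ('p \<Rightarrow> 's) \<Rightarrow> ('q + 's) set rel" where
  "glue_hasse r r\<^sub>1 r\<^sub>2 j\<^sub>1 j\<^sub>2 =
     (let E = glue_equiv r r\<^sub>1 r\<^sub>2 j\<^sub>1 j\<^sub>2
      in {(E `` {Inl x}, E `` {Inl y}) | x y. (x, y) \<in> covers r\<^sub>1} \<union>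
         {(E `` {Inr x}, E `` {Inr y}) | x y. (x, y) \<in> covers r\<^sub>2})"

definition gluing ::
    "'p rel \<Rightarrow> 'q rel \<Rightarrow> 's rel \<Rightarrow> ('p \<Rightarrow> 'q) \<Rightarrow> ('p \<Rightarrow> 's) \<Rightarrow> ('q + 's) set rel" where
  "gluing r r\<^sub>1 r\<^sub>2 j\<^sub>1 j\<^sub>2 =
     (let Q = (Field r\<^sub>1 <+> Field r\<^sub>2) // glue_equiv r r\<^sub>1 r\<^sub>2 j\<^sub>1 j\<^sub>2
      in (glue_hasse r r\<^sub>1 r\<^sub>2 j\<^sub>1 j\<^sub>2)\<^sup>* \<inter> Q \<times> Q)"

definition path_poset_gluing ::
    "'a pair_pre_digraph \<Rightarrow> 'b pair_pre_digraph \<Rightarrow> 'c pair_pre_digraph \<Rightarrow> ('a \<Rightarrow> 'b) \<Rightarrow> ('a \<Rightarrow> 'c) \<Rightarrow>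
     ('b pair_pre_digraph + 'c pair_pre_digraph) set rel" where
  "path_poset_gluing G G\<^sub>1 G\<^sub>2 i\<^sub>1 i\<^sub>2 =
     gluing (path_poset G) (path_poset G\<^sub>1) (path_poset G\<^sub>2)
       (path_poset_map G\<^sub>1 i\<^sub>1) (path_poset_map G\<^sub>2 i\<^sub>2)"

end

theory Submission
  imports Defs
begin

text \<open>
  Multipaths of a digraph are the spanning subgraphs whose arc relation is acyclic and functional in
  both directions. This condition passes to subsets, so the path poset is the face poset of a
  simplicial complex on the set of arcs, and a regular morphism embeds it as a down-closed
  subposet. Consequently the faces below an element of the gluing all come from the same \<open>P(G\<^sub>i)\<close>, a
  cochain on the gluing is a pair of cochains on \<open>P(G\<^sub>1)\<close> and \<open>P(G\<^sub>2)\<close> that agree on \<open>P(G)\<close>, and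
  restriction gives the short exact sequence of Mayer--Vietoris type.

  Sign assignments exist on the face poset of a simplicial complex (count the smaller vertices), and
  two of them differ by the coboundary of a function \<open>\<eta>\<close> on the faces. Rescaling the basis by
  \<open>(-1)\<^bsup>\<eta>\<^esup>\<close> therefore makes the restriction maps commute with the differentials for arbitrary
  choices of the four sign assignments.
\<close>

section \<open>Cohomology and the long exact sequence\<close>

text \<open>The elements of the gluing are equivalence classes and its order is a transitive
  closure, so nothing about it is available at the start: not antisymmetry, not the levels, not d d
  = 0. Everything rests on one observation, that descending from an element of one copy never leaves
  that copy. It yields the order, the coverings and the levels of the gluing through the two
  embeddings, and it confines a square to the copy that contains its top. The gluing is therefore
  never presented as a face poset: its signs are patched from one sign assignment on each side after
  a correction on the overlap, and d d = 0 is brought back along the injection into the sum. The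
  functions \<eta> are needed on the three path posets only. They exist there because the intervals
  below the faces are cubes with the empty face as a common corner, and on such a union of cubes
  every 1-cocycle is a coboundary.\<close>

lemma linear_map_iff:
  "linear_map K V W f \<longleftrightarrow> vectorspace K V \<and> vectorspace K W \<and> f \<in> carrier V \<rightarrow> carrier W \<and>
    (\<forall>x\<in>carrier V. \<forall>y\<in>carrier V. f (x \<oplus>\<^bsub>V\<^esub> y) = f x \<oplus>\<^bsub>W\<^esub> f y) \<and>
    (\<forall>k\<in>carrier K. \<forall>x\<in>carrier V. f (k \<odot>\<^bsub>V\<^esub> x) = k \<odot>\<^bsub>W\<^esub> f x)"
  by (auto simp: linear_map_def mod_hom_def mod_hom_axioms_def module_hom_def vectorspace_def)

section \<open>The quotient of a vector space by a subspace\<close>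

locale quotient_vectorspace = vectorspace K V
  for K and V :: "('k, 'v) module" (structure) +
  fixes W
  assumes W: "subspace K W V"
begin

lemma W_subset: "W \<subseteq> carrier V" and W_zero: "\<zero>\<^bsub>V\<^esub> \<in> W"
  and W_add: "\<lbrakk>x \<in> W; y \<in> W\<rbrakk> \<Longrightarrow> x \<oplus>\<^bsub>V\<^esub> y \<in> W"
  and W_smult: "\<lbrakk>k \<in> carrier K; x \<in> W\<rbrakk> \<Longrightarrow> k \<odot>\<^bsub>V\<^esub> x \<in> W"
  using W by (auto simp: subspace_def submodule_def)

lemma W_neg: "x \<in> W \<Longrightarrow> \<ominus>\<^bsub>V\<^esub> x \<in> W"
  using W_smult[of "\<ominus>\<^bsub>K\<^esub> \<one>\<^bsub>K\<^esub>" x] W_subset smult_minus_1 by force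

sublocale abelian_subgroup W V
proof (rule abelian_subgroupI3)
  show "additive_subgroup W V"
    using W_subset W_zero W_add W_neg
    by (intro additive_subgroupI add.subgroupI) auto
  show "abelian_group V" ..
qed

lemma coset_eq_iff:
  assumes "x \<in> carrier V" "y \<in> carrier V"
  shows "W +> x = W +> y \<longleftrightarrow> (\<exists>w\<in>W. x = w \<oplus>\<^bsub>V\<^esub> y)"
proof
  assume "W +> x = W +> y"
  then have "x \<in> W +> y"
    using a_rcos_self[OF assms(1)] by simp
  then show "\<exists>w\<in>W. x = w \<oplus>\<^bsub>V\<^esub> y"
    by (auto simp: a_r_coset_def')
next
  assume "\<exists>w\<in>W. x = w \<oplus>\<^bsub>V\<^esub> y"
  then have "x \<in> W +> y"
    by (auto simp: a_r_coset_def')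
  then show "W +> x = W +> y"
    using a_repr_independence[OF _ assms(2) a_subgroup] by simp
qed

lemma coset_eq_W_iff: "x \<in> carrier V \<Longrightarrow> W +> x = W \<longleftrightarrow> x \<in> W"
  using a_coset_join1 a_coset_join2 a_subgroup by blast

lemma quotient_carrier: "carrier (quotient_space V W) = (\<lambda>x. W +> x) ` carrier V"
  by (auto simp: quotient_space_def A_RCOSETS_def')

lemma quotient_zero: "\<zero>\<^bsub>quotient_space V W\<^esub> = W +> \<zero>\<^bsub>V\<^esub>"
  using coset_eq_W_iff[of "\<zero>\<^bsub>V\<^esub>"] W_zero by (simp add: quotient_space_def)

lemma quotient_add:
  "\<lbrakk>x \<in> carrier V; y \<in> carrier V\<rbrakk> \<Longrightarrow> (W +> x) \<oplus>\<^bsub>quotient_space V W\<^esub> (W +> y) = W +> (x \<oplus>\<^bsub>V\<^esub> y)"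
  by (simp add: quotient_space_def a_rcos_sum)

text \<open>The scalar multiplication of \<open>quotient_space\<close> and the map
  \<open>coh_map\<close> are unions over all representatives. Such a union collapses to the value at
  x once the value does not depend on the representative, because x itself lies in its
  coset.\<close>

lemma UN_coset_eq:
  assumes "x \<in> carrier V" "\<And>y. y \<in> W +> x \<Longrightarrow> F y = F x"
  shows "(\<Union>y\<in>W +> x. F y) = F x"
  using assms a_rcos_self[OF assms(1)] by blast

lemma quotient_smult:
  assumes "k \<in> carrier K" "x \<in> carrier V"
  shows "k \<odot>\<^bsub>quotient_space V W\<^esub> (W +> x) = W +> (k \<odot>\<^bsub>V\<^esub> x)"
proof -
  have "W +> (k \<odot>\<^bsub>V\<^esub> y) = W +> (k \<odot>\<^bsub>V\<^esub> x)" if "y \<in> W +> x" for y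
  proof -
    from that obtain w where w: "w \<in> W" "y = w \<oplus>\<^bsub>V\<^esub> x"
      by (auto simp: a_r_coset_def')
    then have "k \<odot>\<^bsub>V\<^esub> y = k \<odot>\<^bsub>V\<^esub> w \<oplus>\<^bsub>V\<^esub> k \<odot>\<^bsub>V\<^esub> x"
      using assms W_subset by (auto simp: smult_r_distr)
    then show ?thesis
      using assms w W_subset W_smult[of k w] coset_eq_iff[of "k \<odot>\<^bsub>V\<^esub> y" "k \<odot>\<^bsub>V\<^esub> x"] by auto
  qed
  then show ?thesis
    using UN_coset_eq[OF assms(2), of "\<lambda>y. W +> (k \<odot>\<^bsub>V\<^esub> y)"] by (simp add: quotient_space_def)
qed

lemma quotient_vs: "vectorspace K (quotient_space V W)"
proof (rule vs_criteria)
  show "field K" ..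
  show "\<zero>\<^bsub>quotient_space V W\<^esub> \<in> carrier (quotient_space V W)"
    unfolding quotient_zero quotient_carrier by simp
  show "\<forall>v\<in>carrier (quotient_space V W). \<exists>v'\<in>carrier (quotient_space V W).
      v \<oplus>\<^bsub>quotient_space V W\<^esub> v' = \<zero>\<^bsub>quotient_space V W\<^esub>"
  proof
    fix v assume "v \<in> carrier (quotient_space V W)"
    then obtain x where x: "x \<in> carrier V" "v = W +> x"
      by (auto simp: quotient_carrier)
    then have "v \<oplus>\<^bsub>quotient_space V W\<^esub> (W +> \<ominus>\<^bsub>V\<^esub> x) = \<zero>\<^bsub>quotient_space V W\<^esub>"
      using M.r_neg[of x] by (simp add: quotient_add quotient_zero)
    then show "\<exists>v'\<in>carrier (quotient_space V W).
      v \<oplus>\<^bsub>quotient_space V W\<^esub> v' = \<zero>\<^bsub>quotient_space V W\<^esub>"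
      using x by (auto simp: quotient_carrier)
  qed
qed (auto simp: quotient_carrier quotient_add quotient_smult quotient_zero M.a_ac
      smult_assoc1 smult_l_distr smult_r_distr)

end

section \<open>Cohomology classes and the maps induced on them\<close>

locale complex =
  fixes K :: "('k, 'm) ring_scheme" and C :: "('k, 'v) cochains"
  assumes complex: "cochain_complex K C"
begin

lemma coch_vs: "vectorspace K (coch C n)"
  and cobd_linear: "linear_map K (coch C n) (coch C (n + 1)) (cobd C n)"
  and cobd_cobd: "x \<in> carrier (coch C n) \<Longrightarrow> cobd C (n + 1) (cobd C n x) = \<zero>\<^bsub>coch C (n + 1 + 1)\<^esub>"
  using complex by (auto simp: cochain_complex_def)

lemma mem_cocycles:
  "x \<in> cocycles C n \<longleftrightarrow> x \<in> carrier (coch C n) \<and> cobd C n x = \<zero>\<^bsub>coch C (n + 1)\<^esub>"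
  by (simp add: cocycles_def a_kernel_def')

lemma coboundary_cocycle: "x \<in> carrier (coch C n) \<Longrightarrow> cobd C n x \<in> cocycles C (n + 1)"
  using cobd_cobd cobd_linear[of n] by (auto simp: mem_cocycles linear_map_iff)

lemma coboundaries_Suc: "coboundaries C (n + 1) = cobd C n ` carrier (coch C n)"
  by (simp add: coboundaries_def)

lemma coboundaries_subset: "coboundaries C n \<subseteq> cocycles C n"
  using coboundary_cocycle[of _ "n - 1"] by (auto simp: coboundaries_def)

lemma subspace_cocycles: "subspace K (cocycles C n) (coch C n)"
proof -
  interpret linear_map K "coch C n" "coch C (n + 1)" "cobd C n" by (rule cobd_linear)
  show ?thesis
    using kerT_is_subspace by (simp add: ker_def cocycles_def a_kernel_def')
qed

text \<open>Coboundaries are the image of a linear map and are cocycles because d d = 0. This makes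
  \<open>cohomology\<close> an instance of the quotient calculus above.\<close>

lemma quotient_cohomology:
  "quotient_vectorspace K ((coch C n)\<lparr>carrier := cocycles C n\<rparr>) (coboundaries C n)"
proof -
  interpret V: vectorspace K "coch C n" by (rule coch_vs)
  \<comment> \<open>The target has degree n - 1 + 1 because differentials are indexed by their
    source; simplification turns it into n.\<close>
  interpret d: linear_map K "coch C (n - 1)" "coch C (n - 1 + 1)" "cobd C (n - 1)"
    by (rule cobd_linear)
  interpret Z: vectorspace K "(coch C n)\<lparr>carrier := cocycles C n\<rparr>"
    by (rule V.subspace_is_vs[OF subspace_cocycles])
  have "subspace K (coboundaries C n) (coch C n)"
    using d.imT_is_subspace by (simp add: d.im_def coboundaries_def)
  then have "subspace K (coboundaries C n) ((coch C n)\<lparr>carrier := cocycles C n\<rparr>)"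
    using coboundaries_subset[of n] Z.module_axioms Z.vectorspace_axioms
    by (auto simp: subspace_def submodule_def)
  then show ?thesis
    by (simp add: quotient_vectorspace_def quotient_vectorspace_axioms_def Z.vectorspace_axioms)
qed

text \<open>A coset depends on the addition only, which is unchanged when the carrier is restricted
  to the cocycles. The definition of a class uses the large space, the quotient calculus the small
  one.\<close>

lemma coh_class_coset:
  "coh_class C n x = coboundaries C n +>\<^bsub>(coch C n)\<lparr>carrier := cocycles C n\<rparr>\<^esub> x"
  by (simp add: coh_class_def a_r_coset_def')

lemma cohomology_vs: "vectorspace K (cohomology C n)"
  unfolding cohomology_def by (rule quotient_vectorspace.quotient_vs[OF quotient_cohomology])

lemma cohomology_carrier: "carrier (cohomology C n) = coh_class C n ` cocycles C n"
  unfolding cohomology_def quotient_vectorspace.quotient_carrier[OF quotient_cohomology]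
  by (simp add: coh_class_coset)

lemma coh_class_add:
  assumes "x \<in> cocycles C n" "y \<in> cocycles C n"
  shows "coh_class C n x \<oplus>\<^bsub>cohomology C n\<^esub> coh_class C n y = coh_class C n (x \<oplus>\<^bsub>coch C n\<^esub> y)"
  using quotient_vectorspace.quotient_add[OF quotient_cohomology, of x n y] assms
  by (simp add: coh_class_coset cohomology_def)

lemma coh_class_smult:
  assumes "k \<in> carrier K" "x \<in> cocycles C n"
  shows "k \<odot>\<^bsub>cohomology C n\<^esub> coh_class C n x = coh_class C n (k \<odot>\<^bsub>coch C n\<^esub> x)"
  using quotient_vectorspace.quotient_smult[OF quotient_cohomology, of k x n] assms
  by (simp add: coh_class_coset cohomology_def)

lemma coh_class_eq_iff:
  assumes "x \<in> cocycles C n" "y \<in> cocycles C n"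
  shows "coh_class C n x = coh_class C n y \<longleftrightarrow> (\<exists>u\<in>coboundaries C n. x = u \<oplus>\<^bsub>coch C n\<^esub> y)"
  using quotient_vectorspace.coset_eq_iff[OF quotient_cohomology, of x n y] assms
  by (simp add: coh_class_coset)

lemma coh_class_zero_iff:
  assumes "x \<in> cocycles C n"
  shows "coh_class C n x = \<zero>\<^bsub>cohomology C n\<^esub> \<longleftrightarrow> x \<in> coboundaries C n"
  using quotient_vectorspace.coset_eq_W_iff[OF quotient_cohomology, of x n] assms
  by (simp add: coh_class_coset cohomology_def quotient_space_def)

lemma coh_class_zero: "coh_class C n \<zero>\<^bsub>coch C n\<^esub> = \<zero>\<^bsub>cohomology C n\<^esub>"
  using quotient_vectorspace.quotient_zero[OF quotient_cohomology, of n]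
  by (simp add: coh_class_coset cohomology_def)

lemma cocycles_add: "\<lbrakk>x \<in> cocycles C n; y \<in> cocycles C n\<rbrakk> \<Longrightarrow> x \<oplus>\<^bsub>coch C n\<^esub> y \<in> cocycles C n"
  and cocycles_smult: "\<lbrakk>k \<in> carrier K; x \<in> cocycles C n\<rbrakk> \<Longrightarrow> k \<odot>\<^bsub>coch C n\<^esub> x \<in> cocycles C n"
  using subspace_cocycles[of n] by (auto simp: subspace_def submodule_def)

text \<open>Every member of the class of a cocycle is again a cocycle, since coboundaries are; so
  independence of the representative has to be checked for cohomologous cocycles only.\<close>

lemma coh_class_union:
  assumes "x \<in> cocycles C n"
    and "\<And>y. \<lbrakk>y \<in> cocycles C n; coh_class C n y = coh_class C n x\<rbrakk> \<Longrightarrow> F y = F x"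
  shows "(\<Union>y\<in>coh_class C n x. F y) = F x"
proof -
  interpret Q: quotient_vectorspace K "(coch C n)\<lparr>carrier := cocycles C n\<rparr>" "coboundaries C n"
    by (rule quotient_cohomology)
  have "F y = F x" if "y \<in> coh_class C n x" for y
  proof (rule assms(2))
    from that obtain u where u: "u \<in> coboundaries C n" "y = u \<oplus>\<^bsub>coch C n\<^esub> x"
      by (auto simp: coh_class_def a_r_coset_def')
    then show y: "y \<in> cocycles C n"
      using coboundaries_subset assms(1) cocycles_add by blast
    show "coh_class C n y = coh_class C n x"
      using coh_class_eq_iff[OF y assms(1)] u by auto
  qed
  then show ?thesis
    using Q.UN_coset_eq[of x F] assms(1) by (simp add: coh_class_coset)
qed

text \<open>Here \<phi> is F read on representatives. The equation between them already contains
  that \<phi> is constant on classes, so additivity and homogeneity can be checked on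
  cocycles.\<close>

lemma linear_map_cohomologyI:
  assumes "vectorspace K W" "\<And>x. x \<in> cocycles C n \<Longrightarrow> F (coh_class C n x) = \<phi> x"
    and "\<And>x. x \<in> cocycles C n \<Longrightarrow> \<phi> x \<in> carrier W"
    and "\<And>x y. \<lbrakk>x \<in> cocycles C n; y \<in> cocycles C n\<rbrakk> \<Longrightarrow> \<phi> (x \<oplus>\<^bsub>coch C n\<^esub> y) = \<phi> x \<oplus>\<^bsub>W\<^esub> \<phi> y"
    and "\<And>k x. \<lbrakk>k \<in> carrier K; x \<in> cocycles C n\<rbrakk> \<Longrightarrow> \<phi> (k \<odot>\<^bsub>coch C n\<^esub> x) = k \<odot>\<^bsub>W\<^esub> \<phi> x"
  shows "linear_map K (cohomology C n) W F"
  unfolding linear_map_iff using assms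
  by (auto simp: cohomology_vs cohomology_carrier coh_class_add coh_class_smult
      cocycles_add cocycles_smult)

end

lemma cochain_mapD:
  assumes "cochain_map K C D f"
  shows "linear_map K (coch C n) (coch D n) (f n)"
    and "x \<in> carrier (coch C n) \<Longrightarrow> f n x \<in> carrier (coch D n)"
    and "x \<in> carrier (coch C n) \<Longrightarrow> f (n + 1) (cobd C n x) = cobd D n (f n x)"
    and "\<lbrakk>x \<in> carrier (coch C n); y \<in> carrier (coch C n)\<rbrakk> \<Longrightarrow>
      f n (x \<oplus>\<^bsub>coch C n\<^esub> y) = f n x \<oplus>\<^bsub>coch D n\<^esub> f n y"
    and "\<lbrakk>k \<in> carrier K; x \<in> carrier (coch C n)\<rbrakk> \<Longrightarrow>
      f n (k \<odot>\<^bsub>coch C n\<^esub> x) = k \<odot>\<^bsub>coch D n\<^esub> f n x"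
    and "f n \<zero>\<^bsub>coch C n\<^esub> = \<zero>\<^bsub>coch D n\<^esub>"
proof -
  show l: "linear_map K (coch C n) (coch D n) (f n)"
    using assms by (simp add: cochain_map_def)
  show "x \<in> carrier (coch C n) \<Longrightarrow> f (n + 1) (cobd C n x) = cobd D n (f n x)"
    using assms by (simp add: cochain_map_def)
  interpret linear_map K "coch C n" "coch D n" "f n" by (rule l)
  show "x \<in> carrier (coch C n) \<Longrightarrow> f n x \<in> carrier (coch D n)"
    "\<lbrakk>x \<in> carrier (coch C n); y \<in> carrier (coch C n)\<rbrakk> \<Longrightarrow>
      f n (x \<oplus>\<^bsub>coch C n\<^esub> y) = f n x \<oplus>\<^bsub>coch D n\<^esub> f n y"
    "\<lbrakk>k \<in> carrier K; x \<in> carrier (coch C n)\<rbrakk> \<Longrightarrow>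
      f n (k \<odot>\<^bsub>coch C n\<^esub> x) = k \<odot>\<^bsub>coch D n\<^esub> f n x"
    "f n \<zero>\<^bsub>coch C n\<^esub> = \<zero>\<^bsub>coch D n\<^esub>"
    by simp_all
qed

lemma cochain_map_comp:
  assumes "cochain_map K C D f" "cochain_map K D E g"
  shows "cochain_map K C E (\<lambda>n. g n \<circ> f n)"
  unfolding cochain_map_def
proof (intro allI conjI ballI)
  fix n
  show "linear_map K (coch C n) (coch E n) (g n \<circ> f n)"
    using cochain_mapD(1)[OF assms(1), of n] cochain_mapD(1)[OF assms(2), of n]
    by (auto simp: linear_map_iff Pi_iff)
  show "(g (n + 1) \<circ> f (n + 1)) (cobd C n x) = cobd E n ((g n \<circ> f n) x)" if "x \<in> carrier (coch C n)" for x
    using that cochain_mapD[OF assms(1)] cochain_mapD[OF assms(2)] by simp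
qed

lemma cochain_map_cocycles:
  assumes "cochain_map K C D f" "x \<in> cocycles C n"
  shows "f n x \<in> cocycles D n"
  using assms(2) cochain_mapD(2,3)[OF assms(1), of x n] cochain_mapD(6)[OF assms(1), of "n + 1"]
  by (auto simp: cocycles_def a_kernel_def')

text \<open>A cochain map sends the coboundary of u to the coboundary of f u, so cohomologous
  cocycles have cohomologous images and the union over representatives collapses.\<close>

lemma coh_map_class:
  assumes "complex K C" "complex K D" "cochain_map K C D f" "x \<in> cocycles C n"
  shows "coh_map D f n (coh_class C n x) = coh_class D n (f n x)"
  unfolding coh_map_def
proof (rule complex.coh_class_union[OF assms(1,4)])
  interpret C: complex K C by fact
  interpret D: complex K D by fact
  fix y assume y: "y \<in> cocycles C n" "coh_class C n y = coh_class C n x"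
  then obtain u where u: "u \<in> carrier (coch C (n - 1))" "y = cobd C (n - 1) u \<oplus>\<^bsub>coch C n\<^esub> x"
    using assms(4) by (auto simp: C.coh_class_eq_iff coboundaries_def)
  note f = cochain_mapD[OF assms(3)]
  have "cobd C (n - 1) u \<in> carrier (coch C n)"
    using C.coboundary_cocycle[OF u(1)] by (simp add: C.mem_cocycles)
  then have "f n y = cobd D (n - 1) (f (n - 1) u) \<oplus>\<^bsub>coch D n\<^esub> f n x"
    using f(3)[OF u(1)] f(4)[of "cobd C (n - 1) u" n x] assms(4) u(2)
    by (simp add: C.mem_cocycles)
  moreover have "cobd D (n - 1) (f (n - 1) u) \<in> coboundaries D n"
    using f(2)[OF u(1)] by (simp add: coboundaries_def)
  ultimately show "coh_class D n (f n y) = coh_class D n (f n x)"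
    using D.coh_class_eq_iff[OF cochain_map_cocycles[OF assms(3) y(1)]
        cochain_map_cocycles[OF assms(3,4)]] by blast
qed

lemma coh_map_linear:
  assumes "complex K C" "complex K D" "cochain_map K C D f"
  shows "linear_map K (cohomology C n) (cohomology D n) (coh_map D f n)"
proof -
  interpret C: complex K C by fact
  interpret D: complex K D by fact
  note f = cochain_mapD[OF assms(3)] cochain_map_cocycles[OF assms(3)]
  show ?thesis
  proof (rule C.linear_map_cohomologyI[where \<phi> = "\<lambda>x. coh_class D n (f n x)"])
    show "vectorspace K (cohomology D n)"
      by (rule D.cohomology_vs)
    show "coh_map D f n (coh_class C n x) = coh_class D n (f n x)" if "x \<in> cocycles C n" for x
      by (rule coh_map_class[OF assms that])
  qed (use f(4,5,7) in \<open>simp_all add: C.mem_cocycles D.coh_class_add D.coh_class_smult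
      D.cohomology_carrier\<close>)
qed

section \<open>The connecting homomorphism and exactness in cohomology\<close>

locale short_exact =
  fixes K :: "('k, 'm) ring_scheme" and A :: "('k, 'u) cochains" and B :: "('k, 'v) cochains"
    and C :: "('k, 'w) cochains" and f g
  assumes ses: "short_exact_sequence K A B C f g"
begin

sublocale A: complex K A
  using ses by (simp add: short_exact_sequence_def complex_def)

sublocale B: complex K B
  using ses by (simp add: short_exact_sequence_def complex_def)

sublocale C: complex K C
  using ses by (simp add: short_exact_sequence_def complex_def)

lemma f_map: "cochain_map K A B f" and g_map: "cochain_map K B C g"
  and f_inj: "inj_on (f n) (carrier (coch A n))"
  and g_surj: "g n ` carrier (coch B n) = carrier (coch C n)"
  using ses by (simp_all add: short_exact_sequence_def)

lemmas f_simps = cochain_mapD(2-6)[OF f_map] and g_simps = cochain_mapD(2-6)[OF g_map]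

lemma exact: "f n ` carrier (coch A n) = {b \<in> carrier (coch B n). g n b = \<zero>\<^bsub>coch C n\<^esub>}"
  using ses by (simp add: short_exact_sequence_def exact_at_def a_kernel_def')

lemma g_f: "a \<in> carrier (coch A n) \<Longrightarrow> g n (f n a) = \<zero>\<^bsub>coch C n\<^esub>"
  using exact by blast

text \<open>As g commutes with the differentials, d b is killed by g as soon as g b is a cocycle;
  exactness in the middle then supplies a.\<close>

lemma ex_lift:
  assumes "b \<in> carrier (coch B n)" "g n b \<in> cocycles C n"
  shows "\<exists>a\<in>carrier (coch A (n + 1)). f (n + 1) a = cobd B n b"
proof -
  have "cobd B n b \<in> {b \<in> carrier (coch B (n + 1)). g (n + 1) b = \<zero>\<^bsub>coch C (n + 1)\<^esub>}"
    using B.coboundary_cocycle[OF assms(1)] assms g_simps(2)[OF assms(1)]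
    by (simp add: B.mem_cocycles C.mem_cocycles)
  then show ?thesis
    unfolding exact[symmetric] by force
qed

text \<open>From f (d a) = d (f a) = d (d b) = 0 and the injectivity of f.\<close>

lemma lift_cocycle:
  assumes "b \<in> carrier (coch B n)" "a \<in> carrier (coch A (n + 1))" "f (n + 1) a = cobd B n b"
  shows "a \<in> cocycles A (n + 1)"
proof -
  have da: "cobd A (n + 1) a \<in> carrier (coch A (n + 1 + 1))"
    using A.coboundary_cocycle[OF assms(2)] by (simp add: A.mem_cocycles)
  interpret A2: vectorspace K "coch A (n + 1 + 1)" by (rule A.coch_vs)
  have "f (n + 1 + 1) (cobd A (n + 1) a) = f (n + 1 + 1) \<zero>\<^bsub>coch A (n + 1 + 1)\<^esub>"
    using f_simps(2)[OF assms(2)] assms(3) B.cobd_cobd[OF assms(1)] f_simps(5) by simp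
  then show ?thesis
    using inj_onD[OF f_inj _ da A2.M.zero_closed] assms(2) by (simp add: A.mem_cocycles)
qed

text \<open>Exactness in the middle, applied to x - y. The conclusion is written as a sum to match
  the form in which \<open>coh_class_eq_iff\<close> describes equal classes.\<close>

lemma eq_add_f_if_g_eq:
  assumes "x \<in> carrier (coch B n)" "y \<in> carrier (coch B n)" "g n x = g n y"
  shows "\<exists>w\<in>carrier (coch A n). x = f n w \<oplus>\<^bsub>coch B n\<^esub> y"
proof -
  interpret V: vectorspace K "coch B n" by (rule B.coch_vs)
  interpret W: vectorspace K "coch C n" by (rule C.coch_vs)
  interpret g: linear_map K "coch B n" "coch C n" "g n" by (rule cochain_mapD(1)[OF g_map])
  have "g n (x \<ominus>\<^bsub>coch B n\<^esub> y) = \<zero>\<^bsub>coch C n\<^esub>"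
    using assms by (simp add: W.M.r_neg a_minus_def)
  then have "x \<ominus>\<^bsub>coch B n\<^esub> y \<in> f n ` carrier (coch A n)"
    using assms by (simp add: exact)
  then obtain w where "w \<in> carrier (coch A n)" "f n w = x \<ominus>\<^bsub>coch B n\<^esub> y"
    by auto
  moreover have "x = (x \<ominus>\<^bsub>coch B n\<^esub> y) \<oplus>\<^bsub>coch B n\<^esub> y"
    using assms by (simp add: a_minus_def V.M.a_assoc V.M.l_neg)
  ultimately show ?thesis
    by metis
qed

text \<open>The coboundary by which g b and g b' differ is lifted along g to the coboundary of some
  v. Then b - d v - b' is in the kernel of g, hence equal to f w. Applying d removes d v, and
  injectivity of f leaves a - a' = d w.\<close>

lemma connecting_unique:
  assumes "b \<in> carrier (coch B n)" "a \<in> carrier (coch A (n + 1))" "f (n + 1) a = cobd B n b"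
    and "b' \<in> carrier (coch B n)" "a' \<in> carrier (coch A (n + 1))" "f (n + 1) a' = cobd B n b'"
    and "g n b \<in> cocycles C n" "g n b' \<in> cocycles C n"
    and "coh_class C n (g n b) = coh_class C n (g n b')"
  shows "coh_class A (n + 1) a = coh_class A (n + 1) a'"
proof -
  interpret Vn: vectorspace K "coch B n" by (rule B.coch_vs)
  interpret VS: vectorspace K "coch B (n + 1)" by (rule B.coch_vs)
  interpret AS: vectorspace K "coch A (n + 1)" by (rule A.coch_vs)
  interpret d: linear_map K "coch B n" "coch B (n + 1)" "cobd B n" by (rule B.cobd_linear)
  obtain u where u: "u \<in> carrier (coch C (n - 1))" "g n b = cobd C (n - 1) u \<oplus>\<^bsub>coch C n\<^esub> g n b'"
    using assms(7,8,9) by (auto simp: C.coh_class_eq_iff coboundaries_def)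
  then obtain v where v: "v \<in> carrier (coch B (n - 1))" "u = g (n - 1) v"
    using g_surj[of "n - 1"] by auto
  define dv where "dv = cobd B (n - 1) v"
  have dv: "dv \<in> carrier (coch B n)" "cobd B n dv = \<zero>\<^bsub>coch B (n + 1)\<^esub>"
    using B.coboundary_cocycle[OF v(1)] by (simp_all add: B.mem_cocycles dv_def)
  have "g n dv = cobd C (n - 1) u"
    using g_simps(2)[OF v(1)] v(2) by (simp add: dv_def)
  then have "g n b = g n (dv \<oplus>\<^bsub>coch B n\<^esub> b')"
    using u(2) dv(1) assms(4) by (simp add: g_simps(3))
  then obtain w where w: "w \<in> carrier (coch A n)" "b = f n w \<oplus>\<^bsub>coch B n\<^esub> (dv \<oplus>\<^bsub>coch B n\<^esub> b')"
    using eq_add_f_if_g_eq[of b n "dv \<oplus>\<^bsub>coch B n\<^esub> b'"] assms(1,4) dv(1) by auto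
  have dw: "cobd A n w \<in> carrier (coch A (n + 1))"
    using A.coboundary_cocycle[OF w(1)] by (simp add: A.mem_cocycles)
  have "f (n + 1) a = f (n + 1) (cobd A n w \<oplus>\<^bsub>coch A (n + 1)\<^esub> a')"
    using w assms(3,4,5,6) dv dw by (simp add: f_simps)
  then have "a = cobd A n w \<oplus>\<^bsub>coch A (n + 1)\<^esub> a'"
    using inj_onD[OF f_inj] assms(2,5) dw by auto
  then show ?thesis
    using A.coh_class_eq_iff[OF lift_cocycle[OF assms(1-3)] lift_cocycle[OF assms(4-6)]] w(1)
    by (auto simp: A.coboundaries_Suc)
qed

text \<open>The choice is only apparent: by \<open>connecting_unique\<close> at most one Y
  qualifies. On sets that are not classes of cocycles the value is arbitrary.\<close>

definition \<delta> :: "int \<Rightarrow> 'w set \<Rightarrow> 'u set" where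
  "\<delta> n X = (SOME Y. \<exists>b\<in>carrier (coch B n). \<exists>a\<in>carrier (coch A (n + 1)).
     g n b \<in> cocycles C n \<and> f (n + 1) a = cobd B n b \<and> X = coh_class C n (g n b) \<and>
     Y = coh_class A (n + 1) a)"

lemma delta_class:
  assumes "b \<in> carrier (coch B n)" "a \<in> carrier (coch A (n + 1))"
    and "g n b \<in> cocycles C n" "f (n + 1) a = cobd B n b"
  shows "\<delta> n (coh_class C n (g n b)) = coh_class A (n + 1) a"
  unfolding \<delta>_def
proof (rule some_equality)
  show "\<exists>b'\<in>carrier (coch B n). \<exists>a'\<in>carrier (coch A (n + 1)).
     g n b' \<in> cocycles C n \<and> f (n + 1) a' = cobd B n b' \<and>
     coh_class C n (g n b) = coh_class C n (g n b') \<and> coh_class A (n + 1) a = coh_class A (n + 1) a'"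
    using assms by blast
next
  fix Y
  assume "\<exists>b'\<in>carrier (coch B n). \<exists>a'\<in>carrier (coch A (n + 1)).
     g n b' \<in> cocycles C n \<and> f (n + 1) a' = cobd B n b' \<and>
     coh_class C n (g n b) = coh_class C n (g n b') \<and> Y = coh_class A (n + 1) a'"
  then show "Y = coh_class A (n + 1) a"
    using connecting_unique assms by metis
qed

lemma ex_representative:
  assumes "c \<in> cocycles C n"
  obtains b a where "b \<in> carrier (coch B n)" "a \<in> cocycles A (n + 1)"
    "g n b = c" "f (n + 1) a = cobd B n b"
proof -
  obtain b where b: "b \<in> carrier (coch B n)" "g n b = c"
    using assms g_surj[of n] by (metis C.mem_cocycles imageE)
  then obtain a where "a \<in> carrier (coch A (n + 1))" "f (n + 1) a = cobd B n b"
    using ex_lift assms by blast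
  then show thesis
    using b lift_cocycle that by blast
qed

text \<open>The lifts b and a are chosen for each cocycle separately, but sums and multiples of
  lifts are lifts of the sums and multiples, so linearity is inherited from d, f and g.\<close>

lemma delta_linear: "linear_map K (cohomology C n) (cohomology A (n + 1)) (\<delta> n)"
proof (rule C.linear_map_cohomologyI[where \<phi> = "\<lambda>c. \<delta> n (coh_class C n c)"])
  interpret d: linear_map K "coch B n" "coch B (n + 1)" "cobd B n" by (rule B.cobd_linear)
  show "vectorspace K (cohomology A (n + 1))"
    by (rule A.cohomology_vs)
  fix c assume c: "c \<in> cocycles C n"
  obtain b a where ba: "b \<in> carrier (coch B n)" "a \<in> cocycles A (n + 1)" "g n b = c"
    "f (n + 1) a = cobd B n b"
    using ex_representative[OF c] .
  have \<delta>: "\<delta> n (coh_class C n c) = coh_class A (n + 1) a"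
    using delta_class[of b n a] ba c by (simp add: A.mem_cocycles)
  show "\<delta> n (coh_class C n c) \<in> carrier (cohomology A (n + 1))"
    using \<delta> ba(2) by (simp add: A.cohomology_carrier)
  show "\<delta> n (coh_class C n (k \<odot>\<^bsub>coch C n\<^esub> c)) = k \<odot>\<^bsub>cohomology A (n + 1)\<^esub> \<delta> n (coh_class C n c)"
    if k: "k \<in> carrier K" for k
  proof -
    have "k \<odot>\<^bsub>coch A (n + 1)\<^esub> a \<in> cocycles A (n + 1)"
      using A.cocycles_smult k ba by simp
    then show ?thesis
      using delta_class[of "k \<odot>\<^bsub>coch B n\<^esub> b" n "k \<odot>\<^bsub>coch A (n + 1)\<^esub> a"] k ba c
        C.cocycles_smult[OF k c]
      by (simp add: A.mem_cocycles f_simps g_simps \<delta> A.coh_class_smult)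
  qed
  fix c' assume c': "c' \<in> cocycles C n"
  obtain b' a' where ba': "b' \<in> carrier (coch B n)" "a' \<in> cocycles A (n + 1)" "g n b' = c'"
    "f (n + 1) a' = cobd B n b'"
    using ex_representative[OF c'] .
  have \<delta>': "\<delta> n (coh_class C n c') = coh_class A (n + 1) a'"
    using delta_class[of b' n a'] ba' c' by (simp add: A.mem_cocycles)
  have "a \<oplus>\<^bsub>coch A (n + 1)\<^esub> a' \<in> cocycles A (n + 1)"
    using A.cocycles_add ba ba' by simp
  then show "\<delta> n (coh_class C n (c \<oplus>\<^bsub>coch C n\<^esub> c')) =
      \<delta> n (coh_class C n c) \<oplus>\<^bsub>cohomology A (n + 1)\<^esub> \<delta> n (coh_class C n c')"
    using delta_class[of "b \<oplus>\<^bsub>coch B n\<^esub> b'" n "a \<oplus>\<^bsub>coch A (n + 1)\<^esub> a'"] ba ba' c c'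
      C.cocycles_add[OF c c']
    by (simp add: A.mem_cocycles f_simps g_simps \<delta> \<delta>' A.coh_class_add)
qed simp

lemma connecting: "connecting_hom K A B C f g \<delta>"
  using delta_linear delta_class by (auto simp: connecting_hom_def)

text \<open>If g b is the coboundary of u and v lifts u, then b - d v is killed by g and so equals
  some f a; here a is a cocycle because f is injective. Conversely g f = 0.\<close>

lemma exact_cohomology_B:
  assumes "b \<in> cocycles B n"
  shows "coh_class C n (g n b) = \<zero>\<^bsub>cohomology C n\<^esub> \<longleftrightarrow>
    (\<exists>a\<in>cocycles A n. coh_class B n (f n a) = coh_class B n b)"
proof
  assume "coh_class C n (g n b) = \<zero>\<^bsub>cohomology C n\<^esub>"
  then obtain u where u: "u \<in> carrier (coch C (n - 1))" "g n b = cobd C (n - 1) u"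
    using C.coh_class_zero_iff cochain_map_cocycles[OF g_map assms]
    by (auto simp: coboundaries_def)
  then obtain v where v: "v \<in> carrier (coch B (n - 1))" "u = g (n - 1) v"
    using g_surj[of "n - 1"] by auto
  define dv where "dv = cobd B (n - 1) v"
  have dv: "dv \<in> cocycles B n" "dv \<in> coboundaries B n"
    using B.coboundary_cocycle[OF v(1)] v by (auto simp: dv_def coboundaries_def)
  have "g n b = g n dv"
    using g_simps(2)[OF v(1)] u v by (simp add: dv_def)
  then obtain a where a: "a \<in> carrier (coch A n)" "b = f n a \<oplus>\<^bsub>coch B n\<^esub> dv"
    using eq_add_f_if_g_eq assms dv by (metis B.mem_cocycles)
  interpret V: vectorspace K "coch B n" by (rule B.coch_vs)
  interpret V1: vectorspace K "coch B (n + 1)" by (rule B.coch_vs)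
  interpret A1: vectorspace K "coch A (n + 1)" by (rule A.coch_vs)
  interpret d: linear_map K "coch B n" "coch B (n + 1)" "cobd B n" by (rule B.cobd_linear)
  have "cobd B n (f n a) = \<zero>\<^bsub>coch B (n + 1)\<^esub>"
    using assms dv a by (auto simp: B.mem_cocycles f_simps)
  then have fa: "f n a \<in> cocycles B n"
    using a(1) by (simp add: B.mem_cocycles f_simps)
  have "f (n + 1) (cobd A n a) = f (n + 1) \<zero>\<^bsub>coch A (n + 1)\<^esub>"
    using a(1) fa by (simp add: f_simps B.mem_cocycles)
  then have "a \<in> cocycles A n"
    using inj_onD[OF f_inj, of "n + 1" "cobd A n a"] a(1) A.coboundary_cocycle[OF a(1)]
    by (simp add: A.mem_cocycles)
  moreover have "b = dv \<oplus>\<^bsub>coch B n\<^esub> f n a"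
    using a dv V.M.a_comm by (simp add: f_simps B.mem_cocycles)
  ultimately show "\<exists>a\<in>cocycles A n. coh_class B n (f n a) = coh_class B n b"
    using B.coh_class_eq_iff[OF assms fa] dv(2) by metis
next
  assume "\<exists>a\<in>cocycles A n. coh_class B n (f n a) = coh_class B n b"
  then obtain a where a: "a \<in> cocycles A n" "coh_class B n (f n a) = coh_class B n b"
    by blast
  have "coh_class C n (g n b) = coh_map C g n (coh_class B n b)"
    using coh_map_class[OF B.complex_axioms C.complex_axioms g_map assms] by simp
  also have "\<dots> = coh_class C n (g n (f n a))"
    using coh_map_class[OF B.complex_axioms C.complex_axioms g_map cochain_map_cocycles[OF f_map a(1)]]
      a(2) by simp
  also have "\<dots> = \<zero>\<^bsub>cohomology C n\<^esub>"
    using a by (simp add: g_f A.mem_cocycles C.coh_class_zero)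
  finally show "coh_class C n (g n b) = \<zero>\<^bsub>cohomology C n\<^esub>" .
qed

text \<open>If the lift a of d b is itself a coboundary d w, then b - f w is a cocycle with the same
  image under g as b. Conversely, for a cocycle b the lift of d b = 0 can be taken to be 0.\<close>

lemma exact_cohomology_C:
  assumes "c \<in> cocycles C n"
  shows "\<delta> n (coh_class C n c) = \<zero>\<^bsub>cohomology A (n + 1)\<^esub> \<longleftrightarrow>
    (\<exists>b\<in>cocycles B n. coh_class C n (g n b) = coh_class C n c)"
proof
  interpret V: vectorspace K "coch B n" by (rule B.coch_vs)
  interpret V1: vectorspace K "coch B (n + 1)" by (rule B.coch_vs)
  interpret d: linear_map K "coch B n" "coch B (n + 1)" "cobd B n" by (rule B.cobd_linear)
  interpret g: linear_map K "coch B n" "coch C n" "g n" by (rule cochain_mapD(1)[OF g_map])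
  assume 0: "\<delta> n (coh_class C n c) = \<zero>\<^bsub>cohomology A (n + 1)\<^esub>"
  obtain b a where ba: "b \<in> carrier (coch B n)" "a \<in> cocycles A (n + 1)" "g n b = c"
    "f (n + 1) a = cobd B n b"
    using ex_representative[OF assms] .
  have "coh_class A (n + 1) a = \<zero>\<^bsub>cohomology A (n + 1)\<^esub>"
    using delta_class[of b n a] ba assms 0 by (simp add: A.mem_cocycles)
  then obtain w where w: "w \<in> carrier (coch A n)" "a = cobd A n w"
    using A.coh_class_zero_iff[OF ba(2)] by (auto simp: A.coboundaries_Suc)
  have fw: "f n w \<in> carrier (coch B n)"
    using w f_simps by simp
  have "b \<ominus>\<^bsub>coch B n\<^esub> f n w \<in> cocycles B n"
    using ba w fw by (simp add: B.mem_cocycles f_simps V1.M.r_neg a_minus_def)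
  moreover have "g n (b \<ominus>\<^bsub>coch B n\<^esub> f n w) = c"
    using ba w fw assms by (simp add: g_f a_minus_def C.mem_cocycles)
  ultimately show "\<exists>b\<in>cocycles B n. coh_class C n (g n b) = coh_class C n c"
    by metis
next
  assume "\<exists>b\<in>cocycles B n. coh_class C n (g n b) = coh_class C n c"
  then obtain b where b: "b \<in> cocycles B n" "coh_class C n (g n b) = coh_class C n c"
    by blast
  interpret A1: vectorspace K "coch A (n + 1)" by (rule A.coch_vs)
  have "\<delta> n (coh_class C n c) = coh_class A (n + 1) \<zero>\<^bsub>coch A (n + 1)\<^esub>"
    using delta_class[of b n "\<zero>\<^bsub>coch A (n + 1)\<^esub>"] b cochain_map_cocycles[OF g_map]
    by (simp add: B.mem_cocycles f_simps)
  then show "\<delta> n (coh_class C n c) = \<zero>\<^bsub>cohomology A (n + 1)\<^esub>"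
    by (simp add: A.coh_class_zero)
qed

text \<open>If f a = d b, then c = g b is a cocycle whose image under \<delta> is the class of a, by
  the very construction of \<delta>. Conversely the value of \<delta> is the class of some a' with f
  a' = d b, which vanishes in the cohomology of B.\<close>

lemma exact_cohomology_A:
  assumes "a \<in> cocycles A (n + 1)"
  shows "coh_class B (n + 1) (f (n + 1) a) = \<zero>\<^bsub>cohomology B (n + 1)\<^esub> \<longleftrightarrow>
    (\<exists>c\<in>cocycles C n. \<delta> n (coh_class C n c) = coh_class A (n + 1) a)"
proof
  interpret Cn: vectorspace K "coch C n" by (rule C.coch_vs)
  assume "coh_class B (n + 1) (f (n + 1) a) = \<zero>\<^bsub>cohomology B (n + 1)\<^esub>"
  then obtain b where b: "b \<in> carrier (coch B n)" "f (n + 1) a = cobd B n b"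
    using B.coh_class_zero_iff cochain_map_cocycles[OF f_map assms]
    by (auto simp: B.coboundaries_Suc)
  then have "g n b \<in> cocycles C n"
    using g_simps(1,2)[OF b(1)] g_f[of a "n + 1"] assms
    by (simp add: C.mem_cocycles A.mem_cocycles)
  then show "\<exists>c\<in>cocycles C n. \<delta> n (coh_class C n c) = coh_class A (n + 1) a"
    using delta_class[OF b(1) _ _ b(2)] assms by (auto simp: A.mem_cocycles)
next
  assume "\<exists>c\<in>cocycles C n. \<delta> n (coh_class C n c) = coh_class A (n + 1) a"
  then obtain c where c: "c \<in> cocycles C n" "\<delta> n (coh_class C n c) = coh_class A (n + 1) a"
    by blast
  obtain b a' where ba: "b \<in> carrier (coch B n)" "a' \<in> cocycles A (n + 1)" "g n b = c"
    "f (n + 1) a' = cobd B n b"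
    using ex_representative[OF c(1)] .
  have "coh_class A (n + 1) a' = coh_class A (n + 1) a"
    using delta_class[of b n a'] ba c by (simp add: A.mem_cocycles)
  then have "coh_class B (n + 1) (f (n + 1) a) = coh_class B (n + 1) (f (n + 1) a')"
    using coh_map_class[OF A.complex_axioms B.complex_axioms f_map] assms ba(2) by metis
  moreover have "f (n + 1) a' \<in> coboundaries B (n + 1)"
    using ba by (auto simp: B.coboundaries_Suc)
  ultimately show "coh_class B (n + 1) (f (n + 1) a) = \<zero>\<^bsub>cohomology B (n + 1)\<^esub>"
    using B.coh_class_zero_iff[OF cochain_map_cocycles[OF f_map ba(2)]] by simp
qed

end

section \<open>Direct sums of complexes and maps into and out of them\<close>

lemma direct_sum_simps:
  "carrier (direct_sum V W) = carrier V \<times> carrier W"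
  "\<zero>\<^bsub>direct_sum V W\<^esub> = (\<zero>\<^bsub>V\<^esub>, \<zero>\<^bsub>W\<^esub>)"
  "x \<oplus>\<^bsub>direct_sum V W\<^esub> y = (fst x \<oplus>\<^bsub>V\<^esub> fst y, snd x \<oplus>\<^bsub>W\<^esub> snd y)"
  "k \<odot>\<^bsub>direct_sum V W\<^esub> x = (k \<odot>\<^bsub>V\<^esub> fst x, k \<odot>\<^bsub>W\<^esub> snd x)"
  by (simp_all add: direct_sum_def)

lemma csum_simps:
  "coch (csum C D) n = direct_sum (coch C n) (coch D n)"
  "cobd (csum C D) n = map_prod (cobd C n) (cobd D n)"
  by (simp_all add: csum_def)

lemma cochain_complex_csum:
  assumes "complex K C" "complex K D"
  shows "cochain_complex K (csum C D)"
proof -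
  interpret C: complex K C by fact
  interpret D: complex K D by fact
  have "linear_map K (coch (csum C D) n) (coch (csum C D) (n + 1)) (cobd (csum C D) n)" for n
    using C.cobd_linear[of n] D.cobd_linear[of n]
    by (auto simp: csum_simps linear_map_iff direct_sum_simps direct_sum_is_vs Pi_iff)
  then show ?thesis
    by (auto simp: cochain_complex_def csum_simps direct_sum_simps direct_sum_is_vs
        C.coch_vs D.coch_vs C.cobd_cobd D.cobd_cobd)
qed

lemma cochain_map_pair:
  assumes "cochain_map K A B\<^sub>1 p" "cochain_map K A B\<^sub>2 p'"
  shows "cochain_map K A (csum B\<^sub>1 B\<^sub>2) (\<lambda>n c. (p n c, p' n c))"
  unfolding cochain_map_def
proof (intro allI conjI ballI)
  fix n
  show "linear_map K (coch A n) (coch (csum B\<^sub>1 B\<^sub>2) n) (\<lambda>c. (p n c, p' n c))"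
    using cochain_mapD(1)[OF assms(1), of n] cochain_mapD(1)[OF assms(2), of n]
    by (auto simp: linear_map_iff csum_simps direct_sum_simps direct_sum_is_vs Pi_iff)
  show "(p (n + 1) (cobd A n x), p' (n + 1) (cobd A n x)) = cobd (csum B\<^sub>1 B\<^sub>2) n (p n x, p' n x)"
    if "x \<in> carrier (coch A n)" for x
    using that cochain_mapD(3)[OF assms(1)] cochain_mapD(3)[OF assms(2)] by (simp add: csum_simps)
qed

lemma cochain_map_copair:
  assumes "cochain_map K B\<^sub>1 C t" "cochain_map K B\<^sub>2 C t'"
    and "cochain_complex K (csum B\<^sub>1 B\<^sub>2)" "cochain_complex K C"
  shows "cochain_map K (csum B\<^sub>1 B\<^sub>2) C (\<lambda>n b. t n (fst b) \<oplus>\<^bsub>coch C n\<^esub> t' n (snd b))"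
  unfolding cochain_map_def
proof (intro allI conjI ballI)
  fix n
  interpret V: vectorspace K "coch C n"
    using assms(4) by (simp add: cochain_complex_def)
  interpret d: linear_map K "coch C n" "coch C (n + 1)" "cobd C n"
    using assms(4) by (simp add: cochain_complex_def)
  have vs: "vectorspace K (coch (csum B\<^sub>1 B\<^sub>2) n)"
    using assms(3) by (simp add: cochain_complex_def)
  show "linear_map K (coch (csum B\<^sub>1 B\<^sub>2) n) (coch C n) (\<lambda>b. t n (fst b) \<oplus>\<^bsub>coch C n\<^esub> t' n (snd b))"
    using cochain_mapD(1)[OF assms(1), of n] cochain_mapD(1)[OF assms(2), of n] vs
    by (auto simp: linear_map_iff csum_simps direct_sum_simps Pi_iff V.M.a_ac V.smult_r_distr)
  show "t (n + 1) (fst (cobd (csum B\<^sub>1 B\<^sub>2) n x)) \<oplus>\<^bsub>coch C (n + 1)\<^esub> t' (n + 1) (snd (cobd (csum B\<^sub>1 B\<^sub>2) n x)) =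
      cobd C n (t n (fst x) \<oplus>\<^bsub>coch C n\<^esub> t' n (snd x))"
    if "x \<in> carrier (coch (csum B\<^sub>1 B\<^sub>2) n)" for x
    using that cochain_mapD(2,3)[OF assms(1)] cochain_mapD(2,3)[OF assms(2)]
    by (auto simp: csum_simps direct_sum_simps)
qed

text \<open>Since f commutes with the differentials, f (d (d x)) = d (d (f x)) = 0, and injectivity
  of f carries this back to A. There is no circularity, because \<open>cochain_map\<close> does not
  presuppose that its source is a complex.\<close>

lemma cochain_complex_inject:
  assumes "\<And>n. vectorspace K (coch A n)"
    and "\<And>n. linear_map K (coch A n) (coch A (n + 1)) (cobd A n)"
    and "cochain_complex K B" "cochain_map K A B f" "\<And>n. inj_on (f n) (carrier (coch A n))"
  shows "cochain_complex K A"
  unfolding cochain_complex_def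
proof (intro allI conjI ballI assms(1,2))
  fix n x assume x: "x \<in> carrier (coch A n)"
  have f: "linear_map K (coch A m) (coch B m) (f m)"
    "y \<in> carrier (coch A m) \<Longrightarrow> f (m + 1) (cobd A m y) = cobd B m (f m y)" for m y
    using assms(4) by (auto simp: cochain_map_def)
  have d: "y \<in> carrier (coch A m) \<Longrightarrow> cobd A m y \<in> carrier (coch A (m + 1))" for m y
    using assms(2)[of m] by (auto simp: linear_map_def mod_hom_def mod_hom_axioms_def module_hom_def)
  interpret A2: vectorspace K "coch A (n + 1 + 1)" by (rule assms(1))
  interpret f2: linear_map K "coch A (n + 1 + 1)" "coch B (n + 1 + 1)" "f (n + 1 + 1)" by (rule f(1))
  have "f (n + 1 + 1) (cobd A (n + 1) (cobd A n x)) = cobd B (n + 1) (cobd B n (f n x))"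
    unfolding f(2)[OF d[OF x]] f(2)[OF x] ..
  also have "\<dots> = \<zero>\<^bsub>coch B (n + 1 + 1)\<^esub>"
    using assms(3) linear_map.T_im[OF f(1) x] unfolding cochain_complex_def by blast
  also have "\<dots> = f (n + 1 + 1) \<zero>\<^bsub>coch A (n + 1 + 1)\<^esub>"
    by (rule f2.T0_is_0[symmetric])
  finally show "cobd A (n + 1) (cobd A n x) = \<zero>\<^bsub>coch A (n + 1 + 1)\<^esub>"
    by (rule inj_onD[OF assms(5) _ d[OF d[OF x]] A2.M.zero_closed])
qed

section \<open>The long exact sequence with the cohomology of the middle term split\<close>

locale short_exact_csum =
  short_exact K A "csum B\<^sub>1 B\<^sub>2" C f g + B\<^sub>1: complex K B\<^sub>1 + B\<^sub>2: complex K B\<^sub>2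
  for K :: "('k, 'm) ring_scheme" and A :: "('k, 'u) cochains" and B\<^sub>1 :: "('k, 'v) cochains"
    and B\<^sub>2 :: "('k, 'w) cochains" and C :: "('k, 'x) cochains" and f g
begin

lemma mem_cocycles_csum:
  "b \<in> cocycles (csum B\<^sub>1 B\<^sub>2) n \<longleftrightarrow> fst b \<in> cocycles B\<^sub>1 n \<and> snd b \<in> cocycles B\<^sub>2 n"
  by (cases b) (auto simp: B.mem_cocycles B\<^sub>1.mem_cocycles B\<^sub>2.mem_cocycles csum_simps direct_sum_simps)

text \<open>The coboundaries of the sum are the product of the coboundaries of the summands. This is
  the canonical isomorphism between the cohomology of the sum and the sum of the cohomologies, in
  the form used below.\<close>

lemma coh_class_csum_eq_iff:
  assumes "b \<in> cocycles (csum B\<^sub>1 B\<^sub>2) n" "b' \<in> cocycles (csum B\<^sub>1 B\<^sub>2) n"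
  shows "coh_class (csum B\<^sub>1 B\<^sub>2) n b = coh_class (csum B\<^sub>1 B\<^sub>2) n b' \<longleftrightarrow>
    coh_class B\<^sub>1 n (fst b) = coh_class B\<^sub>1 n (fst b') \<and> coh_class B\<^sub>2 n (snd b) = coh_class B\<^sub>2 n (snd b')"
proof -
  have "coboundaries (csum B\<^sub>1 B\<^sub>2) n = coboundaries B\<^sub>1 n \<times> coboundaries B\<^sub>2 n"
    by (auto simp: coboundaries_def csum_simps direct_sum_simps)
  then show ?thesis
    using assms
    by (cases b, cases b')
       (auto simp: B.coh_class_eq_iff B\<^sub>1.coh_class_eq_iff B\<^sub>2.coh_class_eq_iff mem_cocycles_csum
         csum_simps direct_sum_simps)
qed

lemma f_comp:
  "cochain_map K A B\<^sub>1 (\<lambda>n. fst \<circ> f n)" "cochain_map K A B\<^sub>2 (\<lambda>n. snd \<circ> f n)"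
  using f_map B\<^sub>1.coch_vs B\<^sub>2.coch_vs
  by (auto simp: cochain_map_def linear_map_iff csum_simps direct_sum_simps mem_Times_iff Pi_iff)

lemma g_comp:
  "cochain_map K B\<^sub>1 C (\<lambda>n. g n \<circ> inj1 (coch B\<^sub>1 n) (coch B\<^sub>2 n))"
  "cochain_map K B\<^sub>2 C (\<lambda>n. g n \<circ> inj2 (coch B\<^sub>1 n) (coch B\<^sub>2 n))"
proof -
  \<comment> \<open>The other component of an included cochain is zero, so compatibility of the
    inclusions with the differentials comes down to d 0 = 0.\<close>
  have d0: "cobd B\<^sub>1 n \<zero>\<^bsub>coch B\<^sub>1 n\<^esub> = \<zero>\<^bsub>coch B\<^sub>1 (n + 1)\<^esub>" "cobd B\<^sub>2 n \<zero>\<^bsub>coch B\<^sub>2 n\<^esub> = \<zero>\<^bsub>coch B\<^sub>2 (n + 1)\<^esub>" for n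
    by (rule linear_map.T0_is_0[OF B\<^sub>1.cobd_linear] linear_map.T0_is_0[OF B\<^sub>2.cobd_linear])+
  have "cochain_map K B\<^sub>1 (csum B\<^sub>1 B\<^sub>2) (\<lambda>n. inj1 (coch B\<^sub>1 n) (coch B\<^sub>2 n))"
    unfolding cochain_map_def csum_simps
    by (simp add: inj1_linear B\<^sub>1.coch_vs B\<^sub>2.coch_vs) (simp add: inj1_def d0)
  then show "cochain_map K B\<^sub>1 C (\<lambda>n. g n \<circ> inj1 (coch B\<^sub>1 n) (coch B\<^sub>2 n))"
    using cochain_map_comp g_map by blast
  have "cochain_map K B\<^sub>2 (csum B\<^sub>1 B\<^sub>2) (\<lambda>n. inj2 (coch B\<^sub>1 n) (coch B\<^sub>2 n))"
    unfolding cochain_map_def csum_simps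
    by (simp add: inj2_linear B\<^sub>1.coch_vs B\<^sub>2.coch_vs) (simp add: inj2_def d0)
  then show "cochain_map K B\<^sub>2 C (\<lambda>n. g n \<circ> inj2 (coch B\<^sub>1 n) (coch B\<^sub>2 n))"
    using cochain_map_comp g_map by blast
qed

lemma coh_into_sum_class:
  assumes "a \<in> cocycles A n"
  shows "coh_into_sum B\<^sub>1 B\<^sub>2 f n (coh_class A n a) =
    (coh_class B\<^sub>1 n (fst (f n a)), coh_class B\<^sub>2 n (snd (f n a)))"
  using coh_map_class[OF A.complex_axioms B\<^sub>1.complex_axioms f_comp(1) assms]
    coh_map_class[OF A.complex_axioms B\<^sub>2.complex_axioms f_comp(2) assms]
  by (simp add: coh_into_sum_def)

text \<open>The cochain b is the sum of its two included components, and g is additive.\<close>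

lemma coh_from_sum_class:
  assumes "b \<in> cocycles (csum B\<^sub>1 B\<^sub>2) n"
  shows "coh_from_sum B\<^sub>1 B\<^sub>2 C g n (coh_class B\<^sub>1 n (fst b), coh_class B\<^sub>2 n (snd b)) =
    coh_class C n (g n b)"
proof -
  interpret V1: vectorspace K "coch B\<^sub>1 n" by (rule B\<^sub>1.coch_vs)
  interpret V2: vectorspace K "coch B\<^sub>2 n" by (rule B\<^sub>2.coch_vs)
  have b: "fst b \<in> cocycles B\<^sub>1 n" "snd b \<in> cocycles B\<^sub>2 n"
    using assms mem_cocycles_csum by auto
  then have b': "fst b \<in> carrier (coch B\<^sub>1 n)" "snd b \<in> carrier (coch B\<^sub>2 n)"
    by (simp_all add: B\<^sub>1.mem_cocycles B\<^sub>2.mem_cocycles)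
  let ?b\<^sub>1 = "inj1 (coch B\<^sub>1 n) (coch B\<^sub>2 n) (fst b)" and ?b\<^sub>2 = "inj2 (coch B\<^sub>1 n) (coch B\<^sub>2 n) (snd b)"
  have "?b\<^sub>1 \<oplus>\<^bsub>coch (csum B\<^sub>1 B\<^sub>2) n\<^esub> ?b\<^sub>2 = b"
    using b' by (simp add: inj1_def inj2_def csum_simps direct_sum_simps)
  moreover have "g n (?b\<^sub>1 \<oplus>\<^bsub>coch (csum B\<^sub>1 B\<^sub>2) n\<^esub> ?b\<^sub>2) = g n ?b\<^sub>1 \<oplus>\<^bsub>coch C n\<^esub> g n ?b\<^sub>2"
    using b' by (intro g_simps(3)) (simp_all add: inj1_def inj2_def csum_simps direct_sum_simps)
  ultimately show ?thesis
    using coh_map_class[OF B\<^sub>1.complex_axioms C.complex_axioms g_comp(1) b(1)]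
      coh_map_class[OF B\<^sub>2.complex_axioms C.complex_axioms g_comp(2) b(2)]
      cochain_map_cocycles[OF g_comp(1) b(1)] cochain_map_cocycles[OF g_comp(2) b(2)]
    by (simp add: coh_from_sum_def C.coh_class_add)
qed

lemma coh_into_sum_linear:
  "linear_map K (cohomology A n) (direct_sum (cohomology B\<^sub>1 n) (cohomology B\<^sub>2 n)) (coh_into_sum B\<^sub>1 B\<^sub>2 f n)"
  using coh_map_linear[OF A.complex_axioms B\<^sub>1.complex_axioms f_comp(1), of n]
    coh_map_linear[OF A.complex_axioms B\<^sub>2.complex_axioms f_comp(2), of n]
  by (auto simp: linear_map_iff coh_into_sum_def direct_sum_simps direct_sum_is_vs Pi_iff)

lemma coh_from_sum_linear:
  "linear_map K (direct_sum (cohomology B\<^sub>1 n) (cohomology B\<^sub>2 n)) (cohomology C n) (coh_from_sum B\<^sub>1 B\<^sub>2 C g n)"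
proof -
  interpret V: vectorspace K "cohomology C n" by (rule C.cohomology_vs)
  show ?thesis
    using coh_map_linear[OF B\<^sub>1.complex_axioms C.complex_axioms g_comp(1), of n]
      coh_map_linear[OF B\<^sub>2.complex_axioms C.complex_axioms g_comp(2), of n]
    by (auto simp: linear_map_iff coh_from_sum_def direct_sum_simps direct_sum_is_vs Pi_iff
        V.M.a_ac V.smult_r_distr)
qed

lemma direct_sum_cohomologyE:
  assumes "XY \<in> carrier (direct_sum (cohomology B\<^sub>1 n) (cohomology B\<^sub>2 n))"
  obtains b where "b \<in> cocycles (csum B\<^sub>1 B\<^sub>2) n"
    "XY = (coh_class B\<^sub>1 n (fst b), coh_class B\<^sub>2 n (snd b))"
proof -
  from assms obtain b\<^sub>1 b\<^sub>2 where "b\<^sub>1 \<in> cocycles B\<^sub>1 n" "b\<^sub>2 \<in> cocycles B\<^sub>2 n"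
    "XY = (coh_class B\<^sub>1 n b\<^sub>1, coh_class B\<^sub>2 n b\<^sub>2)"
    by (auto simp: direct_sum_simps B\<^sub>1.cohomology_carrier B\<^sub>2.cohomology_carrier)
  then show thesis
    using that[of "(b\<^sub>1, b\<^sub>2)"] by (simp add: mem_cocycles_csum)
qed

lemma class_pair_mem:
  "b \<in> cocycles (csum B\<^sub>1 B\<^sub>2) n \<Longrightarrow> (coh_class B\<^sub>1 n (fst b), coh_class B\<^sub>2 n (snd b)) \<in>
    carrier (direct_sum (cohomology B\<^sub>1 n) (cohomology B\<^sub>2 n))"
  by (auto simp: direct_sum_simps B\<^sub>1.cohomology_carrier B\<^sub>2.cohomology_carrier mem_cocycles_csum)

lemma coh_class_csum_zero_iff:
  assumes "b \<in> cocycles (csum B\<^sub>1 B\<^sub>2) n"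
  shows "coh_class (csum B\<^sub>1 B\<^sub>2) n b = \<zero>\<^bsub>cohomology (csum B\<^sub>1 B\<^sub>2) n\<^esub> \<longleftrightarrow>
    (coh_class B\<^sub>1 n (fst b), coh_class B\<^sub>2 n (snd b)) = \<zero>\<^bsub>direct_sum (cohomology B\<^sub>1 n) (cohomology B\<^sub>2 n)\<^esub>"
proof -
  have 0: "\<zero>\<^bsub>coch (csum B\<^sub>1 B\<^sub>2) n\<^esub> \<in> cocycles (csum B\<^sub>1 B\<^sub>2) n"
    using B.subspace_cocycles[of n] by (simp add: subspace_def submodule_def)
  show ?thesis
    using coh_class_csum_eq_iff[OF assms 0]
    unfolding B.coh_class_zero
    by (simp add: csum_simps direct_sum_simps B\<^sub>1.coh_class_zero B\<^sub>2.coh_class_zero)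
qed

text \<open>This and the two following statements transport the equivalences for single classes of
  cocycles to pairs of classes; every element of the direct sum is such a pair coming from one
  cocycle of the sum.\<close>

lemma exact_at_B:
  "exact_at K (cohomology A n) (direct_sum (cohomology B\<^sub>1 n) (cohomology B\<^sub>2 n)) (cohomology C n)
    (coh_into_sum B\<^sub>1 B\<^sub>2 f n) (coh_from_sum B\<^sub>1 B\<^sub>2 C g n)"
  unfolding exact_at_def a_kernel_def'
proof (intro conjI coh_into_sum_linear coh_from_sum_linear Set.set_eqI iffI)
  fix XY assume "XY \<in> coh_into_sum B\<^sub>1 B\<^sub>2 f n ` carrier (cohomology A n)"
  then obtain a where a: "a \<in> cocycles A n" "XY = coh_into_sum B\<^sub>1 B\<^sub>2 f n (coh_class A n a)"
    by (auto simp: A.cohomology_carrier)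
  have fa: "f n a \<in> cocycles (csum B\<^sub>1 B\<^sub>2) n"
    by (rule cochain_map_cocycles[OF f_map a(1)])
  show "XY \<in> {XY \<in> carrier (direct_sum (cohomology B\<^sub>1 n) (cohomology B\<^sub>2 n)).
      coh_from_sum B\<^sub>1 B\<^sub>2 C g n XY = \<zero>\<^bsub>cohomology C n\<^esub>}"
    using class_pair_mem[OF fa] coh_from_sum_class[OF fa] exact_cohomology_B[OF fa] a
    by (auto simp: coh_into_sum_class)
next
  fix XY assume "XY \<in> {XY \<in> carrier (direct_sum (cohomology B\<^sub>1 n) (cohomology B\<^sub>2 n)).
      coh_from_sum B\<^sub>1 B\<^sub>2 C g n XY = \<zero>\<^bsub>cohomology C n\<^esub>}"
  then have XY: "XY \<in> carrier (direct_sum (cohomology B\<^sub>1 n) (cohomology B\<^sub>2 n))"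
    "coh_from_sum B\<^sub>1 B\<^sub>2 C g n XY = \<zero>\<^bsub>cohomology C n\<^esub>"
    by auto
  obtain b where b: "b \<in> cocycles (csum B\<^sub>1 B\<^sub>2) n" "XY = (coh_class B\<^sub>1 n (fst b), coh_class B\<^sub>2 n (snd b))"
    using direct_sum_cohomologyE[OF XY(1)] .
  then obtain a where a: "a \<in> cocycles A n"
    "coh_class (csum B\<^sub>1 B\<^sub>2) n (f n a) = coh_class (csum B\<^sub>1 B\<^sub>2) n b"
    using coh_from_sum_class[OF b(1)] exact_cohomology_B[OF b(1)] XY(2) by auto
  then have "XY = coh_into_sum B\<^sub>1 B\<^sub>2 f n (coh_class A n a)"
    using b coh_class_csum_eq_iff[OF cochain_map_cocycles[OF f_map a(1)] b(1)]
    by (simp add: coh_into_sum_class)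
  then show "XY \<in> coh_into_sum B\<^sub>1 B\<^sub>2 f n ` carrier (cohomology A n)"
    using a(1) by (auto simp: A.cohomology_carrier)
qed

lemma exact_at_C:
  "exact_at K (direct_sum (cohomology B\<^sub>1 n) (cohomology B\<^sub>2 n)) (cohomology C n) (cohomology A (n + 1))
    (coh_from_sum B\<^sub>1 B\<^sub>2 C g n) (\<delta> n)"
  unfolding exact_at_def a_kernel_def'
proof (intro conjI coh_from_sum_linear delta_linear Set.set_eqI iffI)
  fix X assume "X \<in> coh_from_sum B\<^sub>1 B\<^sub>2 C g n ` carrier (direct_sum (cohomology B\<^sub>1 n) (cohomology B\<^sub>2 n))"
  then obtain b where b: "b \<in> cocycles (csum B\<^sub>1 B\<^sub>2) n" "X = coh_class C n (g n b)"
    using coh_from_sum_class by (auto elim!: direct_sum_cohomologyE)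
  then show "X \<in> {X \<in> carrier (cohomology C n). \<delta> n X = \<zero>\<^bsub>cohomology A (n + 1)\<^esub>}"
    using exact_cohomology_C[OF cochain_map_cocycles[OF g_map b(1)]] cochain_map_cocycles[OF g_map b(1)]
    by (auto simp: C.cohomology_carrier)
next
  fix X assume "X \<in> {X \<in> carrier (cohomology C n). \<delta> n X = \<zero>\<^bsub>cohomology A (n + 1)\<^esub>}"
  then have X: "X \<in> coh_class C n ` cocycles C n" "\<delta> n X = \<zero>\<^bsub>cohomology A (n + 1)\<^esub>"
    by (auto simp: C.cohomology_carrier)
  then obtain c where c: "c \<in> cocycles C n" "X = coh_class C n c"
    by blast
  then obtain b where b: "b \<in> cocycles (csum B\<^sub>1 B\<^sub>2) n" "coh_class C n (g n b) = X"
    using exact_cohomology_C[OF c(1)] X(2) by auto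
  then show "X \<in> coh_from_sum B\<^sub>1 B\<^sub>2 C g n ` carrier (direct_sum (cohomology B\<^sub>1 n) (cohomology B\<^sub>2 n))"
    using coh_from_sum_class[OF b(1)] class_pair_mem[OF b(1)] by (metis imageI)
qed

lemma exact_at_A:
  "exact_at K (cohomology C n) (cohomology A (n + 1))
    (direct_sum (cohomology B\<^sub>1 (n + 1)) (cohomology B\<^sub>2 (n + 1))) (\<delta> n) (coh_into_sum B\<^sub>1 B\<^sub>2 f (n + 1))"
  unfolding exact_at_def a_kernel_def'
proof (intro conjI coh_into_sum_linear delta_linear Set.set_eqI iffI)
  fix X assume "X \<in> \<delta> n ` carrier (cohomology C n)"
  then obtain c where c: "c \<in> cocycles C n" "X = \<delta> n (coh_class C n c)"
    by (auto simp: C.cohomology_carrier)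
  then have "X \<in> carrier (cohomology A (n + 1))"
    using delta_linear[of n] by (auto simp: linear_map_iff C.cohomology_carrier)
  then obtain a where a: "a \<in> cocycles A (n + 1)" "X = coh_class A (n + 1) a"
    by (auto simp: A.cohomology_carrier)
  then show "X \<in> {X \<in> carrier (cohomology A (n + 1)). coh_into_sum B\<^sub>1 B\<^sub>2 f (n + 1) X =
      \<zero>\<^bsub>direct_sum (cohomology B\<^sub>1 (n + 1)) (cohomology B\<^sub>2 (n + 1))\<^esub>}"
    using exact_cohomology_A[OF a(1)] coh_class_csum_zero_iff[OF cochain_map_cocycles[OF f_map a(1)]] c
    by (auto simp: A.cohomology_carrier coh_into_sum_class)
next
  fix X assume "X \<in> {X \<in> carrier (cohomology A (n + 1)). coh_into_sum B\<^sub>1 B\<^sub>2 f (n + 1) X =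
      \<zero>\<^bsub>direct_sum (cohomology B\<^sub>1 (n + 1)) (cohomology B\<^sub>2 (n + 1))\<^esub>}"
  then have X: "X \<in> coh_class A (n + 1) ` cocycles A (n + 1)"
    "coh_into_sum B\<^sub>1 B\<^sub>2 f (n + 1) X = \<zero>\<^bsub>direct_sum (cohomology B\<^sub>1 (n + 1)) (cohomology B\<^sub>2 (n + 1))\<^esub>"
    by (auto simp: A.cohomology_carrier)
  then obtain a where a: "a \<in> cocycles A (n + 1)" "X = coh_class A (n + 1) a"
    by blast
  then show "X \<in> \<delta> n ` carrier (cohomology C n)"
    using exact_cohomology_A[OF a(1)] coh_class_csum_zero_iff[OF cochain_map_cocycles[OF f_map a(1)]] X(2)
    by (auto simp: C.cohomology_carrier coh_into_sum_class)
qed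

end

section \<open>Posets, lower embeddings and signs\<close>

locale min_poset =
  fixes r :: "'p rel"
  assumes refl_r: "x \<in> Field r \<Longrightarrow> (x, x) \<in> r"
    and antisym_r: "antisym r" and trans_r: "trans r"
    and finite_Field: "finite (Field r)"
    and ex_min: "\<exists>m\<in>Field r. \<forall>x\<in>Field r. (m, x) \<in> r"
begin

lemma poset_min_eqI: "\<lbrakk>m \<in> Field r; \<And>x. x \<in> Field r \<Longrightarrow> (m, x) \<in> r\<rbrakk> \<Longrightarrow> poset_min r = m"
  unfolding poset_min_def by (rule the_equality) (use antisym_r in \<open>auto dest: antisymD\<close>)

lemma poset_min: "poset_min r \<in> Field r" "x \<in> Field r \<Longrightarrow> (poset_min r, x) \<in> r"
proof -
  obtain m where "m \<in> Field r" "\<forall>x\<in>Field r. (m, x) \<in> r"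
    using ex_min by blast
  moreover from this have "poset_min r = m"
    using poset_min_eqI by blast
  ultimately show "poset_min r \<in> Field r" "x \<in> Field r \<Longrightarrow> (poset_min r, x) \<in> r"
    by simp_all
qed

end

lemma coversD:
  assumes "(x, y) \<in> covers r"
  shows "(x, y) \<in> r" "x \<in> Field r" "y \<in> Field r" "x \<noteq> y"
  using assms by (auto simp: covers_def intro: FieldI1 FieldI2)

text \<open>Induction on the size of the interval from x to y: unless y covers x, some z lies
  strictly between, and the intervals below and above z are smaller, as the one misses y and the
  other misses x.\<close>

lemma (in min_poset) le_imp_covers_rtrancl: "(x, y) \<in> r \<Longrightarrow> (x, y) \<in> (covers r)\<^sup>*"
proof (induction "card {z. (x, z) \<in> r \<and> (z, y) \<in> r}" arbitrary: x y rule: less_induct)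
  case less
  have xy: "x \<in> Field r" "y \<in> Field r"
    using less.prems by (auto intro: FieldI1 FieldI2)
  have fin: "finite {z. (x, z) \<in> r \<and> (z, y) \<in> r}"
    by (rule finite_subset[OF _ finite_Field]) (auto intro: FieldI1 FieldI2)
  show ?case
  proof (cases "x = y \<or> (x, y) \<in> covers r")
    case False
    then obtain z where z: "(x, z) \<in> r" "(z, y) \<in> r" "z \<noteq> x" "z \<noteq> y"
      using less.prems by (auto simp: covers_def)
    have "{w. (x, w) \<in> r \<and> (w, z) \<in> r} \<subset> {w. (x, w) \<in> r \<and> (w, y) \<in> r}"
      using z refl_r[OF xy(2)] less.prems transD[OF trans_r _ z(2)] antisymD[OF antisym_r z(2)] by blast
    moreover have "{w. (z, w) \<in> r \<and> (w, y) \<in> r} \<subset> {w. (x, w) \<in> r \<and> (w, y) \<in> r}"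
      using z refl_r[OF xy(1)] less.prems transD[OF trans_r z(1)] antisymD[OF antisym_r z(1)] by blast
    ultimately have "(x, z) \<in> (covers r)\<^sup>*" "(z, y) \<in> (covers r)\<^sup>*"
      using less.hyps[OF psubset_card_mono[OF fin]] z(1,2) by blast+
    then show ?thesis
      by (rule rtrancl_trans)
  qed auto
qed

text \<open>The one equivalence says at once that j is monotone, reflects the order and has a
  down-closed image. Only what lies below an image matters, because the differential at y reads a
  cochain at the elements covered by y.\<close>

definition lower_embedding :: "'p rel \<Rightarrow> 'q rel \<Rightarrow> ('p \<Rightarrow> 'q) \<Rightarrow> bool" where
  "lower_embedding r s j \<longleftrightarrow> inj_on j (Field r) \<and>
     (\<forall>y\<in>Field r. j y \<in> Field s \<and> (\<forall>x. (x, j y) \<in> s \<longleftrightarrow> (\<exists>x'. (x', y) \<in> r \<and> x = j x')))"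

locale lower_embedding_posets = r: min_poset r + s: min_poset s
  for r :: "'p rel" and s :: "'q rel" +
  fixes j :: "'p \<Rightarrow> 'q"
  assumes emb: "lower_embedding r s j"
begin

lemma j_inj: "inj_on j (Field r)"
  using emb unfolding lower_embedding_def by (rule conjunct1)

lemma j_Field: "y \<in> Field r \<Longrightarrow> j y \<in> Field s"
  and j_below: "y \<in> Field r \<Longrightarrow> (x, j y) \<in> s \<longleftrightarrow> (\<exists>x'. (x', y) \<in> r \<and> x = j x')"
  using emb unfolding lower_embedding_def by blast+

lemma j_mono_iff:
  assumes "x \<in> Field r" "y \<in> Field r"
  shows "(j x, j y) \<in> s \<longleftrightarrow> (x, y) \<in> r"
proof
  assume "(j x, j y) \<in> s"
  then obtain x' where x': "(x', y) \<in> r" "j x = j x'"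
    using j_below[OF assms(2)] by auto
  then have "x = x'"
    using inj_onD[OF j_inj] assms(1) by (simp add: FieldI1)
  then show "(x, y) \<in> r"
    using x' by simp
qed (use j_below[OF assms(2)] in auto)

text \<open>The minimum of s lies below the image of the minimum of r, hence is the image of
  something below that minimum.\<close>

lemma j_min: "j (poset_min r) = poset_min s"
proof -
  have "(poset_min s, j (poset_min r)) \<in> s"
    by (intro s.poset_min(2) j_Field r.poset_min(1))
  then obtain x where x: "(x, poset_min r) \<in> r" "poset_min s = j x"
    using j_below[OF r.poset_min(1)] by auto
  then have "x = poset_min r"
    using r.poset_min(2)[of x] r.antisym_r by (auto dest: antisymD simp: FieldI1)
  then show ?thesis
    using x(2) by simp
qed

text \<open>Whatever lies between x and j y is itself an image, so the interval from x to j y is the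
  image of an interval of r, and the one has no inner elements exactly when the other has
  none.\<close>

lemma covers_below:
  assumes y: "y \<in> Field r"
  shows "(x, j y) \<in> covers s \<longleftrightarrow> (\<exists>x'. (x', y) \<in> covers r \<and> x = j x')"
proof
  assume *: "(x, j y) \<in> covers s"
  then obtain x' where x': "(x', y) \<in> r" "x = j x'"
    using coversD(1) j_below[OF y] by metis
  have "z = x' \<or> z = y" if "(x', z) \<in> r" "(z, y) \<in> r" for z
  proof -
    have F: "x' \<in> Field r" "z \<in> Field r"
      using that by (auto intro: FieldI1 FieldI2)
    then have "(x, j z) \<in> s" "(j z, j y) \<in> s"
      using that x' j_mono_iff y by auto
    then have "j z = x \<or> j z = j y"
      using * by (auto simp: covers_def)
    then show ?thesis
      using F x' y j_inj by (auto dest: inj_onD)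
  qed
  then show "\<exists>x'. (x', y) \<in> covers r \<and> x = j x'"
    using x' * by (auto simp: covers_def)
next
  assume "\<exists>x'. (x', y) \<in> covers r \<and> x = j x'"
  then obtain x' where x': "(x', y) \<in> covers r" "x = j x'"
    by blast
  note F = coversD[OF x'(1)]
  have "z = x \<or> z = j y" if z: "(x, z) \<in> s" "(z, j y) \<in> s" for z
  proof -
    obtain z' where z': "(z', y) \<in> r" "z = j z'"
      using z(2) j_below[OF y] by blast
    then have "(x', z') \<in> r"
      using z(1) x'(2) j_mono_iff F by (metis FieldI1)
    then show ?thesis
      using x' z' by (auto simp: covers_def)
  qed
  moreover have "(x, j y) \<in> s" "x \<noteq> j y"
    using F x'(2) j_mono_iff j_inj by (auto dest: inj_onD)
  ultimately show "(x, j y) \<in> covers s"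
    by (auto simp: covers_def)
qed

lemma covers_j: "(x, y) \<in> covers r \<Longrightarrow> (j x, j y) \<in> covers s"
  using covers_below coversD(3) by metis

text \<open>A chain of coverings that ends in j x never leaves the image, and it starts at the image
  of the minimum; so the chains of each length in the two posets correspond, and with them the least
  length.\<close>

lemma level_j:
  assumes "x \<in> Field r"
  shows "level s (j x) = level r x"
proof -
  have "(poset_min s, j x) \<in> covers s ^^ n \<longleftrightarrow> (poset_min r, x) \<in> covers r ^^ n" for n
    using assms
  proof (induction n arbitrary: x)
    case 0
    then show ?case
      using j_min r.poset_min(1) j_inj by (auto dest: inj_onD)
  next
    case (Suc n)
    have "(\<exists>z. (poset_min s, z) \<in> covers s ^^ n \<and> (z, j x) \<in> covers s) \<longleftrightarrow>
        (\<exists>z. (poset_min s, j z) \<in> covers s ^^ n \<and> (z, x) \<in> covers r)"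
      unfolding covers_below[OF Suc.prems] by blast
    also have "\<dots> \<longleftrightarrow> (\<exists>z. (poset_min r, z) \<in> covers r ^^ n \<and> (z, x) \<in> covers r)"
      using Suc.IH by (metis coversD(2))
    finally show ?case
      by (simp add: relcomp_unfold)
  qed
  then show ?thesis
    by (simp add: level_def)
qed

lemma level_set_j: "x \<in> level_set r n \<Longrightarrow> j x \<in> level_set s n"
  by (simp add: level_set_def level_j j_Field)

text \<open>Both sides index a differential, that of s at j y and that of r at y; their agreement is
  what lets restriction along j commute with differentials.\<close>

lemma covers_level_set_j:
  assumes "y \<in> Field r"
  shows "{x \<in> level_set s n. (x, j y) \<in> covers s} = j ` {x \<in> level_set r n. (x, y) \<in> covers r}"
proof -
  have "x' \<in> level_set r n" if "(x', y) \<in> covers r" "j x' \<in> level_set s n" for x'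
    using that level_j coversD(2)[OF that(1)] by (simp add: level_set_def)
  then show ?thesis
    unfolding covers_below[OF assms] using level_set_j by blast
qed

lemma sign_assignment_j:
  assumes "sign_assignment s \<epsilon>"
  shows "sign_assignment r (\<lambda>x y. \<epsilon> (j x) (j y))"
  unfolding sign_assignment_def
proof (intro allI impI, elim conjE)
  fix x y y' z
  assume "(x, y) \<in> covers r" "(y, z) \<in> covers r" "(x, y') \<in> covers r" "(y', z) \<in> covers r" "y \<noteq> y'"
  moreover from this have "j y \<noteq> j y'"
    using j_inj by (auto dest: coversD inj_onD)
  ultimately show "\<epsilon> (j x) (j y) + \<epsilon> (j y) (j z) = \<epsilon> (j x) (j y') + \<epsilon> (j y') (j z) + 1"
    by (intro assms[unfolded sign_assignment_def, rule_format] conjI covers_j)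
qed

end

section \<open>Signs in the field, spaces of cochains and restriction twisted by signs\<close>

lemma sgn_val_closed: "field K \<Longrightarrow> sgn_val K a \<in> carrier K"
  by (simp add: sgn_val_def field.is_ring ring.ring_simprules)

lemma sgn_val_mult:
  assumes "field K"
  shows "sgn_val K a \<otimes>\<^bsub>K\<^esub> sgn_val K b = sgn_val K (a + b)"
proof -
  interpret field K by fact
  show ?thesis
    by (cases a; cases b) (auto simp: sgn_val_def l_minus r_minus)
qed

lemma sgn_val_0: "sgn_val K 0 = \<one>\<^bsub>K\<^esub>"
  by (simp add: sgn_val_def)

lemma func_space_simps:
  assumes "ring K"
  shows "carrier (ring.func_space K S) = S \<rightarrow>\<^sub>E carrier K"
    "\<zero>\<^bsub>ring.func_space K S\<^esub> = (\<lambda>v\<in>S. \<zero>\<^bsub>K\<^esub>)"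
    "f \<oplus>\<^bsub>ring.func_space K S\<^esub> g = (\<lambda>v\<in>S. f v \<oplus>\<^bsub>K\<^esub> g v)"
    "k \<odot>\<^bsub>ring.func_space K S\<^esub> f = (\<lambda>v\<in>S. k \<otimes>\<^bsub>K\<^esub> f v)"
  by (simp_all add: ring.func_space_def[OF assms])

lemma poset_cochains_simps:
  "coch (poset_cochains K r \<epsilon>) n = ring.func_space K (level_set r n)"
  "cobd (poset_cochains K r \<epsilon>) n = poset_diff K r \<epsilon> n"
  by (simp_all add: poset_cochains_def)

lemma func_space_vs:
  assumes "field K"
  shows "vectorspace K (ring.func_space K S)"
proof -
  interpret field K by fact
  show ?thesis
    by (simp add: vectorspace_def assms func_space_is_module)
qed

lemma linear_map_func_spaceI:
  assumes "field K" "f \<in> (S \<rightarrow>\<^sub>E carrier K) \<rightarrow> (T \<rightarrow>\<^sub>E carrier K)"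
    and "\<And>c c' t. \<lbrakk>c \<in> S \<rightarrow>\<^sub>E carrier K; c' \<in> S \<rightarrow>\<^sub>E carrier K; t \<in> T\<rbrakk> \<Longrightarrow>
      f (\<lambda>v\<in>S. c v \<oplus>\<^bsub>K\<^esub> c' v) t = f c t \<oplus>\<^bsub>K\<^esub> f c' t"
    and "\<And>k c t. \<lbrakk>k \<in> carrier K; c \<in> S \<rightarrow>\<^sub>E carrier K; t \<in> T\<rbrakk> \<Longrightarrow>
      f (\<lambda>v\<in>S. k \<otimes>\<^bsub>K\<^esub> c v) t = k \<otimes>\<^bsub>K\<^esub> f c t"
  shows "linear_map K (ring.func_space K S) (ring.func_space K T) f"
proof -
  interpret field K by fact
  have add: "f (\<lambda>v\<in>S. c v \<oplus>\<^bsub>K\<^esub> c' v) = (\<lambda>t\<in>T. f c t \<oplus>\<^bsub>K\<^esub> f c' t)"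
    if "c \<in> S \<rightarrow>\<^sub>E carrier K" "c' \<in> S \<rightarrow>\<^sub>E carrier K" for c c'
  proof (rule extensionalityI[of _ T])
    have "(\<lambda>v\<in>S. c v \<oplus>\<^bsub>K\<^esub> c' v) \<in> S \<rightarrow>\<^sub>E carrier K"
      using that by auto
    then show "f (\<lambda>v\<in>S. c v \<oplus>\<^bsub>K\<^esub> c' v) \<in> extensional T"
      using assms(2) by (auto simp: PiE_def)
  qed (use that assms(3) in auto)
  have smult: "f (\<lambda>v\<in>S. k \<otimes>\<^bsub>K\<^esub> c v) = (\<lambda>t\<in>T. k \<otimes>\<^bsub>K\<^esub> f c t)"
    if "k \<in> carrier K" "c \<in> S \<rightarrow>\<^sub>E carrier K" for k c
  proof (rule extensionalityI[of _ T])
    have "(\<lambda>v\<in>S. k \<otimes>\<^bsub>K\<^esub> c v) \<in> S \<rightarrow>\<^sub>E carrier K"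
      using that by auto
    then show "f (\<lambda>v\<in>S. k \<otimes>\<^bsub>K\<^esub> c v) \<in> extensional T"
      using assms(2) by (auto simp: PiE_def)
  qed (use that assms(4) in auto)
  show ?thesis
    using assms(1,2) add smult
    by (simp add: linear_map_def mod_hom_def mod_hom_axioms_def module_hom_def func_space_vs
        func_space_is_module func_space_simps[OF ring_axioms])
qed

lemma poset_diff_linear:
  assumes "field K"
  shows "linear_map K (coch (poset_cochains K r \<epsilon>) n) (coch (poset_cochains K r \<epsilon>) (n + 1))
    (cobd (poset_cochains K r \<epsilon>) n)"
proof -
  interpret field K by fact
  let ?s = "\<lambda>x y. sgn_val K (\<epsilon> x y)" and ?B = "\<lambda>y. {x \<in> level_set r n. (x, y) \<in> covers r}"
  note [simp] = sgn_val_closed[OF assms] PiE_mem[where S = "level_set r n" and T = "\<lambda>_. carrier K"]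
  show ?thesis
    unfolding poset_cochains_simps
  proof (rule linear_map_func_spaceI[OF assms])
    show "poset_diff K r \<epsilon> n \<in> (level_set r n \<rightarrow>\<^sub>E carrier K) \<rightarrow> (level_set r (n + 1) \<rightarrow>\<^sub>E carrier K)"
      by (auto simp: poset_diff_def intro!: finsum_closed)
  next
    fix c c' y assume c: "c \<in> level_set r n \<rightarrow>\<^sub>E carrier K" "c' \<in> level_set r n \<rightarrow>\<^sub>E carrier K"
      and y: "y \<in> level_set r (n + 1)"
    have "(\<Oplus>\<^bsub>K\<^esub>x\<in>?B y. ?s x y \<otimes>\<^bsub>K\<^esub> (\<lambda>v\<in>level_set r n. c v \<oplus>\<^bsub>K\<^esub> c' v) x) =
        (\<Oplus>\<^bsub>K\<^esub>x\<in>?B y. ?s x y \<otimes>\<^bsub>K\<^esub> c x \<oplus>\<^bsub>K\<^esub> ?s x y \<otimes>\<^bsub>K\<^esub> c' x)"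
      using c by (intro finsum_cong') (auto simp: r_distr)
    also have "\<dots> = (\<Oplus>\<^bsub>K\<^esub>x\<in>?B y. ?s x y \<otimes>\<^bsub>K\<^esub> c x) \<oplus>\<^bsub>K\<^esub> (\<Oplus>\<^bsub>K\<^esub>x\<in>?B y. ?s x y \<otimes>\<^bsub>K\<^esub> c' x)"
      using c by (intro finsum_addf) auto
    finally show "poset_diff K r \<epsilon> n (\<lambda>v\<in>level_set r n. c v \<oplus>\<^bsub>K\<^esub> c' v) y =
        poset_diff K r \<epsilon> n c y \<oplus>\<^bsub>K\<^esub> poset_diff K r \<epsilon> n c' y"
      using y by (simp add: poset_diff_def)
  next
    fix k c y assume c: "k \<in> carrier K" "c \<in> level_set r n \<rightarrow>\<^sub>E carrier K"
      and y: "y \<in> level_set r (n + 1)"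
    have "(\<Oplus>\<^bsub>K\<^esub>x\<in>?B y. ?s x y \<otimes>\<^bsub>K\<^esub> (\<lambda>v\<in>level_set r n. k \<otimes>\<^bsub>K\<^esub> c v) x) =
        (\<Oplus>\<^bsub>K\<^esub>x\<in>?B y. k \<otimes>\<^bsub>K\<^esub> (?s x y \<otimes>\<^bsub>K\<^esub> c x))"
      using c by (intro finsum_cong') (auto simp: m_lcomm)
    also have "\<dots> = k \<otimes>\<^bsub>K\<^esub> (\<Oplus>\<^bsub>K\<^esub>x\<in>?B y. ?s x y \<otimes>\<^bsub>K\<^esub> c x)"
      \<comment> \<open>For an infinite index set both sums have the default value zero.\<close>
      using c by (cases "finite (?B y)") (auto simp: finsum_rdistr finsum_infinite)
    finally show "poset_diff K r \<epsilon> n (\<lambda>v\<in>level_set r n. k \<otimes>\<^bsub>K\<^esub> c v) y =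
        k \<otimes>\<^bsub>K\<^esub> poset_diff K r \<epsilon> n c y"
      using y by (simp add: poset_diff_def)
  qed
qed

text \<open>Restriction along j followed by rescaling the basis element at x by the sign with
  exponent \<theta> x. The twist makes room for sign assignments on the two posets that do not match
  along j.\<close>

definition twisted_pullback ::
    "('k, 'm) ring_scheme \<Rightarrow> 'p rel \<Rightarrow> ('p \<Rightarrow> 'q) \<Rightarrow> ('p \<Rightarrow> bit) \<Rightarrow> int \<Rightarrow> ('q \<Rightarrow> 'k) \<Rightarrow> 'p \<Rightarrow> 'k" where
  "twisted_pullback K r j \<theta> n c = (\<lambda>x\<in>level_set r n. sgn_val K (\<theta> x) \<otimes>\<^bsub>K\<^esub> c (j x))"

text \<open>At y both composites are sums over the elements x covered by y. The term at x has sign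
  exponent \<open>\<theta> y + \<epsilon>' (j x) (j y)\<close> in the one and
  \<open>\<epsilon> x y + \<theta> x\<close> in the other, which is the assumed equation.\<close>

lemma (in lower_embedding_posets) twisted_pullback_cochain_map:
  assumes "field K" and \<theta>: "\<And>x y. (x, y) \<in> covers r \<Longrightarrow> \<epsilon> x y + \<theta> x = \<theta> y + \<epsilon>' (j x) (j y)"
  shows "cochain_map K (poset_cochains K s \<epsilon>') (poset_cochains K r \<epsilon>) (twisted_pullback K r j \<theta>)"
proof -
  interpret field K by fact
  note [simp] = sgn_val_closed[OF assms(1)]
  have "linear_map K (ring.func_space K (level_set s n)) (ring.func_space K (level_set r n))
      (twisted_pullback K r j \<theta> n)" for n
    using level_set_j[of _ n] PiE_mem[where S = "level_set s n" and T = "\<lambda>_. carrier K"]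
    by (intro linear_map_func_spaceI assms(1))
       (auto simp: twisted_pullback_def r_distr m_lcomm)
  moreover have "twisted_pullback K r j \<theta> (n + 1) (poset_diff K s \<epsilon>' n c) =
      poset_diff K r \<epsilon> n (twisted_pullback K r j \<theta> n c)"
    if c: "c \<in> level_set s n \<rightarrow>\<^sub>E carrier K" for n c
  proof
    fix y
    let ?B = "{x \<in> level_set r n. (x, y) \<in> covers r}"
    show "twisted_pullback K r j \<theta> (n + 1) (poset_diff K s \<epsilon>' n c) y =
        poset_diff K r \<epsilon> n (twisted_pullback K r j \<theta> n c) y"
    proof (cases "y \<in> level_set r (n + 1)")
      case True
      then have F: "y \<in> Field r"
        by (simp add: level_set_def)
      have fin: "finite ?B"
        using r.finite_Field by (simp add: level_set_def)
      have inj: "inj_on j ?B"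
        using j_inj by (rule inj_on_subset) (auto simp: level_set_def)
      have cl: "c (j x) \<in> carrier K" if "x \<in> level_set r n" for x
        using c level_set_j that by auto
      have "sgn_val K (\<theta> y) \<otimes>\<^bsub>K\<^esub> (\<Oplus>\<^bsub>K\<^esub>x\<in>j ` ?B. sgn_val K (\<epsilon>' x (j y)) \<otimes>\<^bsub>K\<^esub> c x) =
          sgn_val K (\<theta> y) \<otimes>\<^bsub>K\<^esub> (\<Oplus>\<^bsub>K\<^esub>x\<in>?B. sgn_val K (\<epsilon>' (j x) (j y)) \<otimes>\<^bsub>K\<^esub> c (j x))"
        using inj cl by (subst finsum_reindex) auto
      also have "\<dots> = (\<Oplus>\<^bsub>K\<^esub>x\<in>?B. sgn_val K (\<theta> y) \<otimes>\<^bsub>K\<^esub> (sgn_val K (\<epsilon>' (j x) (j y)) \<otimes>\<^bsub>K\<^esub> c (j x)))"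
        using fin cl by (intro finsum_rdistr) auto
      also have "\<dots> = (\<Oplus>\<^bsub>K\<^esub>x\<in>?B. sgn_val K (\<epsilon> x y) \<otimes>\<^bsub>K\<^esub> (sgn_val K (\<theta> x) \<otimes>\<^bsub>K\<^esub> c (j x)))"
        using cl \<theta> by (intro finsum_cong') (auto simp: sgn_val_mult[OF assms(1)] simp flip: m_assoc)
      also have "\<dots> = (\<Oplus>\<^bsub>K\<^esub>x\<in>?B. sgn_val K (\<epsilon> x y) \<otimes>\<^bsub>K\<^esub> twisted_pullback K r j \<theta> n c x)"
        using cl by (intro finsum_cong') (auto simp: twisted_pullback_def)
      finally show ?thesis
        using True level_set_j[OF True] covers_level_set_j[OF F]
        by (simp add: poset_diff_def twisted_pullback_def)
    qed (simp add: poset_diff_def twisted_pullback_def)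
  qed
  ultimately show ?thesis
    by (simp add: cochain_map_def poset_cochains_simps func_space_simps[OF ring_axioms])
qed


section \<open>Signs and coboundaries on the face poset of a simplicial complex\<close>

lemma bit_add_cancel: "a + (a + b) = b" for a b :: bit
  by (cases a; cases b) simp_all

text \<open>The two summands 1 cancel: the sum of two sign assignments satisfies the square
  condition without the extra 1, that is, it is a cocycle.\<close>

lemma bit_add_square:
  fixes a b c d :: bit
  assumes "a + b = c + d + 1" "a' + b' = c' + d' + 1"
  shows "(a + a') + (b + b') = (c + c') + (d + d')"
proof -
  have "(a + a') + (b + b') = (a + b) + (a' + b')"
    by (simp only: ac_simps)
  also have "\<dots> = 1 + (1 + ((c + c') + (d + d')))"
    unfolding assms by (simp only: ac_simps)
  finally show ?thesis
    unfolding bit_add_cancel .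
qed

text \<open>Induction on A: a new element x contributes the row of all F x b and the column of all F
  a x, which cancel term by term. Exchanging the two summations would only show that twice the sum
  vanishes, which says nothing in characteristic 2.\<close>

lemma (in abelian_group) finsum_antisymmetric:
  assumes "finite A"
    and "\<And>a b. \<lbrakk>a \<in> A; b \<in> A; a \<noteq> b\<rbrakk> \<Longrightarrow> F a b \<in> carrier G"
    and "\<And>a b. \<lbrakk>a \<in> A; b \<in> A; a \<noteq> b\<rbrakk> \<Longrightarrow> F a b \<oplus> F b a = \<zero>"
  shows "(\<Oplus>a\<in>A. \<Oplus>b\<in>A - {a}. F a b) = \<zero>"
  using assms
proof (induction A rule: finite_induct)
  case (insert x A)
  note F = insert.prems(1)
  have Fx: "(\<lambda>a. F a x) \<in> A \<rightarrow> carrier G" "F x \<in> A \<rightarrow> carrier G"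
    using insert.hyps(2) by (auto intro!: F)
  have FA: "(\<lambda>a. \<Oplus>b\<in>A - {a}. F a b) \<in> A \<rightarrow> carrier G"
    by (auto intro!: finsum_closed F)
  have "(\<Oplus>a\<in>A. \<Oplus>b\<in>insert x A - {a}. F a b) = (\<Oplus>a\<in>A. F a x \<oplus> (\<Oplus>b\<in>A - {a}. F a b))"
  proof (rule finsum_cong')
    fix a assume a: "a \<in> A"
    then have "insert x A - {a} = insert x (A - {a})"
      using insert.hyps(2) by auto
    then show "(\<Oplus>b\<in>insert x A - {a}. F a b) = F a x \<oplus> (\<Oplus>b\<in>A - {a}. F a b)"
      using insert.hyps a Fx by (auto intro!: finsum_insert F)
  qed (use Fx FA in auto)
  also have "\<dots> = (\<Oplus>a\<in>A. F a x) \<oplus> (\<Oplus>a\<in>A. \<Oplus>b\<in>A - {a}. F a b)"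
    using Fx(1) FA by (rule finsum_addf)
  also have "(\<Oplus>a\<in>A. \<Oplus>b\<in>A - {a}. F a b) = \<zero>"
    using insert.prems by (intro insert.IH) auto
  finally have A: "(\<Oplus>a\<in>A. \<Oplus>b\<in>insert x A - {a}. F a b) = (\<Oplus>a\<in>A. F a x)"
    using Fx(1) by simp
  have "(\<Oplus>a\<in>insert x A. \<Oplus>b\<in>insert x A - {a}. F a b) =
      (\<Oplus>b\<in>insert x A - {x}. F x b) \<oplus> (\<Oplus>a\<in>A. \<Oplus>b\<in>insert x A - {a}. F a b)"
    using insert.hyps by (intro finsum_insert) (auto intro!: finsum_closed F)
  also have "insert x A - {x} = A"
    using insert.hyps(2) by auto
  also have "(\<Oplus>b\<in>A. F x b) \<oplus> (\<Oplus>a\<in>A. \<Oplus>b\<in>insert x A - {a}. F a b) = (\<Oplus>a\<in>A. F x a \<oplus> F a x)"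
    unfolding A using finsum_addf[OF Fx(2,1)] by simp
  also have "\<dots> = (\<Oplus>a\<in>A. \<zero>)"
    using insert.hyps(2) by (intro finsum_cong') (auto intro!: insert.prems(2))
  finally show ?case
    by simp
qed simp

text \<open>Two comparisons with the same sign e, later the one on the gluing, combine to a
  comparison of \<open>e\<^sub>0\<close> with \<open>e\<^sub>1\<close> whose twist is the sum of the
  two twists.\<close>

lemma bit_add_twist:
  fixes a b c d e :: bit
  assumes "e\<^sub>0 + a = b + e" "e\<^sub>1 + c = d + e"
  shows "e\<^sub>0 + (a + c) = (b + d) + e\<^sub>1"
proof -
  have "e\<^sub>0 + (a + c) = e\<^sub>1 + (e\<^sub>1 + (e\<^sub>0 + (a + c)))"
    unfolding bit_add_cancel ..
  also have "\<dots> = e\<^sub>1 + ((e\<^sub>0 + a) + (e\<^sub>1 + c))"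
    by (simp only: ac_simps)
  also have "\<dots> = e + (e + (e\<^sub>1 + (b + d)))"
    unfolding assms by (simp only: ac_simps)
  finally show ?thesis
    unfolding bit_add_cancel by (simp only: ac_simps)
qed

text \<open>The map h names faces by elements of the poset, so that sets of arcs can act as the
  faces of a poset of digraphs. The empty face is included and becomes the minimum; levels are
  therefore numbers of vertices and not dimensions.\<close>

locale simplicial_poset =
  fixes r :: "'p rel" and S :: "'e set set" and h :: "'e set \<Rightarrow> 'p"
  assumes finite_S: "finite S" and finite_face: "\<sigma> \<in> S \<Longrightarrow> finite \<sigma>" and empty_S: "{} \<in> S"
    and down: "\<lbrakk>\<sigma> \<in> S; \<tau> \<subseteq> \<sigma>\<rbrakk> \<Longrightarrow> \<tau> \<in> S" and inj_h: "inj_on h S"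
    and r_eq: "r = {(h \<sigma>, h \<tau>) | \<sigma> \<tau>. \<sigma> \<in> S \<and> \<tau> \<in> S \<and> \<sigma> \<subseteq> \<tau>}"
begin

lemma h_eq_iff: "\<lbrakk>\<sigma> \<in> S; \<tau> \<in> S\<rbrakk> \<Longrightarrow> h \<sigma> = h \<tau> \<longleftrightarrow> \<sigma> = \<tau>"
  using inj_h by (auto dest: inj_onD)

lemma Field_r: "Field r = h ` S"
  by (auto simp: r_eq Field_def)

lemma h_le_iff: "\<lbrakk>\<sigma> \<in> S; \<tau> \<in> S\<rbrakk> \<Longrightarrow> (h \<sigma>, h \<tau>) \<in> r \<longleftrightarrow> \<sigma> \<subseteq> \<tau>"
  by (auto simp: r_eq h_eq_iff)

sublocale min_poset r
proof
  show "antisym r"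
    by (rule antisymI) (auto simp: r_eq h_eq_iff)
  show "trans r"
    by (rule transI) (auto simp: r_eq h_eq_iff, blast)
  show "\<exists>m\<in>Field r. \<forall>x\<in>Field r. (m, x) \<in> r"
    using empty_S by (auto simp: Field_r h_le_iff)
qed (auto simp: Field_r h_le_iff finite_S)

lemma min_poset_r: "min_poset r"
  by (rule min_poset_axioms)

lemma poset_min_h: "poset_min r = h {}"
  using empty_S by (intro poset_min_eqI) (auto simp: Field_r h_le_iff)

text \<open>For a face properly contained in \<tau>, removing from \<tau> a vertex outside that face
  gives a face in between, by closure under subsets; a covered face must coincide with it.\<close>

lemma covers_h:
  assumes "\<tau> \<in> S"
  shows "(x, h \<tau>) \<in> covers r \<longleftrightarrow> (\<exists>e\<in>\<tau>. x = h (\<tau> - {e}))"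
proof
  assume *: "(x, h \<tau>) \<in> covers r"
  then obtain \<sigma> where \<sigma>: "x = h \<sigma>" "\<sigma> \<in> S"
    using coversD(2)[OF *] by (auto simp: Field_r)
  then have "\<sigma> \<subset> \<tau>"
    using coversD(1,4)[OF *] assms by (auto simp: h_le_iff)
  then obtain e where e: "e \<in> \<tau>" "e \<notin> \<sigma>"
    by blast
  then have "(h \<sigma>, h (\<tau> - {e})) \<in> r" "(h (\<tau> - {e}), h \<tau>) \<in> r" "\<tau> - {e} \<in> S"
    using \<sigma> \<open>\<sigma> \<subset> \<tau>\<close> assms down[OF assms, of "\<tau> - {e}"] by (auto simp: h_le_iff)
  then have "h (\<tau> - {e}) = h \<sigma> \<or> h (\<tau> - {e}) = h \<tau>"
    using * \<sigma>(1) by (auto simp: covers_def)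
  then show "\<exists>e\<in>\<tau>. x = h (\<tau> - {e})"
    using e \<sigma> assms \<open>\<tau> - {e} \<in> S\<close> by (auto simp: h_eq_iff)
next
  assume "\<exists>e\<in>\<tau>. x = h (\<tau> - {e})"
  then obtain e where e: "e \<in> \<tau>" "x = h (\<tau> - {e})"
    by blast
  have S: "\<tau> - {e} \<in> S"
    using down[OF assms] by blast
  have "z = x \<or> z = h \<tau>" if z: "(x, z) \<in> r" "(z, h \<tau>) \<in> r" for z
  proof -
    obtain \<sigma> where "z = h \<sigma>" "\<sigma> \<in> S"
      using FieldI1[OF z(2)] by (auto simp: Field_r)
    moreover from this have "\<tau> - {e} \<subseteq> \<sigma>" "\<sigma> \<subseteq> \<tau>"
      using z e S assms by (auto simp: h_le_iff)
    then have "\<sigma> = \<tau> - {e} \<or> \<sigma> = \<tau>"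
      by blast
    ultimately show ?thesis
      using e by auto
  qed
  moreover have "(x, h \<tau>) \<in> r" "x \<noteq> h \<tau>"
    using e S assms by (auto simp: h_le_iff h_eq_iff)
  ultimately show "(x, h \<tau>) \<in> covers r"
    by (auto simp: covers_def)
qed

lemma covers_hI: "\<lbrakk>\<tau> \<in> S; e \<in> \<tau>\<rbrakk> \<Longrightarrow> (h (\<tau> - {e}), h \<tau>) \<in> covers r"
  using covers_h by auto

text \<open>Each covering adds exactly one vertex, so all chains from the empty face to \<tau> have
  the same length and the minimum in \<open>level\<close> is taken over one number.\<close>

lemma level_h:
  assumes "\<tau> \<in> S"
  shows "level r (h \<tau>) = card \<tau>"
proof -
  have "(h {}, h \<tau>) \<in> covers r ^^ n \<longleftrightarrow> n = card \<tau>" for n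
    using assms
  proof (induction n arbitrary: \<tau>)
    case 0
    then show ?case
      using empty_S finite_face by (auto simp: h_eq_iff)
  next
    case (Suc n)
    have "\<tau> - {e} \<in> S" "finite \<tau>" for e
      using Suc.prems down[of \<tau>] finite_face by auto
    then have "(\<exists>e\<in>\<tau>. (h {}, h (\<tau> - {e})) \<in> covers r ^^ n) \<longleftrightarrow> (\<exists>e\<in>\<tau>. Suc n = card \<tau>)"
      using Suc.IH card_Suc_Diff1 by (metis Suc_inject)
    moreover have "(\<exists>e\<in>\<tau>. Suc n = card \<tau>) \<longleftrightarrow> Suc n = card \<tau>"
      by (cases "\<tau> = {}") auto
    ultimately show ?case
      using covers_h[OF Suc.prems] by (auto simp: relcomp_unfold)
  qed
  then show ?thesis
    by (simp add: level_def poset_min_h Least_equality)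
qed

lemma mem_level_set: "x \<in> level_set r n \<longleftrightarrow> (\<exists>\<tau>\<in>S. x = h \<tau> \<and> int (card \<tau>) = n)"
  by (auto simp: level_set_def Field_r level_h)

lemma coversE:
  assumes "(x, y) \<in> covers r"
  obtains \<tau> e where "\<tau> \<in> S" "e \<in> \<tau>" "x = h (\<tau> - {e})" "y = h \<tau>"
  using assms coversD(3)[OF assms] covers_h by (auto simp: Field_r)

text \<open>Removing a and then c gives the same face as removing b and then d; as a and b differ, c
  must be b. Squares are thus parametrised by a face and two of its vertices.\<close>

lemma squareE:
  assumes "(x, y) \<in> covers r" "(y, z) \<in> covers r" "(x, y') \<in> covers r" "(y', z) \<in> covers r" "y \<noteq> y'"
  obtains \<tau> a b where "\<tau> \<in> S" "a \<in> \<tau>" "b \<in> \<tau>" "a \<noteq> b" "x = h (\<tau> - {a, b})"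
    "y = h (\<tau> - {a})" "y' = h (\<tau> - {b})" "z = h \<tau>"
proof -
  obtain \<tau> a where \<tau>: "\<tau> \<in> S" "a \<in> \<tau>" "y = h (\<tau> - {a})" "z = h \<tau>"
    using coversE[OF assms(2)] .
  then obtain b where b: "b \<in> \<tau>" "y' = h (\<tau> - {b})"
    using assms(4) covers_h by blast
  have S: "\<tau> - A \<in> S" for A
    using down[OF \<tau>(1)] by blast
  obtain c where c: "c \<in> \<tau> - {a}" "x = h (\<tau> - {a} - {c})"
    using assms(1) \<tau>(3) covers_h[OF S] by blast
  obtain d where d: "d \<in> \<tau> - {b}" "x = h (\<tau> - {b} - {d})"
    using assms(3) b(2) covers_h[OF S] by blast
  have "\<tau> - {a} - {c} = \<tau> - {b} - {d}"
    using c(2) d(2) h_eq_iff[of "\<tau> - {a} - {c}" "\<tau> - {b} - {d}"] down[OF S, of "\<tau> - {a} - {c}" "{a}"]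
      down[OF S, of "\<tau> - {b} - {d}" "{b}"] by simp
  moreover have "a \<noteq> b"
    using assms(5) \<tau> b by auto
  ultimately have "c = b"
    using b(1) by auto
  moreover have "\<tau> - {a} - {b} = \<tau> - {a, b}"
    by auto
  ultimately show thesis
    using that[OF \<tau>(1,2) b(1) \<open>a \<noteq> b\<close> _ \<tau>(3) b(2) \<tau>(4)] c(2) by simp
qed

lemma square:
  assumes "\<tau> \<in> S" "a \<in> \<tau>" "b \<in> \<tau>" "a \<noteq> b"
  shows "(h (\<tau> - {a, b}), h (\<tau> - {a})) \<in> covers r" "(h (\<tau> - {a}), h \<tau>) \<in> covers r"
    "(h (\<tau> - {a, b}), h (\<tau> - {b})) \<in> covers r" "(h (\<tau> - {b}), h \<tau>) \<in> covers r"
    "h (\<tau> - {a}) \<noteq> h (\<tau> - {b})"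
proof -
  have S: "\<tau> - A \<in> S" for A
    using down[OF assms(1)] by blast
  show "(h (\<tau> - {a, b}), h (\<tau> - {a})) \<in> covers r"
    using covers_hI[OF S, of b "{a}"] assms by (simp add: Diff_insert2[of \<tau> a "{b}"])
  show "(h (\<tau> - {a, b}), h (\<tau> - {b})) \<in> covers r"
    using covers_hI[OF S, of a "{b}"] assms by (simp add: Diff_insert[of \<tau> a "{b}"])
  show "(h (\<tau> - {a}), h \<tau>) \<in> covers r" "(h (\<tau> - {b}), h \<tau>) \<in> covers r"
    using covers_hI[OF assms(1)] assms by simp_all
  show "h (\<tau> - {a}) \<noteq> h (\<tau> - {b})"
    using assms S by (auto simp: h_eq_iff)
qed

text \<open>These are the classical incidence signs for an arbitrary numbering of the vertices. For
  two vertices of \<tau>, removing the smaller one lowers the count of the larger one by one, while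
  removing the larger one leaves the count of the smaller one unchanged; this single change is the 1
  of the square condition.\<close>

lemma ex_sign_assignment: "\<exists>\<epsilon>. sign_assignment r \<epsilon>"
proof -
  have "finite (\<Union>S)"
    using finite_S finite_face by simp
  then obtain f :: "'e \<Rightarrow> nat" where f: "inj_on f (\<Union>S)"
    by (meson finite_imp_inj_to_nat_seg)
  define s :: "'e set \<Rightarrow> 'e \<Rightarrow> bit" where "s \<tau> e = of_nat (card {a \<in> \<tau>. f a < f e})" for \<tau> e
  \<comment> \<open>The faces are recovered from their names; on a covering pair their difference is
    a singleton, so \<open>the_elem\<close> returns the removed vertex.\<close>
  define \<epsilon> where "\<epsilon> x y = (let \<sigma> = the_inv_into S h x; \<tau> = the_inv_into S h y
    in s \<tau> (the_elem (\<tau> - \<sigma>)))" for x y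
  have \<epsilon>: "\<epsilon> (h (\<tau> - {e})) (h \<tau>) = s \<tau> e" if "\<tau> \<in> S" "e \<in> \<tau>" for \<tau> e
  proof -
    have "\<tau> - {e} \<in> S" "\<tau> - (\<tau> - {e}) = {e}"
      using that down[OF that(1), of "\<tau> - {e}"] by auto
    then show ?thesis
      using that(1) by (simp add: \<epsilon>_def the_inv_into_f_f[OF inj_h])
  qed
  have swap: "s (\<tau> - {b}) a + s \<tau> b = s (\<tau> - {a}) b + s \<tau> a + 1"
    if \<tau>: "\<tau> \<in> S" "a \<in> \<tau>" "b \<in> \<tau>" "f a < f b" for \<tau> a b
  proof -
    have "{c \<in> \<tau> - {b}. f c < f a} = {c \<in> \<tau>. f c < f a}"
      using \<tau>(4) by auto
    moreover have "{c \<in> \<tau>. f c < f b} = insert a {c \<in> \<tau> - {a}. f c < f b}"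
      using \<tau> by auto
    ultimately show ?thesis
      using finite_face[OF \<tau>(1)] by (simp add: s_def)
  qed
  have "sign_assignment r \<epsilon>"
    unfolding sign_assignment_def
  proof (intro allI impI, elim conjE)
    fix x y y' z
    assume sq: "(x, y) \<in> covers r" "(y, z) \<in> covers r" "(x, y') \<in> covers r" "(y', z) \<in> covers r" "y \<noteq> y'"
    obtain \<tau> a b where \<tau>: "\<tau> \<in> S" "a \<in> \<tau>" "b \<in> \<tau>" "a \<noteq> b" and eq: "x = h (\<tau> - {a, b})"
      "y = h (\<tau> - {a})" "y' = h (\<tau> - {b})" "z = h \<tau>"
      by (rule squareE[OF sq])
    have S: "\<tau> - {a} \<in> S" "\<tau> - {b} \<in> S"
      using down[OF \<tau>(1)] by auto
    have "\<tau> - {a} - {b} = \<tau> - {a, b}" "\<tau> - {b} - {a} = \<tau> - {a, b}"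
      by auto
    then have e: "\<epsilon> x y = s (\<tau> - {a}) b" "\<epsilon> x y' = s (\<tau> - {b}) a" "\<epsilon> y z = s \<tau> a" "\<epsilon> y' z = s \<tau> b"
      using \<epsilon>[OF S(1), of b] \<epsilon>[OF S(2), of a] \<epsilon>[OF \<tau>(1)] \<tau> eq by simp_all
    \<comment> \<open>Modulo 2 the summand 1 may change sides; this serves the case in which y
      arises by removing the smaller of the two vertices.\<close>
    have flip: "q = p + 1" if "p = q + 1" for p q :: bit
      using that by (cases q) simp_all
    have "f a \<noteq> f b"
      using inj_onD[OF f, of a b] \<tau> by auto
    then consider "f a < f b" | "f b < f a"
      by linarith
    then show "\<epsilon> x y + \<epsilon> y z = \<epsilon> x y' + \<epsilon> y' z + 1"
    proof cases
      case 1
      then show ?thesis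
        unfolding e by (rule flip[OF swap[OF \<tau>(1,2,3)]])
    next
      case 2
      then show ?thesis
        unfolding e by (rule swap[OF \<tau>(1,3,2)])
    qed
  qed
  then show ?thesis
    by blast
qed

text \<open>The sum of the two sign assignments is a 1-cocycle. Its primitive \<open>\<eta>\<close> is built by induction on
the dimension, descending along an arbitrarily chosen facet; the square condition makes the choice
irrelevant.\<close>

lemma sign_assignment_unique:
  assumes "sign_assignment r \<epsilon>" "sign_assignment r \<epsilon>'"
  shows "\<exists>\<eta>. \<forall>x y. (x, y) \<in> covers r \<longrightarrow> \<epsilon> x y + \<eta> x = \<eta> y + \<epsilon>' x y"
proof -
  define \<beta> where "\<beta> \<sigma> \<tau> = \<epsilon> (h \<sigma>) (h \<tau>) + \<epsilon>' (h \<sigma>) (h \<tau>)" for \<sigma> \<tau>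
  have \<beta>: "\<beta> (\<tau> - {a, b}) (\<tau> - {a}) + \<beta> (\<tau> - {a}) \<tau> = \<beta> (\<tau> - {a, b}) (\<tau> - {b}) + \<beta> (\<tau> - {b}) \<tau>"
    if "\<tau> \<in> S" "a \<in> \<tau>" "b \<in> \<tau>" "a \<noteq> b" for \<tau> a b
  proof -
    note sq = square[OF that]
    have "e (h (\<tau> - {a, b})) (h (\<tau> - {a})) + e (h (\<tau> - {a})) (h \<tau>) =
        e (h (\<tau> - {a, b})) (h (\<tau> - {b})) + e (h (\<tau> - {b})) (h \<tau>) + 1" if "sign_assignment r e" for e
      using that sq unfolding sign_assignment_def by metis
    from bit_add_square[OF this[OF assms(1)] this[OF assms(2)]] show ?thesis
      unfolding \<beta>_def .
  qed
  have "\<exists>\<eta>. \<forall>\<tau>\<in>S. card \<tau> \<le> n \<longrightarrow> (\<forall>e\<in>\<tau>. \<beta> (\<tau> - {e}) \<tau> = \<eta> (\<tau> - {e}) + \<eta> \<tau>)" for n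
  proof (induction n)
    case 0
    then show ?case
      using finite_face by auto
  next
    case (Suc n)
    then obtain \<eta> where \<eta>: "\<And>\<tau> e. \<lbrakk>\<tau> \<in> S; card \<tau> \<le> n; e \<in> \<tau>\<rbrakk> \<Longrightarrow> \<beta> (\<tau> - {e}) \<tau> = \<eta> (\<tau> - {e}) + \<eta> \<tau>"
      by blast
    define m where "m \<tau> = (SOME e. e \<in> \<tau>)" for \<tau> :: "'e set"
    \<comment> \<open>Only faces with exactly n + 1 vertices receive a new value, so the equations
      already known for smaller faces survive.\<close>
    define \<eta>' where "\<eta>' \<tau> = (if card \<tau> = Suc n then \<eta> (\<tau> - {m \<tau>}) + \<beta> (\<tau> - {m \<tau>}) \<tau> else \<eta> \<tau>)" for \<tau>
    have "\<beta> (\<tau> - {e}) \<tau> = \<eta>' (\<tau> - {e}) + \<eta>' \<tau>" if \<tau>: "\<tau> \<in> S" "card \<tau> \<le> Suc n" "e \<in> \<tau>" for \<tau> e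
    proof (cases "card \<tau> = Suc n")
      case False
      have "card (\<tau> - {e}) \<noteq> Suc n"
        using card_Diff1_le[of \<tau> e] \<tau>(2) False by linarith
      then show ?thesis
        using \<eta>[OF \<tau>(1) _ \<tau>(3)] \<tau>(2) False by (simp add: \<eta>'_def)
    next
      case True
      have fin: "finite \<tau>"
        using finite_face \<tau>(1) .
      have card: "card (\<tau> - {a}) = n" if "a \<in> \<tau>" for a
        using True that fin by simp
      have S: "\<tau> - A \<in> S" for A
        using down[OF \<tau>(1)] by blast
      have m: "m \<tau> \<in> \<tau>"
        unfolding m_def using \<tau>(3) by (rule someI)
      have eq: "\<eta>' (\<tau> - {e}) = \<eta> (\<tau> - {e})" "\<eta>' \<tau> = \<eta> (\<tau> - {m \<tau>}) + \<beta> (\<tau> - {m \<tau>}) \<tau>"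
        using card[OF \<tau>(3)] True by (simp_all add: \<eta>'_def)
      show ?thesis
      proof (cases "e = m \<tau>")
        case True
        then show ?thesis
          unfolding eq by (simp only: bit_add_cancel)
      next
        case False
        \<comment> \<open>In the square spanned by \<tau> and the vertices e and
          \<open>m \<tau>\<close>, the two lower edges obey the induction hypothesis and one upper
          edge fits by definition of \<eta>'; the cocycle condition settles the other one.\<close>
        have "\<tau> - {e} - {m \<tau>} = \<tau> - {e, m \<tau>}" "\<tau> - {m \<tau>} - {e} = \<tau> - {e, m \<tau>}"
          by auto
        then have "\<beta> (\<tau> - {e, m \<tau>}) (\<tau> - {e}) = \<eta> (\<tau> - {e, m \<tau>}) + \<eta> (\<tau> - {e})"
          "\<beta> (\<tau> - {e, m \<tau>}) (\<tau> - {m \<tau>}) = \<eta> (\<tau> - {e, m \<tau>}) + \<eta> (\<tau> - {m \<tau>})"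
          using \<eta>[OF S, of "{e}" "m \<tau>"] \<eta>[OF S, of "{m \<tau>}" e] card m \<tau>(3) False by auto
        with \<beta>[OF \<tau>(1,3) m False] show ?thesis
          unfolding eq by (cases "\<eta> (\<tau> - {e, m \<tau>})"; cases "\<eta> (\<tau> - {e})"; cases "\<eta> (\<tau> - {m \<tau>})";
            cases "\<beta> (\<tau> - {e}) \<tau>"; cases "\<beta> (\<tau> - {m \<tau>}) \<tau>") simp_all
      qed
    qed
    then show ?case
      by blast
  qed
  \<comment> \<open>No face has more vertices than this, so one \<eta> serves the whole
    complex.\<close>
  from this[of "Max (card ` S)"] obtain \<eta>
    where "\<forall>\<tau>\<in>S. card \<tau> \<le> Max (card ` S) \<longrightarrow> (\<forall>e\<in>\<tau>. \<beta> (\<tau> - {e}) \<tau> = \<eta> (\<tau> - {e}) + \<eta> \<tau>)"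
    by blast
  then have \<eta>: "\<beta> (\<tau> - {e}) \<tau> = \<eta> (\<tau> - {e}) + \<eta> \<tau>" if "\<tau> \<in> S" "e \<in> \<tau>" for \<tau> e
    using that finite_S by simp
  show ?thesis
  proof (intro exI[of _ "\<lambda>x. \<eta> (the_inv_into S h x)"] allI impI)
    fix x y assume "(x, y) \<in> covers r"
    then obtain \<tau> e where \<tau>: "\<tau> \<in> S" "e \<in> \<tau>" "x = h (\<tau> - {e})" "y = h \<tau>"
      by (rule coversE)
    have "\<tau> - {e} \<in> S"
      using down[OF \<tau>(1)] by blast
    then show "\<epsilon> x y + \<eta> (the_inv_into S h x) = \<eta> (the_inv_into S h y) + \<epsilon>' x y"
      using \<eta>[OF \<tau>(1,2)] \<tau> unfolding \<beta>_def
      by (cases "\<epsilon> x y"; cases "\<epsilon>' x y") (simp_all add: the_inv_into_f_f[OF inj_h] add.commute)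
  qed
qed

text \<open>The elements covered by a face correspond to its vertices, and distinct vertices give
  distinct facets, so the sum can run over vertices.\<close>

lemma poset_diff_h:
  assumes "field K" "\<tau> \<in> S" "int (card \<tau>) = n + 1" "c \<in> level_set r n \<rightarrow>\<^sub>E carrier K"
  shows "poset_diff K r \<epsilon> n c (h \<tau>) =
    (\<Oplus>\<^bsub>K\<^esub>e\<in>\<tau>. sgn_val K (\<epsilon> (h (\<tau> - {e})) (h \<tau>)) \<otimes>\<^bsub>K\<^esub> c (h (\<tau> - {e})))"
proof -
  interpret field K by fact
  have S: "\<tau> - {e} \<in> S" for e
    using down[OF assms(2)] by blast
  have lev: "h (\<tau> - {e}) \<in> level_set r n" if "e \<in> \<tau>" for e
  proof -
    have "card (\<tau> - {e}) = card \<tau> - 1" "card \<tau> > 0"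
      using that finite_face[OF assms(2)] by (auto simp: card_gt_0_iff)
    then show ?thesis
      using S assms(3) by (auto simp: mem_level_set)
  qed
  have "{x \<in> level_set r n. (x, h \<tau>) \<in> covers r} = (\<lambda>e. h (\<tau> - {e})) ` \<tau>"
    using lev covers_h[OF assms(2)] by auto
  moreover have "inj_on (\<lambda>e. h (\<tau> - {e})) \<tau>"
    using S by (auto intro!: inj_onI simp: h_eq_iff)
  moreover have "h \<tau> \<in> level_set r (n + 1)"
    using assms(2,3) by (auto simp: mem_level_set)
  moreover have "c x \<in> carrier K" if "x \<in> level_set r n" for x
    using assms(4) that by auto
  ultimately show ?thesis
    using lev by (simp add: poset_diff_def finsum_reindex sgn_val_closed[OF assms(1)] image_subset_iff Pi_iff)
qed

text \<open>At a face \<tau> the value of d d c is a sum over ordered pairs of distinct vertices.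
  The two orders of a pair are the two sides of a square, whose sign condition makes their terms
  opposite.\<close>

lemma poset_cochain_complex:
  assumes "field K" and sign: "sign_assignment r \<epsilon>"
  shows "cochain_complex K (poset_cochains K r \<epsilon>)"
  unfolding cochain_complex_def
proof (intro allI conjI ballI poset_diff_linear[OF assms(1)])
  interpret field K by fact
  fix n
  show "vectorspace K (coch (poset_cochains K r \<epsilon>) n)"
    by (simp add: poset_cochains_simps func_space_vs[OF assms(1)])
  fix c assume "c \<in> carrier (coch (poset_cochains K r \<epsilon>) n)"
  then have c: "c \<in> level_set r n \<rightarrow>\<^sub>E carrier K"
    by (simp add: poset_cochains_simps func_space_simps[OF ring_axioms])
  have "poset_diff K r \<epsilon> n c \<in> carrier (coch (poset_cochains K r \<epsilon>) (n + 1))"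
    using linear_map.T_im[OF poset_diff_linear[OF assms(1)], of c r \<epsilon> n] c
    by (simp add: poset_cochains_simps func_space_simps[OF ring_axioms])
  then have dc: "poset_diff K r \<epsilon> n c \<in> level_set r (n + 1) \<rightarrow>\<^sub>E carrier K"
    by (simp add: poset_cochains_simps func_space_simps[OF ring_axioms])
  have "poset_diff K r \<epsilon> (n + 1) (poset_diff K r \<epsilon> n c) z = \<zero>\<^bsub>K\<^esub>" if z: "z \<in> level_set r (n + 1 + 1)" for z
  proof -
    obtain \<tau> where \<tau>: "\<tau> \<in> S" "z = h \<tau>" "int (card \<tau>) = n + 1 + 1"
      using z by (auto simp: mem_level_set)
    have fin: "finite \<tau>"
      using finite_face \<tau>(1) .
    have S: "\<tau> - A \<in> S" for A
      using down[OF \<tau>(1)] by blast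
    have card: "int (card (\<tau> - {e})) = n + 1" if "e \<in> \<tau>" for e
    proof -
      have "card \<tau> = Suc (card (\<tau> - {e}))"
        using card_Suc_Diff1[OF fin that] by simp
      then show ?thesis
        using \<tau>(3) by simp
    qed
    define s where "s a b = sgn_val K (\<epsilon> (h a) (h b))" for a b
    have s: "s a b \<in> carrier K" for a b
      by (simp add: s_def sgn_val_closed[OF assms(1)])
    \<comment> \<open>The contribution to d d c at \<tau> of removing e from \<tau> and then e' from
      the rest.\<close>
    define F where "F e e' = s (\<tau> - {e}) \<tau> \<otimes>\<^bsub>K\<^esub> (s (\<tau> - {e, e'}) (\<tau> - {e}) \<otimes>\<^bsub>K\<^esub> c (h (\<tau> - {e, e'})))" for e e'
    have cl: "c (h (\<tau> - {e, e'})) \<in> carrier K" if "e \<in> \<tau>" "e' \<in> \<tau>" "e \<noteq> e'" for e e'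
    proof -
      have "card (\<tau> - {e, e'}) = card \<tau> - 2" "card {e, e'} \<le> card \<tau>"
        using that fin card_mono[OF fin, of "{e, e'}"] by (auto simp: card_Diff_subset)
      then have "h (\<tau> - {e, e'}) \<in> level_set r n"
        using S \<tau>(3) that by (auto simp: mem_level_set of_nat_diff)
      then show ?thesis
        using c by auto
    qed
    have F: "F e e' \<in> carrier K" if "e \<in> \<tau>" "e' \<in> \<tau>" "e \<noteq> e'" for e e'
      using that cl s by (simp add: F_def)
    have anti: "F e e' \<oplus>\<^bsub>K\<^esub> F e' e = \<zero>\<^bsub>K\<^esub>" if e: "e \<in> \<tau>" "e' \<in> \<tau>" "e \<noteq> e'" for e e'
    proof -
      have sq: "\<epsilon> (h (\<tau> - {e, e'})) (h (\<tau> - {e})) + \<epsilon> (h (\<tau> - {e})) (h \<tau>) =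
          \<epsilon> (h (\<tau> - {e, e'})) (h (\<tau> - {e'})) + \<epsilon> (h (\<tau> - {e'})) (h \<tau>) + 1"
        by (intro sign[unfolded sign_assignment_def, rule_format] conjI square[OF \<tau>(1) e])
      have "s (\<tau> - {e}) \<tau> \<otimes>\<^bsub>K\<^esub> s (\<tau> - {e, e'}) (\<tau> - {e}) =
          \<ominus>\<^bsub>K\<^esub> (s (\<tau> - {e'}) \<tau> \<otimes>\<^bsub>K\<^esub> s (\<tau> - {e, e'}) (\<tau> - {e'}))"
        unfolding s_def sgn_val_mult[OF assms(1)] using sq
        by (auto simp: sgn_val_def add.commute)
      then show ?thesis
        using cl[OF e] s by (simp add: F_def insert_commute[of e' e] l_minus l_neg flip: m_assoc)
    qed
    have "poset_diff K r \<epsilon> (n + 1) (poset_diff K r \<epsilon> n c) z =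
        (\<Oplus>\<^bsub>K\<^esub>e\<in>\<tau>. s (\<tau> - {e}) \<tau> \<otimes>\<^bsub>K\<^esub> poset_diff K r \<epsilon> n c (h (\<tau> - {e})))"
      using poset_diff_h[OF assms(1) \<tau>(1,3) dc] by (simp add: \<tau>(2) s_def)
    also have "\<dots> = (\<Oplus>\<^bsub>K\<^esub>e\<in>\<tau>. \<Oplus>\<^bsub>K\<^esub>e'\<in>\<tau> - {e}. F e e')"
    proof (rule finsum_cong')
      fix e assume e: "e \<in> \<tau>"
      have eq: "\<tau> - {e} - {e'} = \<tau> - {e, e'}" for e'
        by auto
      have "s (\<tau> - {e}) \<tau> \<otimes>\<^bsub>K\<^esub> poset_diff K r \<epsilon> n c (h (\<tau> - {e})) = s (\<tau> - {e}) \<tau> \<otimes>\<^bsub>K\<^esub>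
          (\<Oplus>\<^bsub>K\<^esub>e'\<in>\<tau> - {e}. s (\<tau> - {e, e'}) (\<tau> - {e}) \<otimes>\<^bsub>K\<^esub> c (h (\<tau> - {e, e'})))"
        using poset_diff_h[OF assms(1) S card[OF e] c] by (simp add: s_def eq)
      also have "\<dots> = (\<Oplus>\<^bsub>K\<^esub>e'\<in>\<tau> - {e}. F e e')"
        unfolding F_def using e fin s cl by (intro finsum_rdistr) auto
      finally show "s (\<tau> - {e}) \<tau> \<otimes>\<^bsub>K\<^esub> poset_diff K r \<epsilon> n c (h (\<tau> - {e})) = (\<Oplus>\<^bsub>K\<^esub>e'\<in>\<tau> - {e}. F e e')" .
    qed (use F in \<open>auto intro!: finsum_closed\<close>)
    also have "\<dots> = \<zero>\<^bsub>K\<^esub>"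
      using fin F anti by (rule finsum_antisymmetric)
    finally show ?thesis .
  qed
  then have "poset_diff K r \<epsilon> (n + 1) (poset_diff K r \<epsilon> n c) = (\<lambda>z\<in>level_set r (n + 1 + 1). \<zero>\<^bsub>K\<^esub>)"
    by (intro extensionalityI[of _ "level_set r (n + 1 + 1)"]) (auto simp: poset_diff_def)
  then show "cobd (poset_cochains K r \<epsilon>) (n + 1) (cobd (poset_cochains K r \<epsilon>) n c) =
      \<zero>\<^bsub>coch (poset_cochains K r \<epsilon>) (n + 1 + 1)\<^esub>"
    unfolding poset_cochains_simps func_space_simps(2)[OF ring_axioms] .
qed

end

section \<open>Gluing\<close>

text \<open>An interface free of equivalence classes: \<open>gl\<close> is the union of down-closed
  copies of \<open>r\<^sub>1\<close> and \<open>r\<^sub>2\<close> that meet exactly in the copy of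
  r. The short exact sequence needs no more of the gluing than this.\<close>

locale pushout_posets =
  e1: lower_embedding_posets r r\<^sub>1 j\<^sub>1 + e2: lower_embedding_posets r r\<^sub>2 j\<^sub>2 +
  f1: lower_embedding_posets r\<^sub>1 gl q\<^sub>1 + f2: lower_embedding_posets r\<^sub>2 gl q\<^sub>2
  for r :: "'p rel" and r\<^sub>1 :: "'q rel" and r\<^sub>2 :: "'s rel" and gl :: "'t rel"
    and j\<^sub>1 j\<^sub>2 q\<^sub>1 q\<^sub>2 +
  assumes Field_gl: "Field gl = q\<^sub>1 ` Field r\<^sub>1 \<union> q\<^sub>2 ` Field r\<^sub>2"
    and overlap: "\<lbrakk>x \<in> Field r\<^sub>1; y \<in> Field r\<^sub>2\<rbrakk> \<Longrightarrow>
      q\<^sub>1 x = q\<^sub>2 y \<longleftrightarrow> (\<exists>p\<in>Field r. x = j\<^sub>1 p \<and> y = j\<^sub>2 p)"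
begin

lemma q_j: "p \<in> Field r \<Longrightarrow> q\<^sub>1 (j\<^sub>1 p) = q\<^sub>2 (j\<^sub>2 p)"
  using overlap e1.j_Field e2.j_Field by blast

text \<open>The given signs on \<open>r\<^sub>1\<close> and \<open>r\<^sub>2\<close> may disagree on
  r, but only by the coboundary of some \<eta>. Adding to \<open>\<epsilon>\<^sub>2\<close> the
  coboundary of an extension of \<eta> removes the disagreement. The patched function is a sign
  assignment because a square lies below its top, hence inside one copy.\<close>

lemma sign_assignment_gl:
  assumes "\<And>\<epsilon> \<epsilon>'. \<lbrakk>sign_assignment r \<epsilon>; sign_assignment r \<epsilon>'\<rbrakk> \<Longrightarrow>
      \<exists>\<eta>. \<forall>x y. (x, y) \<in> covers r \<longrightarrow> \<epsilon> x y + \<eta> x = \<eta> y + \<epsilon>' x y"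
    and "sign_assignment r\<^sub>1 \<epsilon>\<^sub>1" "sign_assignment r\<^sub>2 \<epsilon>\<^sub>2"
  shows "\<exists>\<epsilon>. sign_assignment gl \<epsilon>"
proof -
  obtain \<eta> where \<eta>: "\<And>x y. (x, y) \<in> covers r \<Longrightarrow>
      \<epsilon>\<^sub>2 (j\<^sub>2 x) (j\<^sub>2 y) + \<eta> x = \<eta> y + \<epsilon>\<^sub>1 (j\<^sub>1 x) (j\<^sub>1 y)"
    using assms(1)[OF e2.sign_assignment_j[OF assms(3)] e1.sign_assignment_j[OF assms(2)]] by blast
  \<comment> \<open>Any extension of \<eta> from r to \<open>r\<^sub>2\<close> would do, since
    adding a coboundary preserves the square condition; outside the copy of r the value 0 is
    taken.\<close>
  define \<eta>' where "\<eta>' y = (if y \<in> j\<^sub>2 ` Field r then \<eta> (the_inv_into (Field r) j\<^sub>2 y) else 0)" for y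
  have \<eta>': "\<eta>' (j\<^sub>2 p) = \<eta> p" if "p \<in> Field r" for p
    using that by (simp add: \<eta>'_def the_inv_into_f_f[OF e2.j_inj])
  define \<epsilon>\<^sub>2' where "\<epsilon>\<^sub>2' x y = \<epsilon>\<^sub>2 x y + (\<eta>' x + \<eta>' y)" for x y
  have \<epsilon>\<^sub>2'_j: "\<epsilon>\<^sub>2' (j\<^sub>2 x) (j\<^sub>2 y) = \<epsilon>\<^sub>1 (j\<^sub>1 x) (j\<^sub>1 y)" if "(x, y) \<in> covers r" for x y
  proof -
    have "\<epsilon>\<^sub>2' (j\<^sub>2 x) (j\<^sub>2 y) = \<eta> y + (\<epsilon>\<^sub>2 (j\<^sub>2 x) (j\<^sub>2 y) + \<eta> x)"
      unfolding \<epsilon>\<^sub>2'_def \<eta>'[OF coversD(2)[OF that]] \<eta>'[OF coversD(3)[OF that]] by (simp only: ac_simps)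
    then show ?thesis
      unfolding \<eta>[OF that] bit_add_cancel .
  qed
  have sign\<^sub>2: "sign_assignment r\<^sub>2 \<epsilon>\<^sub>2'"
    unfolding sign_assignment_def
  proof (intro allI impI)
    fix x y y' z assume *: "(x, y) \<in> covers r\<^sub>2 \<and> (y, z) \<in> covers r\<^sub>2 \<and> (x, y') \<in> covers r\<^sub>2 \<and>
      (y', z) \<in> covers r\<^sub>2 \<and> y \<noteq> y'"
    \<comment> \<open>The value of \<eta>' at the middle element occurs twice and cancels, so the
      correction depends on the ends x and z only and is the same along both sides of a
      square.\<close>
    have twist: "\<epsilon>\<^sub>2' x y + \<epsilon>\<^sub>2' y z = \<eta>' x + \<eta>' z + (\<epsilon>\<^sub>2 x y + \<epsilon>\<^sub>2 y z)" for y
    proof -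
      have "\<epsilon>\<^sub>2' x y + \<epsilon>\<^sub>2' y z = \<eta>' y + (\<eta>' y + (\<eta>' x + \<eta>' z + (\<epsilon>\<^sub>2 x y + \<epsilon>\<^sub>2 y z)))"
        unfolding \<epsilon>\<^sub>2'_def by (simp only: ac_simps)
      then show ?thesis
        unfolding bit_add_cancel .
    qed
    have "\<epsilon>\<^sub>2 x y + \<epsilon>\<^sub>2 y z = \<epsilon>\<^sub>2 x y' + \<epsilon>\<^sub>2 y' z + 1"
      using assms(3) * unfolding sign_assignment_def by blast
    then show "\<epsilon>\<^sub>2' x y + \<epsilon>\<^sub>2' y z = \<epsilon>\<^sub>2' x y' + \<epsilon>\<^sub>2' y' z + 1"
      unfolding twist by (simp only: add.assoc)
  qed
  \<comment> \<open>The upper element decides the case: if Y is in the first copy, so is everything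
    it covers.\<close>
  define \<epsilon> where "\<epsilon> X Y = (if Y \<in> q\<^sub>1 ` Field r\<^sub>1
      then \<epsilon>\<^sub>1 (the_inv_into (Field r\<^sub>1) q\<^sub>1 X) (the_inv_into (Field r\<^sub>1) q\<^sub>1 Y)
      else \<epsilon>\<^sub>2' (the_inv_into (Field r\<^sub>2) q\<^sub>2 X) (the_inv_into (Field r\<^sub>2) q\<^sub>2 Y))" for X Y
  have \<epsilon>\<^sub>1: "\<epsilon> (q\<^sub>1 x) (q\<^sub>1 y) = \<epsilon>\<^sub>1 x y" if "(x, y) \<in> covers r\<^sub>1" for x y
    using coversD(2,3)[OF that] by (simp add: \<epsilon>_def the_inv_into_f_f[OF f1.j_inj])
  have \<epsilon>\<^sub>2: "\<epsilon> (q\<^sub>2 x) (q\<^sub>2 y) = \<epsilon>\<^sub>2' x y" if c: "(x, y) \<in> covers r\<^sub>2" for x y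
  proof (cases "q\<^sub>2 y \<in> q\<^sub>1 ` Field r\<^sub>1")
    case True
    then obtain p where p: "p \<in> Field r" "y = j\<^sub>2 p"
      using overlap coversD(3)[OF c] by (metis imageE)
    then obtain p' where p': "(p', p) \<in> covers r" "x = j\<^sub>2 p'"
      using e2.covers_below c by blast
    then have "\<epsilon> (q\<^sub>2 x) (q\<^sub>2 y) = \<epsilon> (q\<^sub>1 (j\<^sub>1 p')) (q\<^sub>1 (j\<^sub>1 p))"
      using q_j[OF coversD(2)[OF p'(1)]] q_j[OF p(1)] p by simp
    also have "\<dots> = \<epsilon>\<^sub>2' x y"
      unfolding \<epsilon>\<^sub>1[OF e1.covers_j[OF p'(1)]] \<epsilon>\<^sub>2'_j[OF p'(1), symmetric] p(2) p'(2) ..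
    finally show ?thesis .
  next
    case False
    then show ?thesis
      using coversD(2,3)[OF c] by (simp add: \<epsilon>_def the_inv_into_f_f[OF f2.j_inj])
  qed
  have "sign_assignment gl \<epsilon>"
    unfolding sign_assignment_def
  proof (intro allI impI, elim conjE)
    fix X Y Y' Z
    assume sq: "(X, Y) \<in> covers gl" "(Y, Z) \<in> covers gl" "(X, Y') \<in> covers gl" "(Y', Z) \<in> covers gl" "Y \<noteq> Y'"
    show "\<epsilon> X Y + \<epsilon> Y Z = \<epsilon> X Y' + \<epsilon> Y' Z + 1"
    proof (cases "Z \<in> q\<^sub>1 ` Field r\<^sub>1")
      case True
      then obtain z where z: "z \<in> Field r\<^sub>1" "Z = q\<^sub>1 z"
        by blast
      obtain y y' where y: "(y, z) \<in> covers r\<^sub>1" "Y = q\<^sub>1 y" "(y', z) \<in> covers r\<^sub>1" "Y' = q\<^sub>1 y'"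
        using sq(2,4) f1.covers_below[OF z(1)] z(2) by blast
      obtain x x' where x: "(x, y) \<in> covers r\<^sub>1" "X = q\<^sub>1 x" "(x', y') \<in> covers r\<^sub>1" "X = q\<^sub>1 x'"
        using sq(1,3) f1.covers_below coversD(2)[OF y(1)] coversD(2)[OF y(3)] y(2,4) by metis
      have "x' = x"
        using inj_onD[OF f1.j_inj] x coversD(2)[OF x(1)] coversD(2)[OF x(3)] by auto
      moreover have "y \<noteq> y'"
        using sq(5) y by auto
      ultimately have "\<epsilon>\<^sub>1 x y + \<epsilon>\<^sub>1 y z = \<epsilon>\<^sub>1 x y' + \<epsilon>\<^sub>1 y' z + 1"
        using x y by (intro assms(2)[unfolded sign_assignment_def, rule_format] conjI) auto
      then show ?thesis
        using \<epsilon>\<^sub>1[OF x(1)] \<epsilon>\<^sub>1[OF x(3)] \<epsilon>\<^sub>1[OF y(1)] \<epsilon>\<^sub>1[OF y(3)] \<open>x' = x\<close> x(2) y(2,4) z(2) by simp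
    next
      case False
      then obtain z where z: "z \<in> Field r\<^sub>2" "Z = q\<^sub>2 z"
        using coversD(3)[OF sq(2)] Field_gl by blast
      obtain y y' where y: "(y, z) \<in> covers r\<^sub>2" "Y = q\<^sub>2 y" "(y', z) \<in> covers r\<^sub>2" "Y' = q\<^sub>2 y'"
        using sq(2,4) f2.covers_below[OF z(1)] z(2) by blast
      obtain x x' where x: "(x, y) \<in> covers r\<^sub>2" "X = q\<^sub>2 x" "(x', y') \<in> covers r\<^sub>2" "X = q\<^sub>2 x'"
        using sq(1,3) f2.covers_below coversD(2)[OF y(1)] coversD(2)[OF y(3)] y(2,4) by metis
      have "x' = x"
        using inj_onD[OF f2.j_inj] x coversD(2)[OF x(1)] coversD(2)[OF x(3)] by auto
      moreover have "y \<noteq> y'"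
        using sq(5) y by auto
      ultimately have "\<epsilon>\<^sub>2' x y + \<epsilon>\<^sub>2' y z = \<epsilon>\<^sub>2' x y' + \<epsilon>\<^sub>2' y' z + 1"
        using x y by (intro sign\<^sub>2[unfolded sign_assignment_def, rule_format] conjI) auto
      then show ?thesis
        using \<epsilon>\<^sub>2[OF x(1)] \<epsilon>\<^sub>2[OF x(3)] \<epsilon>\<^sub>2[OF y(1)] \<epsilon>\<^sub>2[OF y(3)] \<open>x' = x\<close> x(2) y(2,4) z(2) by simp
    qed
  qed
  then show ?thesis
    by blast
qed

text \<open>The functions \<eta> compare each given sign assignment with the one pulled back from
  the gluing. Once f and g are twisted accordingly, f is injective because the two copies cover
  \<open>gl\<close>, a pair killed by g agrees on the overlap after removing the twists and so comes
  from the gluing, and g is onto because a cochain on r extends by zero.\<close>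

lemma short_exact_sequence_gl:
  assumes "field K"
    and complexes: "cochain_complex K (poset_cochains K r\<^sub>1 \<epsilon>\<^sub>1)" "cochain_complex K (poset_cochains K r\<^sub>2 \<epsilon>\<^sub>2)"
      "cochain_complex K (poset_cochains K r \<epsilon>\<^sub>0)"
    and \<eta>\<^sub>1: "\<And>x y. (x, y) \<in> covers r\<^sub>1 \<Longrightarrow> \<epsilon>\<^sub>1 x y + \<eta>\<^sub>1 x = \<eta>\<^sub>1 y + \<epsilon> (q\<^sub>1 x) (q\<^sub>1 y)"
    and \<eta>\<^sub>2: "\<And>x y. (x, y) \<in> covers r\<^sub>2 \<Longrightarrow> \<epsilon>\<^sub>2 x y + \<eta>\<^sub>2 x = \<eta>\<^sub>2 y + \<epsilon> (q\<^sub>2 x) (q\<^sub>2 y)"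
    and \<eta>\<^sub>0: "\<And>x y. (x, y) \<in> covers r \<Longrightarrow> \<epsilon>\<^sub>0 x y + \<eta>\<^sub>0 x = \<eta>\<^sub>0 y + \<epsilon> (q\<^sub>1 (j\<^sub>1 x)) (q\<^sub>1 (j\<^sub>1 y))"
  shows "\<exists>f g. short_exact_sequence K (poset_cochains K gl \<epsilon>)
    (csum (poset_cochains K r\<^sub>1 \<epsilon>\<^sub>1) (poset_cochains K r\<^sub>2 \<epsilon>\<^sub>2)) (poset_cochains K r \<epsilon>\<^sub>0) f g"
proof -
  interpret field K by fact
  note [simp] = sgn_val_closed[OF assms(1)]
  let ?A = "poset_cochains K gl \<epsilon>" and ?B\<^sub>1 = "poset_cochains K r\<^sub>1 \<epsilon>\<^sub>1"
    and ?B\<^sub>2 = "poset_cochains K r\<^sub>2 \<epsilon>\<^sub>2" and ?C = "poset_cochains K r \<epsilon>\<^sub>0"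
  let ?s = "sgn_val K"
  have sgn_sgn: "?s a \<otimes>\<^bsub>K\<^esub> (?s b \<otimes>\<^bsub>K\<^esub> k) = ?s (a + b) \<otimes>\<^bsub>K\<^esub> k" if "k \<in> carrier K" for a b k
    using that by (simp add: sgn_val_mult[OF assms(1)] flip: m_assoc)
  have sgn_neg: "?s a \<otimes>\<^bsub>K\<^esub> k \<oplus>\<^bsub>K\<^esub> ?s (a + 1) \<otimes>\<^bsub>K\<^esub> k = \<zero>\<^bsub>K\<^esub>" if "k \<in> carrier K" for a k
    using that by (cases a) (simp_all add: sgn_val_def l_minus r_neg l_neg)
  have sgn_cancel: "?s a \<otimes>\<^bsub>K\<^esub> (?s a \<otimes>\<^bsub>K\<^esub> k) = k" if "k \<in> carrier K" for a k
    using that by (simp add: sgn_sgn sgn_val_0)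
  have carr: "carrier (coch (poset_cochains K R e) n) = level_set R n \<rightarrow>\<^sub>E carrier K" for R :: "'x rel" and e n
    by (simp add: poset_cochains_simps func_space_simps[OF ring_axioms])
  \<comment> \<open>With this choice the restriction from \<open>gl\<close> to
    \<open>r\<^sub>1\<close> and on to r has the total twist \<open>\<eta>\<^sub>0\<close>, since
    the two occurrences of \<open>\<eta>\<^sub>1\<close> cancel modulo 2.\<close>
  define \<theta>\<^sub>1 where "\<theta>\<^sub>1 p = \<eta>\<^sub>0 p + \<eta>\<^sub>1 (j\<^sub>1 p)" for p
  \<comment> \<open>The summand 1 makes \<open>g\<close> the difference of the two restrictions.\<close>
  define \<theta>\<^sub>2 where "\<theta>\<^sub>2 p = \<eta>\<^sub>0 p + \<eta>\<^sub>2 (j\<^sub>2 p) + 1" for p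
  have \<theta>\<^sub>1: "\<epsilon>\<^sub>0 x y + \<theta>\<^sub>1 x = \<theta>\<^sub>1 y + \<epsilon>\<^sub>1 (j\<^sub>1 x) (j\<^sub>1 y)" if "(x, y) \<in> covers r" for x y
    unfolding \<theta>\<^sub>1_def by (rule bit_add_twist[OF \<eta>\<^sub>0[OF that] \<eta>\<^sub>1[OF e1.covers_j[OF that]]])
  have \<theta>\<^sub>2: "\<epsilon>\<^sub>0 x y + \<theta>\<^sub>2 x = \<theta>\<^sub>2 y + \<epsilon>\<^sub>2 (j\<^sub>2 x) (j\<^sub>2 y)" if "(x, y) \<in> covers r" for x y
  proof -
    have "\<epsilon>\<^sub>0 x y + \<eta>\<^sub>0 x = \<eta>\<^sub>0 y + \<epsilon> (q\<^sub>2 (j\<^sub>2 x)) (q\<^sub>2 (j\<^sub>2 y))"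
      using \<eta>\<^sub>0[OF that] q_j coversD(2,3)[OF that] by simp
    from bit_add_twist[OF this \<eta>\<^sub>2[OF e2.covers_j[OF that]]]
    have "\<epsilon>\<^sub>0 x y + (\<eta>\<^sub>0 x + \<eta>\<^sub>2 (j\<^sub>2 x)) + 1 = \<eta>\<^sub>0 y + \<eta>\<^sub>2 (j\<^sub>2 y) + \<epsilon>\<^sub>2 (j\<^sub>2 x) (j\<^sub>2 y) + 1"
      by (rule arg_cong)
    then show ?thesis
      unfolding \<theta>\<^sub>2_def by (simp only: ac_simps)
  qed
  let ?p\<^sub>1 = "twisted_pullback K r\<^sub>1 q\<^sub>1 \<eta>\<^sub>1" and ?p\<^sub>2 = "twisted_pullback K r\<^sub>2 q\<^sub>2 \<eta>\<^sub>2"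
    and ?t\<^sub>1 = "twisted_pullback K r j\<^sub>1 \<theta>\<^sub>1" and ?t\<^sub>2 = "twisted_pullback K r j\<^sub>2 \<theta>\<^sub>2"
  have p: "cochain_map K ?A ?B\<^sub>1 ?p\<^sub>1" "cochain_map K ?A ?B\<^sub>2 ?p\<^sub>2"
    by (rule f1.twisted_pullback_cochain_map[OF assms(1)], erule \<eta>\<^sub>1)
       (rule f2.twisted_pullback_cochain_map[OF assms(1)], erule \<eta>\<^sub>2)
  have t: "cochain_map K ?B\<^sub>1 ?C ?t\<^sub>1" "cochain_map K ?B\<^sub>2 ?C ?t\<^sub>2"
    by (rule e1.twisted_pullback_cochain_map[OF assms(1)], erule \<theta>\<^sub>1)
       (rule e2.twisted_pullback_cochain_map[OF assms(1)], erule \<theta>\<^sub>2)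
  define f where "f n c = (?p\<^sub>1 n c, ?p\<^sub>2 n c)" for n c
  define g where "g n b = ?t\<^sub>1 n (fst b) \<oplus>\<^bsub>coch ?C n\<^esub> ?t\<^sub>2 n (snd b)" for n b
  have B: "cochain_complex K (csum ?B\<^sub>1 ?B\<^sub>2)"
    using complexes(1,2) by (intro cochain_complex_csum) (simp_all add: complex_def)
  have f_map: "cochain_map K ?A (csum ?B\<^sub>1 ?B\<^sub>2) f"
    unfolding f_def by (rule cochain_map_pair[OF p])
  have g_map: "cochain_map K (csum ?B\<^sub>1 ?B\<^sub>2) ?C g"
    unfolding g_def by (rule cochain_map_copair[OF t B complexes(3)])
  have inj: "inj_on (f n) (carrier (coch ?A n))" for n
  proof (rule inj_onI)
    fix c c' assume c: "c \<in> carrier (coch ?A n)" "c' \<in> carrier (coch ?A n)" and eq: "f n c = f n c'"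
    show "c = c'"
    proof (rule extensionalityI[of _ "level_set gl n"])
      fix X assume X: "X \<in> level_set gl n"
      then have cX: "c X \<in> carrier K" "c' X \<in> carrier K"
        using c by (auto simp: carr)
      from X consider x where "x \<in> Field r\<^sub>1" "X = q\<^sub>1 x" | x where "x \<in> Field r\<^sub>2" "X = q\<^sub>2 x"
        using Field_gl by (auto simp: level_set_def)
      then show "c X = c' X"
      proof cases
        case 1
        then have "x \<in> level_set r\<^sub>1 n"
          using X f1.level_j by (simp add: level_set_def)
        moreover have "?p\<^sub>1 n c x = ?p\<^sub>1 n c' x"
          using eq by (simp add: f_def)
        ultimately have "?s (\<eta>\<^sub>1 x) \<otimes>\<^bsub>K\<^esub> c X = ?s (\<eta>\<^sub>1 x) \<otimes>\<^bsub>K\<^esub> c' X"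
          by (simp add: twisted_pullback_def 1)
        then show ?thesis
          using sgn_cancel cX by metis
      next
        case 2
        then have "x \<in> level_set r\<^sub>2 n"
          using X f2.level_j by (simp add: level_set_def)
        moreover have "?p\<^sub>2 n c x = ?p\<^sub>2 n c' x"
          using eq by (simp add: f_def)
        ultimately have "?s (\<eta>\<^sub>2 x) \<otimes>\<^bsub>K\<^esub> c X = ?s (\<eta>\<^sub>2 x) \<otimes>\<^bsub>K\<^esub> c' X"
          by (simp add: twisted_pullback_def 2)
        then show ?thesis
          using sgn_cancel cX by metis
      qed
    qed (use c in \<open>auto simp: carr PiE_def\<close>)
  qed
  have A: "cochain_complex K ?A"
  proof (rule cochain_complex_inject[OF _ _ B f_map inj])
    show "vectorspace K (coch ?A n)" for n
      by (simp add: poset_cochains_simps func_space_vs[OF assms(1)])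
  qed (rule poset_diff_linear[OF assms(1)])
  have gB: "g n b = (\<lambda>x\<in>level_set r n. ?s (\<theta>\<^sub>1 x) \<otimes>\<^bsub>K\<^esub> fst b (j\<^sub>1 x) \<oplus>\<^bsub>K\<^esub> ?s (\<theta>\<^sub>2 x) \<otimes>\<^bsub>K\<^esub> snd b (j\<^sub>2 x))" for n b
    by (auto simp: g_def twisted_pullback_def poset_cochains_simps func_space_simps[OF ring_axioms])
  have \<theta>: "\<theta>\<^sub>1 x + \<eta>\<^sub>1 (j\<^sub>1 x) = \<eta>\<^sub>0 x" "\<theta>\<^sub>2 x + \<eta>\<^sub>2 (j\<^sub>2 x) = \<eta>\<^sub>0 x + 1" for x
    by (cases "\<eta>\<^sub>0 x"; cases "\<eta>\<^sub>1 (j\<^sub>1 x)"; simp add: \<theta>\<^sub>1_def)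
       (cases "\<eta>\<^sub>0 x"; cases "\<eta>\<^sub>2 (j\<^sub>2 x)"; simp add: \<theta>\<^sub>2_def)
  have gf: "g n (f n c) = \<zero>\<^bsub>coch ?C n\<^esub>" if c: "c \<in> carrier (coch ?A n)" for n c
  proof -
    have "?s (\<theta>\<^sub>1 x) \<otimes>\<^bsub>K\<^esub> ?p\<^sub>1 n c (j\<^sub>1 x) \<oplus>\<^bsub>K\<^esub> ?s (\<theta>\<^sub>2 x) \<otimes>\<^bsub>K\<^esub> ?p\<^sub>2 n c (j\<^sub>2 x) = \<zero>\<^bsub>K\<^esub>"
      if x: "x \<in> level_set r n" for x
    proof -
      have cx: "c (q\<^sub>1 (j\<^sub>1 x)) \<in> carrier K"
        using c f1.level_set_j[OF e1.level_set_j[OF x]] by (auto simp: carr)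
      have "q\<^sub>2 (j\<^sub>2 x) = q\<^sub>1 (j\<^sub>1 x)"
        using q_j x by (simp add: level_set_def)
      then have "?p\<^sub>1 n c (j\<^sub>1 x) = ?s (\<eta>\<^sub>1 (j\<^sub>1 x)) \<otimes>\<^bsub>K\<^esub> c (q\<^sub>1 (j\<^sub>1 x))"
        "?p\<^sub>2 n c (j\<^sub>2 x) = ?s (\<eta>\<^sub>2 (j\<^sub>2 x)) \<otimes>\<^bsub>K\<^esub> c (q\<^sub>1 (j\<^sub>1 x))"
        using e1.level_set_j[OF x] e2.level_set_j[OF x] by (simp_all add: twisted_pullback_def)
      then show ?thesis
        by (simp only: sgn_sgn[OF cx] \<theta> sgn_neg[OF cx])
    qed
    then show ?thesis
      by (auto simp: gB f_def poset_cochains_simps func_space_simps[OF ring_axioms] restrict_def)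
  qed
  have lift: "\<exists>c\<in>carrier (coch ?A n). b = f n c"
    if b: "b \<in> carrier (coch (csum ?B\<^sub>1 ?B\<^sub>2) n)" and 0: "g n b = \<zero>\<^bsub>coch ?C n\<^esub>" for n b
  proof -
    obtain b\<^sub>1 b\<^sub>2 where b12: "b = (b\<^sub>1, b\<^sub>2)" "b\<^sub>1 \<in> level_set r\<^sub>1 n \<rightarrow>\<^sub>E carrier K" "b\<^sub>2 \<in> level_set r\<^sub>2 n \<rightarrow>\<^sub>E carrier K"
      using b by (cases b) (auto simp: csum_simps direct_sum_simps carr)
    \<comment> \<open>A twisted restriction is undone by multiplying with the same signs again. On
      the overlap the formula of the first copy is used; \<open>c2\<close> shows that the second
      copy gives the same value there.\<close>
    define c where "c = (\<lambda>X\<in>level_set gl n. if X \<in> q\<^sub>1 ` Field r\<^sub>1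
        then ?s (\<eta>\<^sub>1 (the_inv_into (Field r\<^sub>1) q\<^sub>1 X)) \<otimes>\<^bsub>K\<^esub> b\<^sub>1 (the_inv_into (Field r\<^sub>1) q\<^sub>1 X)
        else ?s (\<eta>\<^sub>2 (the_inv_into (Field r\<^sub>2) q\<^sub>2 X)) \<otimes>\<^bsub>K\<^esub> b\<^sub>2 (the_inv_into (Field r\<^sub>2) q\<^sub>2 X))"
    have c1: "c (q\<^sub>1 x) = ?s (\<eta>\<^sub>1 x) \<otimes>\<^bsub>K\<^esub> b\<^sub>1 x" if "x \<in> level_set r\<^sub>1 n" for x
      using f1.level_set_j[OF that] that
      by (simp add: c_def the_inv_into_f_f[OF f1.j_inj] level_set_def)
    have c2: "c (q\<^sub>2 y) = ?s (\<eta>\<^sub>2 y) \<otimes>\<^bsub>K\<^esub> b\<^sub>2 y" if y: "y \<in> level_set r\<^sub>2 n" for y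
    proof (cases "q\<^sub>2 y \<in> q\<^sub>1 ` Field r\<^sub>1")
      case True
      then obtain p where pF: "p \<in> Field r" "y = j\<^sub>2 p"
        using overlap y by (auto simp: level_set_def image_iff) metis
      then have pl: "p \<in> level_set r n"
        using y e2.level_j by (simp add: level_set_def)
      have cl: "b\<^sub>1 (j\<^sub>1 p) \<in> carrier K" "b\<^sub>2 y \<in> carrier K"
        using b12 e1.level_set_j[OF pl] y by auto
      have "g n b p = \<zero>\<^bsub>K\<^esub>"
        using 0 pl by (simp add: poset_cochains_simps func_space_simps[OF ring_axioms])
      then have "?s (\<theta>\<^sub>1 p) \<otimes>\<^bsub>K\<^esub> b\<^sub>1 (j\<^sub>1 p) \<oplus>\<^bsub>K\<^esub> ?s (\<theta>\<^sub>2 p) \<otimes>\<^bsub>K\<^esub> b\<^sub>2 y = \<zero>\<^bsub>K\<^esub>"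
        using pl pF by (simp add: gB b12)
      moreover have "?s (\<theta>\<^sub>2 p + 1) \<otimes>\<^bsub>K\<^esub> b\<^sub>2 y \<oplus>\<^bsub>K\<^esub> ?s (\<theta>\<^sub>2 p) \<otimes>\<^bsub>K\<^esub> b\<^sub>2 y = \<zero>\<^bsub>K\<^esub>"
        by (subst a_comm) (simp_all only: sgn_neg cl m_closed sgn_val_closed[OF assms(1)])
      moreover have "?s a \<otimes>\<^bsub>K\<^esub> b\<^sub>1 (j\<^sub>1 p) \<in> carrier K" "?s a \<otimes>\<^bsub>K\<^esub> b\<^sub>2 y \<in> carrier K" for a
        using cl by simp_all
      ultimately have "?s (\<theta>\<^sub>1 p) \<otimes>\<^bsub>K\<^esub> b\<^sub>1 (j\<^sub>1 p) = ?s (\<theta>\<^sub>2 p + 1) \<otimes>\<^bsub>K\<^esub> b\<^sub>2 y"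
        by (metis add.right_cancel)
      \<comment> \<open>Multiplication by the sign of \<open>\<eta>\<^sub>0\<close> turns the twists
        of g back into those of f.\<close>
      then have "?s (\<eta>\<^sub>0 p + \<theta>\<^sub>1 p) \<otimes>\<^bsub>K\<^esub> b\<^sub>1 (j\<^sub>1 p) = ?s (\<eta>\<^sub>0 p + (\<theta>\<^sub>2 p + 1)) \<otimes>\<^bsub>K\<^esub> b\<^sub>2 y"
        unfolding sgn_sgn[OF cl(1), symmetric] sgn_sgn[OF cl(2), symmetric] by (rule arg_cong)
      moreover have "\<eta>\<^sub>0 p + \<theta>\<^sub>1 p = \<eta>\<^sub>1 (j\<^sub>1 p)" "\<eta>\<^sub>0 p + (\<theta>\<^sub>2 p + 1) = \<eta>\<^sub>2 y"
        unfolding \<theta>\<^sub>1_def \<theta>\<^sub>2_def pF(2)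
        by (cases "\<eta>\<^sub>0 p"; cases "\<eta>\<^sub>1 (j\<^sub>1 p)"; simp) (cases "\<eta>\<^sub>0 p"; cases "\<eta>\<^sub>2 (j\<^sub>2 p)"; simp)
      ultimately have "?s (\<eta>\<^sub>1 (j\<^sub>1 p)) \<otimes>\<^bsub>K\<^esub> b\<^sub>1 (j\<^sub>1 p) = ?s (\<eta>\<^sub>2 y) \<otimes>\<^bsub>K\<^esub> b\<^sub>2 y"
        by metis
      then show ?thesis
        using c1[OF e1.level_set_j[OF pl]] q_j[OF pF(1)] pF(2) by simp
    next
      case False
      then show ?thesis
        using f2.level_set_j[OF y] y
        by (simp add: c_def the_inv_into_f_f[OF f2.j_inj] level_set_def)
    qed
    have "c X \<in> carrier K" if X: "X \<in> level_set gl n" for X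
    proof -
      from X consider x where "x \<in> Field r\<^sub>1" "X = q\<^sub>1 x" | x where "x \<in> Field r\<^sub>2" "X = q\<^sub>2 x"
        using Field_gl by (auto simp: level_set_def)
      then show ?thesis
      proof cases
        case 1
        then have "x \<in> level_set r\<^sub>1 n"
          using X f1.level_j by (simp add: level_set_def)
        then show ?thesis
          using c1 b12(2) 1 by auto
      next
        case 2
        then have "x \<in> level_set r\<^sub>2 n"
          using X f2.level_j by (simp add: level_set_def)
        then show ?thesis
          using c2 b12(3) 2 by auto
      qed
    qed
    then have "c \<in> carrier (coch ?A n)"
      by (auto simp: carr c_def)
    moreover have "?p\<^sub>1 n c = b\<^sub>1"
      using b12(2) by (intro extensionalityI[of _ "level_set r\<^sub>1 n"])
        (auto simp: twisted_pullback_def c1 sgn_cancel PiE_def Pi_iff)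
    moreover have "?p\<^sub>2 n c = b\<^sub>2"
      using b12(3) by (intro extensionalityI[of _ "level_set r\<^sub>2 n"])
        (auto simp: twisted_pullback_def c2 sgn_cancel PiE_def Pi_iff)
    ultimately show ?thesis
      by (auto simp: f_def b12)
  qed
  have surj: "\<exists>b\<in>carrier (coch (csum ?B\<^sub>1 ?B\<^sub>2) n). g n b = c" if "c \<in> carrier (coch ?C n)" for n c
  proof -
    have c: "c \<in> level_set r n \<rightarrow>\<^sub>E carrier K"
      using that by (simp add: carr)
    \<comment> \<open>The preimage of c under g is supported on the copy of r inside
      \<open>r\<^sub>1\<close>, where the sign of \<open>\<theta>\<^sub>1\<close> is applied so that
      g cancels it; the second component is zero.\<close>
    define b\<^sub>1 where "b\<^sub>1 = (\<lambda>x\<in>level_set r\<^sub>1 n. if x \<in> j\<^sub>1 ` Field r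
        then ?s (\<theta>\<^sub>1 (the_inv_into (Field r) j\<^sub>1 x)) \<otimes>\<^bsub>K\<^esub> c (the_inv_into (Field r) j\<^sub>1 x) else \<zero>\<^bsub>K\<^esub>)"
    define b\<^sub>2 where "b\<^sub>2 = (\<lambda>x\<in>level_set r\<^sub>2 n. \<zero>\<^bsub>K\<^esub>)"
    have b1: "b\<^sub>1 (j\<^sub>1 p) = ?s (\<theta>\<^sub>1 p) \<otimes>\<^bsub>K\<^esub> c p" if "p \<in> level_set r n" for p
      using e1.level_set_j[OF that] that
      by (simp add: b\<^sub>1_def the_inv_into_f_f[OF e1.j_inj] level_set_def)
    have "b\<^sub>1 x \<in> carrier K" if x: "x \<in> level_set r\<^sub>1 n" for x
    proof (cases "x \<in> j\<^sub>1 ` Field r")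
      case True
      then obtain p where p: "p \<in> Field r" "x = j\<^sub>1 p"
        by blast
      then have "p \<in> level_set r n"
        using x e1.level_j by (simp add: level_set_def)
      then show ?thesis
        using b1 c p(2) by auto
    next
      case False
      then show ?thesis
        using x by (simp add: b\<^sub>1_def)
    qed
    then have "(b\<^sub>1, b\<^sub>2) \<in> carrier (coch (csum ?B\<^sub>1 ?B\<^sub>2) n)"
      by (auto simp: csum_simps direct_sum_simps carr b\<^sub>1_def b\<^sub>2_def)
    moreover have "g n (b\<^sub>1, b\<^sub>2) = c"
      using c e2.level_set_j
      by (intro extensionalityI[of _ "level_set r n"])
         (auto simp: gB b1 b\<^sub>2_def sgn_cancel PiE_def Pi_iff)
    ultimately show ?thesis
      by blast
  qed
  have "short_exact_sequence K ?A (csum ?B\<^sub>1 ?B\<^sub>2) ?C f g"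
    unfolding short_exact_sequence_def exact_at_def a_kernel_def'
  proof (intro conjI allI A B complexes(3) f_map g_map inj cochain_mapD(1)[OF f_map]
      cochain_mapD(1)[OF g_map])
    fix n
    show "f n ` carrier (coch ?A n) = {b \<in> carrier (coch (csum ?B\<^sub>1 ?B\<^sub>2) n). g n b = \<zero>\<^bsub>coch ?C n\<^esub>}"
      using cochain_mapD(2)[OF f_map] gf lift by blast
    show "g n ` carrier (coch (csum ?B\<^sub>1 ?B\<^sub>2) n) = carrier (coch ?C n)"
      using cochain_mapD(2)[OF g_map] surj by blast
  qed
  then show ?thesis
    by blast
qed

end

text \<open>A glued covering that ends in the first copy but comes from \<open>s\<^sub>2\<close> has
  its upper end in r; as r is down-closed in \<open>s\<^sub>2\<close>, the covering is one of r and
  so also one of \<open>s\<^sub>1\<close>. Hence a descending chain stays in the first copy. The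
  diagram H is a parameter in order that the two posets can be interchanged.\<close>

lemma glued_hasse_below:
  assumes "lower_embedding_posets r s\<^sub>1 j\<^sub>1" "lower_embedding_posets r s\<^sub>2 j\<^sub>2"
    and inj: "inj_on q\<^sub>1 (Field s\<^sub>1)"
    and overlap: "\<And>x y. \<lbrakk>x \<in> Field s\<^sub>1; y \<in> Field s\<^sub>2\<rbrakk> \<Longrightarrow>
      q\<^sub>1 x = q\<^sub>2 y \<longleftrightarrow> (\<exists>p\<in>Field r. x = j\<^sub>1 p \<and> y = j\<^sub>2 p)"
    and H: "H = {(q\<^sub>1 x, q\<^sub>1 y) | x y. (x, y) \<in> covers s\<^sub>1} \<union> {(q\<^sub>2 x, q\<^sub>2 y) | x y. (x, y) \<in> covers s\<^sub>2}"
    and y: "y \<in> Field s\<^sub>1"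
  shows "(X, q\<^sub>1 y) \<in> H\<^sup>* \<longleftrightarrow> (\<exists>x. (x, y) \<in> s\<^sub>1 \<and> X = q\<^sub>1 x)"
proof
  interpret e1: lower_embedding_posets r s\<^sub>1 j\<^sub>1 by fact
  interpret e2: lower_embedding_posets r s\<^sub>2 j\<^sub>2 by fact
  have step: "\<exists>x. (x, y) \<in> covers s\<^sub>1 \<and> X = q\<^sub>1 x" if X: "(X, q\<^sub>1 y) \<in> H" and y: "y \<in> Field s\<^sub>1" for X y
    using X unfolding H
  proof (elim UnE CollectE exE conjE)
    fix x' y' assume *: "(X, q\<^sub>1 y) = (q\<^sub>1 x', q\<^sub>1 y')" "(x', y') \<in> covers s\<^sub>1"
    then have "y = y'"
      using inj_onD[OF inj] y coversD(3)[OF *(2)] by auto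
    then show ?thesis
      using * by auto
  next
    fix x' y' assume *: "(X, q\<^sub>1 y) = (q\<^sub>2 x', q\<^sub>2 y')" "(x', y') \<in> covers s\<^sub>2"
    then obtain p where p: "p \<in> Field r" "y = j\<^sub>1 p" "y' = j\<^sub>2 p"
      using overlap[OF y coversD(3)[OF *(2)]] by auto
    then obtain p' where p': "(p', p) \<in> covers r" "x' = j\<^sub>2 p'"
      using *(2) e2.covers_below by blast
    have "q\<^sub>1 (j\<^sub>1 p') = q\<^sub>2 (j\<^sub>2 p')"
      using overlap e1.j_Field e2.j_Field coversD(2)[OF p'(1)] by blast
    then show ?thesis
      using e1.covers_j[OF p'(1)] *(1) p p' by auto
  qed
  assume "(X, q\<^sub>1 y) \<in> H\<^sup>*"
  then show "\<exists>x. (x, y) \<in> s\<^sub>1 \<and> X = q\<^sub>1 x"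
  proof (induction rule: converse_rtrancl_induct)
    case base
    then show ?case
      using e1.s.refl_r y by blast
  next
    case (step X Y)
    then obtain x where x: "(x, y) \<in> s\<^sub>1" "Y = q\<^sub>1 x"
      by blast
    obtain w where "(w, x) \<in> covers s\<^sub>1" "X = q\<^sub>1 w"
      using \<open>\<And>y X. \<lbrakk>(X, q\<^sub>1 y) \<in> H; y \<in> Field s\<^sub>1\<rbrakk> \<Longrightarrow> \<exists>x. (x, y) \<in> covers s\<^sub>1 \<and> X = q\<^sub>1 x\<close>[of X x]
        step.hyps(1) x FieldI1[OF x(1)] by blast
    then show ?case
      using transD[OF e1.s.trans_r coversD(1) x(1)] by blast
  qed
next
  interpret e1: lower_embedding_posets r s\<^sub>1 j\<^sub>1 by fact
  assume "\<exists>x. (x, y) \<in> s\<^sub>1 \<and> X = q\<^sub>1 x"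
  then obtain x where x: "(x, y) \<in> (covers s\<^sub>1)\<^sup>*" "X = q\<^sub>1 x"
    using e1.s.le_imp_covers_rtrancl by blast
  from x(1) have "(q\<^sub>1 x, q\<^sub>1 y) \<in> H\<^sup>*"
  proof (induction rule: rtrancl_induct)
    case (step y z)
    then have "(q\<^sub>1 y, q\<^sub>1 z) \<in> H"
      unfolding H by blast
    then show ?case
      using step.IH by (rule rtrancl_into_rtrancl[rotated])
  qed simp
  then show "(X, q\<^sub>1 y) \<in> H\<^sup>*"
    using x(2) by simp
qed

section \<open>The gluing as a pushout of posets\<close>

locale glued_posets =
  e1: lower_embedding_posets r r\<^sub>1 j\<^sub>1 + e2: lower_embedding_posets r r\<^sub>2 j\<^sub>2
  for r :: "'p rel" and r\<^sub>1 :: "'q rel" and r\<^sub>2 :: "'s rel" and j\<^sub>1 j\<^sub>2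
begin

abbreviation (input) "D \<equiv> Field r\<^sub>1 <+> Field r\<^sub>2"
abbreviation (input) "E \<equiv> glue_equiv r r\<^sub>1 r\<^sub>2 j\<^sub>1 j\<^sub>2"
abbreviation (input) "Q \<equiv> D // E"
abbreviation (input) "H \<equiv> glue_hasse r r\<^sub>1 r\<^sub>2 j\<^sub>1 j\<^sub>2"
abbreviation (input) "gl \<equiv> gluing r r\<^sub>1 r\<^sub>2 j\<^sub>1 j\<^sub>2"
abbreviation (input) "q\<^sub>1 \<equiv> \<lambda>x. E `` {Inl x}"
abbreviation (input) "q\<^sub>2 \<equiv> \<lambda>y. E `` {Inr y}"

text \<open>Chains of identifications do not get longer than one step: by injectivity of
  \<open>j\<^sub>1\<close> and \<open>j\<^sub>2\<close>, a second identification leads back to the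
  start.\<close>

lemma glue_equiv_eq:
  "E = (Id \<union> {(Inl (j\<^sub>1 p), Inr (j\<^sub>2 p)) | p. p \<in> Field r} \<union> {(Inr (j\<^sub>2 p), Inl (j\<^sub>1 p)) | p. p \<in> Field r})
     \<inter> D \<times> D"
proof -
  let ?I = "{(Inl (j\<^sub>1 p) :: 'q + 's, Inr (j\<^sub>2 p) :: 'q + 's) | p. p \<in> Field r}"
  have conv: "?I\<inverse> = {(Inr (j\<^sub>2 p), Inl (j\<^sub>1 p)) | p. p \<in> Field r}"
    by auto
  have glue_step: "(a, c) \<in> Id \<union> ?I \<union> ?I\<inverse>" if "(a, b) \<in> Id \<union> ?I \<union> ?I\<inverse>" "(b, c) \<in> ?I \<union> ?I\<inverse>" for a b c
    using that unfolding conv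
    by (elim UnE) (auto simp: inj_on_eq_iff[OF e1.j_inj] inj_on_eq_iff[OF e2.j_inj])
  have "(?I \<union> ?I\<inverse>)\<^sup>* = Id \<union> ?I \<union> ?I\<inverse>"
  proof (intro Set.equalityI subrelI)
    fix a b assume "(a, b) \<in> (?I \<union> ?I\<inverse>)\<^sup>*"
    then show "(a, b) \<in> Id \<union> ?I \<union> ?I\<inverse>"
    proof (induction rule: rtrancl_induct)
      case base
      show ?case
        by simp
    next
      case (step b c)
      from glue_step[OF step.IH step.hyps(2)] show ?case .
    qed
  next
    fix a b assume "(a, b) \<in> Id \<union> ?I \<union> ?I\<inverse>"
    then consider "a = b" | "(a, b) \<in> ?I \<union> ?I\<inverse>"
      by (elim UnE) simp_all
    then show "(a, b) \<in> (?I \<union> ?I\<inverse>)\<^sup>*"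
      by cases (simp, rule r_into_rtrancl)
  qed
  then show ?thesis
    unfolding glue_equiv_def Let_def conv by simp
qed

lemma equiv_E: "equiv D E"
proof (rule equivI)
  show "E \<subseteq> D \<times> D" "refl_on D E"
    by (auto simp: glue_equiv_eq refl_on_def)
  show "sym E"
    by (auto simp: glue_equiv_eq sym_def)
  show "trans E"
    by (auto simp: glue_equiv_def Let_def intro!: trans_Int trans_rtrancl) (auto simp: trans_def)
qed

lemma class_eq_iff: "\<lbrakk>a \<in> D; b \<in> D\<rbrakk> \<Longrightarrow> E `` {a} = E `` {b} \<longleftrightarrow> (a, b) \<in> E"
  using equiv_E by (rule eq_equiv_class_iff)

lemma q_inj: "inj_on q\<^sub>1 (Field r\<^sub>1)" "inj_on q\<^sub>2 (Field r\<^sub>2)"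
  by (auto intro!: inj_onI simp: class_eq_iff) (auto simp: glue_equiv_eq)

lemma q_overlap: "\<lbrakk>x \<in> Field r\<^sub>1; y \<in> Field r\<^sub>2\<rbrakk> \<Longrightarrow>
    q\<^sub>1 x = q\<^sub>2 y \<longleftrightarrow> (\<exists>p\<in>Field r. x = j\<^sub>1 p \<and> y = j\<^sub>2 p)"
  by (subst class_eq_iff) (auto simp: glue_equiv_eq)

lemma Q_eq: "Q = q\<^sub>1 ` Field r\<^sub>1 \<union> q\<^sub>2 ` Field r\<^sub>2"
  by (auto simp: quotient_def)

lemma Field_gluing: "Field gl = q\<^sub>1 ` Field r\<^sub>1 \<union> q\<^sub>2 ` Field r\<^sub>2"
  unfolding Q_eq[symmetric] by (auto simp: gluing_def Let_def Field_def)

lemma gluing_below_1: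
  assumes "y \<in> Field r\<^sub>1"
  shows "(X, q\<^sub>1 y) \<in> gl \<longleftrightarrow> (\<exists>x. (x, y) \<in> r\<^sub>1 \<and> X = q\<^sub>1 x)"
proof -
  have "(X, q\<^sub>1 y) \<in> H\<^sup>* \<longleftrightarrow> (\<exists>x. (x, y) \<in> r\<^sub>1 \<and> X = q\<^sub>1 x)"
    by (rule glued_hasse_below[OF e1.lower_embedding_posets_axioms e2.lower_embedding_posets_axioms
          q_inj(1) q_overlap _ assms]) (auto simp: glue_hasse_def Let_def)
  then show ?thesis
    using assms unfolding gluing_def Let_def Q_eq by (auto intro: FieldI1)
qed

lemma gluing_below_2:
  assumes "y \<in> Field r\<^sub>2"
  shows "(X, q\<^sub>2 y) \<in> gl \<longleftrightarrow> (\<exists>x. (x, y) \<in> r\<^sub>2 \<and> X = q\<^sub>2 x)"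
proof -
  have "q\<^sub>2 x = q\<^sub>1 y \<longleftrightarrow> (\<exists>p\<in>Field r. x = j\<^sub>2 p \<and> y = j\<^sub>1 p)" if "x \<in> Field r\<^sub>2" "y \<in> Field r\<^sub>1" for x y
    using q_overlap[OF that(2,1)] by auto
  then have "(X, q\<^sub>2 y) \<in> H\<^sup>* \<longleftrightarrow> (\<exists>x. (x, y) \<in> r\<^sub>2 \<and> X = q\<^sub>2 x)"
    by (rule glued_hasse_below[OF e2.lower_embedding_posets_axioms e1.lower_embedding_posets_axioms
          q_inj(2) _ _ assms]) (auto simp: glue_hasse_def Let_def)
  then show ?thesis
    using assms unfolding gluing_def Let_def Q_eq by (auto intro: FieldI1)
qed

text \<open>Antisymmetry is not automatic for a transitive closure. It holds because X below Y, and
  then Y below X, can both be read in the copy that contains Y, where the order is that of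
  \<open>r\<^sub>1\<close> or \<open>r\<^sub>2\<close>.\<close>

lemma min_poset_gluing: "min_poset gl"
proof
  let ?m = "q\<^sub>1 (poset_min r\<^sub>1)"
  \<comment> \<open>The minima of both sides come from the minimum of r, hence are identified, and
    one element serves both copies.\<close>
  have m: "?m = q\<^sub>2 (poset_min r\<^sub>2)"
    unfolding e1.j_min[symmetric] e2.j_min[symmetric]
    using q_overlap[OF e1.j_Field e2.j_Field] e1.r.poset_min(1) by blast
  have "(q\<^sub>1 x, q\<^sub>1 x) \<in> gl" if "x \<in> Field r\<^sub>1" for x
    unfolding gluing_below_1[OF that] using e1.s.refl_r[OF that] by blast
  moreover have "(q\<^sub>2 x, q\<^sub>2 x) \<in> gl" if "x \<in> Field r\<^sub>2" for x
    unfolding gluing_below_2[OF that] using e2.s.refl_r[OF that] by blast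
  ultimately show "(X, X) \<in> gl" if "X \<in> Field gl" for X
    using that unfolding Field_gluing by blast
  show "trans gl"
    unfolding gluing_def Let_def by (intro trans_Int trans_rtrancl) (auto simp: trans_def)
  show "antisym gl"
  proof (rule antisymI)
    fix X Y assume XY: "(X, Y) \<in> gl" "(Y, X) \<in> gl"
    consider y where "y \<in> Field r\<^sub>1" "Y = q\<^sub>1 y" | y where "y \<in> Field r\<^sub>2" "Y = q\<^sub>2 y"
      using FieldI2[OF XY(1)] unfolding Field_gluing by blast
    then show "X = Y"
    proof cases
      case 1
      then obtain x where x: "(x, y) \<in> r\<^sub>1" "X = q\<^sub>1 x"
        using XY(1) by (auto simp: gluing_below_1)
      then obtain y' where y': "(y', x) \<in> r\<^sub>1" "Y = q\<^sub>1 y'"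
        using XY(2) gluing_below_1[OF FieldI1[OF x(1)]] by auto
      then have "y' = y"
        using inj_onD[OF q_inj(1)] 1 FieldI1[OF y'(1)] by auto
      then show ?thesis
        using x y' antisymD[OF e1.s.antisym_r] 1 by blast
    next
      case 2
      then obtain x where x: "(x, y) \<in> r\<^sub>2" "X = q\<^sub>2 x"
        using XY(1) by (auto simp: gluing_below_2)
      then obtain y' where y': "(y', x) \<in> r\<^sub>2" "Y = q\<^sub>2 y'"
        using XY(2) gluing_below_2[OF FieldI1[OF x(1)]] by auto
      then have "y' = y"
        using inj_onD[OF q_inj(2)] 2 FieldI1[OF y'(1)] by auto
      then show ?thesis
        using x y' antisymD[OF e2.s.antisym_r] 2 by blast
    qed
  qed
  show "finite (Field gl)"
    unfolding Field_gluing using e1.s.finite_Field e2.s.finite_Field by blast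
  show "\<exists>m\<in>Field gl. \<forall>X\<in>Field gl. (m, X) \<in> gl"
  proof
    show "?m \<in> Field gl"
      unfolding Field_gluing using e1.s.poset_min(1) by blast
    have "(?m, q\<^sub>1 x) \<in> gl" if "x \<in> Field r\<^sub>1" for x
      unfolding gluing_below_1[OF that] using e1.s.poset_min(2)[OF that] by blast
    moreover have "(?m, q\<^sub>2 x) \<in> gl" if "x \<in> Field r\<^sub>2" for x
      unfolding gluing_below_2[OF that] m using e2.s.poset_min(2)[OF that] by blast
    ultimately show "\<forall>X\<in>Field gl. (?m, X) \<in> gl"
      unfolding Field_gluing by blast
  qed
qed

sublocale pushout_posets r r\<^sub>1 r\<^sub>2 gl j\<^sub>1 j\<^sub>2 q\<^sub>1 q\<^sub>2
proof -
  interpret gl: min_poset gl by (rule min_poset_gluing)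
  have "lower_embedding r\<^sub>1 gl q\<^sub>1" "lower_embedding r\<^sub>2 gl q\<^sub>2"
    unfolding lower_embedding_def
    by (intro conjI ballI allI q_inj gluing_below_1 gluing_below_2;
        auto simp only: Field_gluing)+
  then interpret f1: lower_embedding_posets r\<^sub>1 gl q\<^sub>1 + f2: lower_embedding_posets r\<^sub>2 gl q\<^sub>2
    by unfold_locales
  show "pushout_posets r r\<^sub>1 r\<^sub>2 gl j\<^sub>1 j\<^sub>2 q\<^sub>1 q\<^sub>2"
    by unfold_locales (fact Field_gluing q_overlap)+
qed

end

section \<open>Multipaths\<close>

definition path_like :: "'a rel \<Rightarrow> bool" where
  "path_like R \<longleftrightarrow> single_valued R \<and> single_valued (R\<inverse>) \<and> acyclic R"

lemma path_like_subset: "path_like R \<Longrightarrow> R' \<subseteq> R \<Longrightarrow> path_like R'"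
  unfolding path_like_def by (meson acyclic_subset converse_mono single_valued_subset)

lemma mem_map_prod_image: "(a, b) \<in> map_prod \<phi> \<psi> ` R \<longleftrightarrow> (\<exists>x y. (x, y) \<in> R \<and> a = \<phi> x \<and> b = \<psi> y)"
  by force

lemma single_valued_image:
  assumes "single_valued R" "R \<subseteq> V \<times> V" "inj_on \<phi> V"
  shows "single_valued (map_prod \<phi> \<phi> ` R)"
proof (rule single_valuedI)
  fix a b c assume *: "(a, b) \<in> map_prod \<phi> \<phi> ` R" "(a, c) \<in> map_prod \<phi> \<phi> ` R"
  obtain x y where xy: "(x, y) \<in> R" "a = \<phi> x" "b = \<phi> y"
    using *(1) unfolding mem_map_prod_image by blast
  obtain x' z where xz: "(x', z) \<in> R" "a = \<phi> x'" "c = \<phi> z"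
    using *(2) unfolding mem_map_prod_image by blast
  have "x' = x"
    using xy(1,2) xz(1,2) assms(2) inj_onD[OF assms(3)] by auto
  then have "y = z"
    using single_valuedD[OF assms(1)] xy(1) xz(1) by simp
  then show "b = c"
    using xy(3) xz(3) by simp
qed

text \<open>By injectivity on V consecutive arcs of the image come from consecutive arcs of R, so a
  cycle of the image would pull back to a cycle.\<close>

lemma path_like_image:
  assumes "path_like R" "R \<subseteq> V \<times> V" "inj_on \<phi> V"
  shows "path_like (map_prod \<phi> \<phi> ` R)"
proof -
  note inj = inj_onD[OF assms(3)]
  have "\<exists>x y. a = \<phi> x \<and> b = \<phi> y \<and> x \<in> V \<and> y \<in> V \<and> (x, y) \<in> R\<^sup>+" if "(a, b) \<in> (map_prod \<phi> \<phi> ` R)\<^sup>+" for a b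
    using that
  proof (induction rule: trancl_induct)
    case (base b)
    then show ?case
      using assms(2) unfolding mem_map_prod_image by blast
  next
    case (step b c)
    then obtain x y where xy: "a = \<phi> x" "b = \<phi> y" "x \<in> V" "y \<in> V" "(x, y) \<in> R\<^sup>+"
      by blast
    obtain y' z where yz: "b = \<phi> y'" "c = \<phi> z" "(y', z) \<in> R"
      using step.hyps(2) unfolding mem_map_prod_image by blast
    have "y' = y" "z \<in> V"
      using assms(2) inj xy yz by auto
    then have "(x, z) \<in> R\<^sup>+"
      using xy(5) yz(3) by (simp add: trancl_into_trancl)
    then show ?case
      using xy(1,3) yz(2) \<open>z \<in> V\<close> by blast
  qed
  then have "acyclic (map_prod \<phi> \<phi> ` R)"
    using assms(1) inj unfolding acyclic_def path_like_def by metis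
  moreover have "(map_prod \<phi> \<phi> ` R)\<inverse> = map_prod \<phi> \<phi> ` R\<inverse>"
    by force
  moreover have "R\<inverse> \<subseteq> V \<times> V"
    using assms(2) by auto
  ultimately show ?thesis
    using assms single_valued_image unfolding path_like_def by metis
qed

lemma set_zip_tl: "set (zip vs (tl vs)) = {(vs ! i, vs ! Suc i) | i. Suc i < length vs}"
  by (auto simp: set_zip nth_tl less_diff_conv)

lemma set_zip_tl_snoc: "vs \<noteq> [] \<Longrightarrow> set (zip (vs @ [b]) (tl (vs @ [b]))) = insert (last vs, b) (set (zip vs (tl vs)))"
proof (induction vs)
  case (Cons a vs)
  then show ?case
    by (cases vs) auto
qed simp

lemma set_zip_tl_Cons: "vs \<noteq> [] \<Longrightarrow> set (zip (b # vs) (tl (b # vs))) = insert (b, hd vs) (set (zip vs (tl vs)))"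
  by (cases vs) auto

text \<open>The position in the list grows along every arc, which excludes cycles; distinctness
  makes successors and predecessors unique.\<close>

lemma path_like_simple_path:
  assumes "distinct vs"
  shows "path_like (set (zip vs (tl vs)))"
proof -
  define idx where "idx = the_inv_into {..<length vs} ((!) vs)"
  have idx: "idx (vs ! i) = i" if "i < length vs" for i
    unfolding idx_def using that assms by (intro the_inv_into_f_f) (auto simp: inj_on_nth)
  have "set (zip vs (tl vs)) \<subseteq> inv_image less_than idx"
    by (auto simp: set_zip_tl idx)
  then have "acyclic (set (zip vs (tl vs)))"
    by (rule wf_acyclic[OF wf_subset[OF wf_inv_image[OF wf_less_than]]])
  moreover have "single_valued (set (zip vs (tl vs)))" "single_valued ((set (zip vs (tl vs)))\<inverse>)"
    unfolding set_zip_tl by (auto intro!: single_valuedI simp: nth_eq_iff_index_eq[OF assms])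
  ultimately show ?thesis
    by (simp add: path_like_def)
qed

lemma nth_path_rtrancl:
  assumes "set (zip vs (tl vs)) \<subseteq> R" "i \<le> k" "k < length vs"
  shows "(vs ! i, vs ! k) \<in> R\<^sup>*"
  using assms(2,3)
proof (induction k rule: dec_induct)
  case (step k)
  then have "(vs ! k, vs ! Suc k) \<in> R"
    using assms(1) by (auto simp: set_zip_tl)
  then show ?case
    using step by (simp add: rtrancl_into_rtrancl)
qed simp

text \<open>A longest simple path through v contains every arc that touches it: at a vertex with a
  neighbour in the given direction on the path by uniqueness of that neighbour, and at the ends
  because such an arc would either close a cycle or prolong the path. By connectedness the path then
  exhausts V and R.\<close>

lemma simple_path_if_connected:
  assumes fin: "finite V" and R: "R \<subseteq> V \<times> V" "path_like R" and v: "v \<in> V"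
    and conn: "\<And>w. w \<in> V \<Longrightarrow> (v, w) \<in> (R \<union> R\<inverse>)\<^sup>*"
  shows "\<exists>vs. vs \<noteq> [] \<and> distinct vs \<and> V = set vs \<and> R = set (zip vs (tl vs))"
proof -
  have acyc: "(a, b) \<in> R\<^sup>* \<Longrightarrow> (b, a) \<notin> R" for a b
    using R(2) rtrancl_into_trancl2[of b a R b] unfolding path_like_def acyclic_def by auto
  \<comment> \<open>Requiring v on the path makes the list nonempty and ties it to the vertex from
    which all of V is connected.\<close>
  let ?P = "{vs. distinct vs \<and> set vs \<subseteq> V \<and> v \<in> set vs \<and> set (zip vs (tl vs)) \<subseteq> R}"
  have "finite {vs. set vs \<subseteq> V \<and> distinct vs}"
    using fin by (rule finite_subset_distinct)
  then have "finite ?P"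
    by (rule rev_finite_subset) auto
  moreover have "[v] \<in> ?P"
    using v by simp
  ultimately have P: "finite (length ` ?P)" "length ` ?P \<noteq> {}"
    by (simp, blast)
  obtain vs where vs: "vs \<in> ?P" and len: "Max (length ` ?P) = length vs"
    using Max_in[OF P] by (rule imageE)
  have max: "length ws \<le> length vs" if "ws \<in> ?P" for ws
    unfolding len[symmetric] using that by (intro Max_ge[OF P(1)] imageI)
  from vs have vs': "distinct vs" "set vs \<subseteq> V" "v \<in> set vs" "set (zip vs (tl vs)) \<subseteq> R" "vs \<noteq> []"
    by auto
  have out: "(a, b) \<in> set (zip vs (tl vs))" if ab: "(a, b) \<in> R" "a \<in> set vs" for a b
  proof -
    obtain i where i: "i < length vs" "a = vs ! i"
      using ab(2) by (auto simp: in_set_conv_nth)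
    show ?thesis
    proof (cases "Suc i < length vs")
      case True
      then have "(a, vs ! Suc i) \<in> set (zip vs (tl vs))"
        using i by (auto simp: set_zip_tl)
      moreover from this have "b = vs ! Suc i"
        using vs'(4) ab(1) R(2) unfolding path_like_def single_valued_def by blast
      ultimately show ?thesis
        by simp
    next
      case False
      then have "length vs = Suc i"
        using i(1) by simp
      then have last: "a = last vs"
        using i(2) vs'(5) by (simp add: last_conv_nth)
      have "b \<notin> set vs"
      proof
        assume "b \<in> set vs"
        then obtain k where "k < length vs" "b = vs ! k"
          by (auto simp: in_set_conv_nth)
        then have "(b, a) \<in> R\<^sup>*"
          using nth_path_rtrancl[OF vs'(4), of k i] i False by simp
        then show False
          using acyc ab(1) by blast
      qed
      then have "vs @ [b] \<in> ?P"
        using vs' ab(1) R(1) set_zip_tl_snoc[OF vs'(5), of b] last by auto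
      then show ?thesis
        using max[of "vs @ [b]"] by simp
    qed
  qed
  have into: "(a, b) \<in> set (zip vs (tl vs))" if ab: "(a, b) \<in> R" "b \<in> set vs" for a b
  proof -
    obtain i where i: "i < length vs" "b = vs ! i"
      using ab(2) by (auto simp: in_set_conv_nth)
    show ?thesis
    proof (cases i)
      case (Suc k)
      then have "(vs ! k, b) \<in> set (zip vs (tl vs))"
        using i by (auto simp: set_zip_tl)
      moreover from this have "a = vs ! k"
        using vs'(4) ab(1) R(2) unfolding path_like_def single_valued_def by blast
      ultimately show ?thesis
        by simp
    next
      case 0
      then have hd: "b = hd vs"
        using i vs'(5) by (simp add: hd_conv_nth)
      have "a \<notin> set vs"
      proof
        assume "a \<in> set vs"
        then obtain k where "k < length vs" "a = vs ! k"
          by (auto simp: in_set_conv_nth)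
        then have "(b, a) \<in> R\<^sup>*"
          using nth_path_rtrancl[OF vs'(4), of i k] i 0 by simp
        then show False
          using acyc ab(1) by blast
      qed
      then have "a # vs \<in> ?P"
        using vs' ab(1) R(1) set_zip_tl_Cons[OF vs'(5), of a] hd by auto
      then show ?thesis
        using max[of "a # vs"] by simp
    qed
  qed
  have "w \<in> set vs" if "(v, w) \<in> (R \<union> R\<inverse>)\<^sup>*" for w
    using that
  proof (induction rule: rtrancl_induct)
    case (step a b)
    then consider "(a, b) \<in> set (zip vs (tl vs))" | "(b, a) \<in> set (zip vs (tl vs))"
      using out[of a b] into[of b a] by auto
    then show ?case
    proof cases
      case 1
      from list.set_sel(2)[OF vs'(5) set_zip_rightD[OF this]] show ?thesis .
    next
      case 2
      then show ?thesis
        by (rule set_zip_leftD)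
    qed
  qed (fact vs'(3))
  then have V: "V = set vs"
    using conn vs'(2) by blast
  then have "R = set (zip vs (tl vs))"
    using out vs'(4) R(1) by auto
  then show ?thesis
    using V vs'(1,5) by blast
qed

section \<open>Connected components of a digraph\<close>

lemma connected_iff:
  assumes "pair_wf_digraph C"
  shows "Digraph_Component.connected (with_proj C) \<longleftrightarrow>
    pverts C \<noteq> {} \<and> (\<forall>u\<in>pverts C. \<forall>v\<in>pverts C. (u, v) \<in> (parcs C \<union> (parcs C)\<inverse>)\<^sup>*)"
proof -
  interpret pair_wf_digraph C by fact
  have arcs: "parcs (mk_symmetric (with_proj C)) = parcs C \<union> (parcs C)\<inverse>"
    by (auto simp: parcs_mk_symmetric)
  have "u \<rightarrow>\<^sup>*\<^bsub>with_proj (mk_symmetric (with_proj C))\<^esub> v \<longleftrightarrow> (u, v) \<in> (parcs C \<union> (parcs C)\<inverse>)\<^sup>*"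
    if u: "u \<in> pverts C" for u v
  proof
    assume "u \<rightarrow>\<^sup>*\<^bsub>with_proj (mk_symmetric (with_proj C))\<^esub> v"
    then show "(u, v) \<in> (parcs C \<union> (parcs C)\<inverse>)\<^sup>*"
      using reachable_rtranclI arcs by fastforce
  next
    assume "(u, v) \<in> (parcs C \<union> (parcs C)\<inverse>)\<^sup>*"
    then show "u \<rightarrow>\<^sup>*\<^bsub>with_proj (mk_symmetric (with_proj C))\<^esub> v"
    proof (induction rule: rtrancl_induct)
      case base
      then show ?case
        using u by (simp add: reachable_def)
    next
      case (step w x)
      \<comment> \<open>Reachability is defined by walks inside the vertex set. As both ends of an
        arc are vertices, the plain closure gives nothing more when it starts at a vertex.\<close>
      then have "x \<in> pverts C"
        using wellformed' by auto
      then show ?case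
        using step arcs unfolding reachable_def by (auto intro: rtrancl_on_into_rtrancl_on)
    qed
  qed
  then show ?thesis
    unfolding Digraph_Component.connected_def strongly_connected_def by simp
qed

lemma simple_path_digraph_if_path_like:
  assumes "pair_wf_digraph C" "finite (pverts C)" "path_like (parcs C)" "Digraph_Component.connected (with_proj C)"
  shows "simple_path_digraph C"
proof -
  interpret pair_wf_digraph C by fact
  obtain v where v: "v \<in> pverts C" "\<And>w. w \<in> pverts C \<Longrightarrow> (v, w) \<in> (parcs C \<union> (parcs C)\<inverse>)\<^sup>*"
    using assms(4) unfolding connected_iff[OF assms(1)] by blast
  have "parcs C \<subseteq> pverts C \<times> pverts C"
    using wellformed' by auto
  from simple_path_if_connected[OF assms(2) this assms(3) v] show ?thesis
    by (simp add: simple_path_digraph_def)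
qed

text \<open>Arcs are selected by their source alone; the target follows, because W is closed under
  arcs in both directions when H is well-formed.\<close>

definition component_of :: "'a pair_pre_digraph \<Rightarrow> 'a \<Rightarrow> 'a pair_pre_digraph" where
  "component_of H v = (let W = {w \<in> pverts H. (v, w) \<in> (parcs H \<union> (parcs H)\<inverse>)\<^sup>*}
     in \<lparr>pverts = W, parcs = {e \<in> parcs H. fst e \<in> W}\<rparr>)"

text \<open>Maximality holds because a connected subgraph of H that contains v connects each of its
  vertices to v inside H, so that no vertex outside W, and then no further arc, can occur.\<close>

lemma connected_component_of:
  assumes wf: "pair_wf_digraph H" and v: "v \<in> pverts H"
  shows "connected_component H (component_of H v)"
proof -
  interpret pair_wf_digraph H by fact
  let ?s = "\<lambda>R. R \<union> R\<inverse>"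
  let ?W = "{w \<in> pverts H. (v, w) \<in> (?s (parcs H))\<^sup>*}"
  let ?C = "component_of H v"
  have C: "pverts ?C = ?W" "parcs ?C = {e \<in> parcs H. fst e \<in> ?W}"
    by (simp_all add: component_of_def Let_def)
  have W_step: "b \<in> ?W" if "a \<in> ?W" "(a, b) \<in> ?s (parcs H)" for a b
    using that wellformed' by (auto intro: rtrancl_into_rtrancl)
  have wfC: "pair_wf_digraph ?C"
  proof
    fix e assume "e \<in> parcs ?C"
    then have "fst e \<in> ?W" "(fst e, snd e) \<in> ?s (parcs H)"
      by (auto simp: C)
    then show "fst e \<in> pverts ?C" "snd e \<in> pverts ?C"
      using W_step unfolding C by blast+
  qed
  have sub: "subgraph (with_proj ?C) (with_proj H)"
    using wf wfC by (auto simp: subgraph_def C wf_digraph_wp_iff)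
  have sym: "(b, a) \<in> (?s R)\<^sup>*" if "(a, b) \<in> (?s R)\<^sup>*" for a b and R :: "'a rel"
    using that sym_rtrancl[of "?s R"] by (auto simp: sym_def)
  have reach: "w \<in> ?W \<and> (v, w) \<in> (?s (parcs ?C))\<^sup>*" if "(v, w) \<in> (?s (parcs H))\<^sup>*" for w
    using that
  proof (induction rule: rtrancl_induct)
    case base
    then show ?case
      using v by simp
  next
    case (step a b)
    then have "b \<in> ?W"
      using W_step by blast
    moreover have "(a, b) \<in> ?s (parcs ?C)"
      using step calculation by (auto simp: C)
    ultimately show ?case
      using step.IH by (meson rtrancl_into_rtrancl)
  qed
  have conn: "Digraph_Component.connected (with_proj ?C)"
    unfolding connected_iff[OF wfC]
  proof (intro conjI ballI)
    show "pverts ?C \<noteq> {}"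
      using v by (auto simp: C)
    fix a b assume "a \<in> pverts ?C" "b \<in> pverts ?C"
    then have "(v, a) \<in> (?s (parcs ?C))\<^sup>*" "(v, b) \<in> (?s (parcs ?C))\<^sup>*"
      using reach by (auto simp: C)
    then show "(a, b) \<in> (?s (parcs ?C))\<^sup>*"
      using sym rtrancl_trans by metis
  qed
  have max: "H' = with_proj ?C"
    if H': "subgraph (with_proj ?C) H'" "subgraph H' (with_proj H)" "Digraph_Component.connected H'" for H'
  proof -
    \<comment> \<open>H' is an arbitrary digraph with its own end maps; being a subgraph of H forces
      these to be the projections, so it is the pair digraph C'.\<close>
    define C' where "C' = \<lparr>pverts = verts H', parcs = arcs H'\<rparr>"
    have H'_eq: "H' = with_proj C'"
      using H'(2) by (intro pre_digraph.equality) (auto simp: C'_def subgraph_def compatible_def)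
    have wfC': "pair_wf_digraph C'"
      using H'(2) by (auto simp: subgraph_def H'_eq wf_digraph_wp_iff)
    have subs: "pverts ?C \<subseteq> pverts C'" "parcs ?C \<subseteq> parcs C'" "pverts C' \<subseteq> pverts H" "parcs C' \<subseteq> parcs H"
      using H'(1,2) by (auto simp: subgraph_def H'_eq)
    have "v \<in> pverts C'"
      using subs(1) v by (auto simp: C)
    then have "(v, w) \<in> (?s (parcs C'))\<^sup>*" if "w \<in> pverts C'" for w
      using H'(3) that unfolding H'_eq connected_iff[OF wfC'] by blast
    moreover have "(?s (parcs C'))\<^sup>* \<subseteq> (?s (parcs H))\<^sup>*"
      using subs(4) by (intro rtrancl_mono) auto
    ultimately have verts: "pverts C' = pverts ?C"
      using subs(1,3) by (auto simp: C)
    have "parcs C' \<subseteq> parcs ?C"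
      using subs(4) pair_wf_digraph.arc_fst_in_verts[OF wfC'] unfolding verts by (auto simp: C)
    then have "C' = ?C"
      using verts subs(2) by (intro pair_pre_digraph.equality) auto
    then show ?thesis
      by (simp add: H'_eq)
  qed
  show ?thesis
    unfolding connected_component_def pre_digraph.max_subgraph_def using sub conn max by blast
qed

text \<open>Two arcs with a common source or target, or the arcs of a cycle, lie in the component of
  one vertex. A violation of any of the three conditions would therefore show up inside a single
  component, which is a simple path.\<close>

lemma path_like_if_components:
  assumes wf: "pair_wf_digraph H" and comp: "\<And>C. connected_component H C \<Longrightarrow> simple_path_digraph C"
  shows "path_like (parcs H)"
proof -
  interpret pair_wf_digraph H by fact
  let ?C = "component_of H"
  have path: "path_like (parcs (?C v))" if "v \<in> pverts H" for v
    using comp[OF connected_component_of[OF wf that]] path_like_simple_path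
    by (auto simp: simple_path_digraph_def)
  have arcs: "parcs (?C v) = {e \<in> parcs H. fst e \<in> pverts H \<and> (v, fst e) \<in> (parcs H \<union> (parcs H)\<inverse>)\<^sup>*}" for v
    by (auto simp: component_of_def Let_def)
  have out: "(a, b) \<in> parcs (?C a)" "(a, b) \<in> parcs (?C b)" if "(a, b) \<in> parcs H" for a b
    using that wellformed' by (auto simp: arcs)
  have "single_valued (parcs H)"
  proof (rule single_valuedI)
    fix a b c assume *: "(a, b) \<in> parcs H" "(a, c) \<in> parcs H"
    then show "b = c"
      using path[of a] out(1)[OF *(1)] out(1)[OF *(2)] wellformed'(1)
      unfolding path_like_def single_valued_def by metis
  qed
  moreover have "single_valued ((parcs H)\<inverse>)"
  proof (rule single_valuedI)
    fix a b c assume *: "(a, b) \<in> (parcs H)\<inverse>" "(a, c) \<in> (parcs H)\<inverse>"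
    then show "b = c"
      using path[of a] out(2)[of b a] out(2)[of c a] wellformed'(2)
      unfolding path_like_def single_valued_def converse_iff by metis
  qed
  moreover have "acyclic (parcs H)"
  proof (rule acyclicI, rule allI, rule notI)
    fix x assume cycle: "(x, x) \<in> (parcs H)\<^sup>+"
    have "(x, y) \<in> (parcs (?C x))\<^sup>+ \<and> (x, y) \<in> (parcs H \<union> (parcs H)\<inverse>)\<^sup>*" if "(x, y) \<in> (parcs H)\<^sup>+" for y
      using that
    proof (induction rule: trancl_induct)
      case (base y)
      then show ?case
        using out(1) by blast
    next
      case (step y z)
      then have "(y, z) \<in> parcs (?C x)"
        using wellformed'(1) by (auto simp: arcs)
      then show ?case
        using step by (meson UnI1 rtrancl_into_rtrancl trancl_into_trancl)
    qed
    then have "(x, x) \<in> (parcs (?C x))\<^sup>+"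
      using cycle by blast
    moreover have "x \<in> pverts H"
      using tranclD[OF cycle] wellformed'(1) by blast
    ultimately show False
      using path unfolding path_like_def acyclic_def by blast
  qed
  ultimately show ?thesis
    by (simp add: path_like_def)
qed

section \<open>Path posets as face posets and their embeddings\<close>

lemma (in pair_digraph) wf_subset: "A \<subseteq> parcs G \<Longrightarrow> pair_wf_digraph \<lparr>pverts = pverts G, parcs = A\<rparr>"
  by unfold_locales (auto dest!: subsetD intro: in_arcsD1 in_arcsD2)

text \<open>A spanning subgraph is determined by its arcs. If these are path-like, then so are the
  arcs of every component, which is finite and connected and hence a simple path; the converse is
  assembled from the components.\<close>

lemma (in pair_digraph) multipath_iff:
  "multipath G H \<longleftrightarrow> (\<exists>A\<subseteq>parcs G. path_like A \<and> H = \<lparr>pverts = pverts G, parcs = A\<rparr>)"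
proof
  assume H: "multipath G H"
  then have "pverts H = pverts G" "parcs H \<subseteq> parcs G" "pair_wf_digraph H"
    by (auto simp: multipath_def spanning_def subgraph_def wf_digraph_wp_iff)
  moreover from this H have "path_like (parcs H)"
    by (intro path_like_if_components) (auto simp: multipath_def)
  moreover have "H = \<lparr>pverts = pverts H, parcs = parcs H\<rparr>"
    by simp
  ultimately show "\<exists>A\<subseteq>parcs G. path_like A \<and> H = \<lparr>pverts = pverts G, parcs = A\<rparr>"
    by metis
next
  assume "\<exists>A\<subseteq>parcs G. path_like A \<and> H = \<lparr>pverts = pverts G, parcs = A\<rparr>"
  then obtain A where A: "A \<subseteq> parcs G" "path_like A" "H = \<lparr>pverts = pverts G, parcs = A\<rparr>"
    by blast
  have "simple_path_digraph C" if "connected_component H C" for C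
  proof (rule simple_path_digraph_if_path_like)
    from that have sub: "subgraph (with_proj C) (with_proj H)"
      and conn: "Digraph_Component.connected (with_proj C)"
      by (auto simp: connected_component_def pre_digraph.max_subgraph_def)
    then show "pair_wf_digraph C" "Digraph_Component.connected (with_proj C)"
      by (auto simp: subgraph_def wf_digraph_wp_iff)
    show "finite (pverts C)"
      using sub A(3) pair_finite_verts by (auto simp: subgraph_def intro: finite_subset)
    show "path_like (parcs C)"
      using sub A(2,3) by (auto simp: subgraph_def intro: path_like_subset)
  qed
  then show "multipath G H"
    using A wf_subset[OF A(1)] pair_wf_digraph
    by (auto simp: multipath_def spanning_def subgraph_def wf_digraph_wp_iff)
qed

lemma (in pair_digraph) simplicial_path_poset:
  "simplicial_poset (path_poset G) {A. A \<subseteq> parcs G \<and> path_like A} (\<lambda>A. \<lparr>pverts = pverts G, parcs = A\<rparr>)"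
proof
  show "finite {A. A \<subseteq> parcs G \<and> path_like A}"
    using pair_finite_arcs by simp
  show "finite A" if "A \<in> {A. A \<subseteq> parcs G \<and> path_like A}" for A
    using that pair_finite_arcs by (auto intro: finite_subset)
  show "{} \<in> {A. A \<subseteq> parcs G \<and> path_like A}"
    by (simp add: path_like_def acyclic_def)
  show "B \<in> {A. A \<subseteq> parcs G \<and> path_like A}" if "A \<in> {A. A \<subseteq> parcs G \<and> path_like A}" "B \<subseteq> A" for A B
    using that path_like_subset by blast
  show "inj_on (\<lambda>A. \<lparr>pverts = pverts G, parcs = A\<rparr>) {A. A \<subseteq> parcs G \<and> path_like A}"
    by (auto intro: inj_onI)
  have sub: "subgraph (with_proj \<lparr>pverts = pverts G, parcs = A\<rparr>) (with_proj \<lparr>pverts = pverts G, parcs = B\<rparr>) \<longleftrightarrow> A \<subseteq> B"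
    if "A \<subseteq> parcs G" "B \<subseteq> parcs G" for A B
    using wf_subset[OF that(1)] wf_subset[OF that(2)] by (auto simp: subgraph_def wf_digraph_wp_iff)
  show "path_poset G = {(\<lparr>pverts = pverts G, parcs = A\<rparr>, \<lparr>pverts = pverts G, parcs = B\<rparr>) | A B.
      A \<in> {A. A \<subseteq> parcs G \<and> path_like A} \<and> B \<in> {A. A \<subseteq> parcs G \<and> path_like A} \<and> A \<subseteq> B}"
    unfolding path_poset_def multipath_iff by (auto simp: sub)
qed

text \<open>A set of arcs contained in the image of A is the image of a subset of A, which is
  path-like along with A; this makes the image down-closed. Injectivity on arcs follows from that on
  vertices, as the ends of arcs are vertices.\<close>

lemma path_poset_embedding:
  assumes "pair_digraph G" "pair_digraph G'" "regular_morphism G G' \<phi>"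
  shows "lower_embedding (path_poset G) (path_poset G') (path_poset_map G' \<phi>)"
proof -
  interpret G: pair_digraph G by fact
  interpret G': pair_digraph G' by fact
  interpret r: simplicial_poset "path_poset G" "{A. A \<subseteq> parcs G \<and> path_like A}" "\<lambda>A. \<lparr>pverts = pverts G, parcs = A\<rparr>"
    by (rule G.simplicial_path_poset)
  interpret r': simplicial_poset "path_poset G'" "{A. A \<subseteq> parcs G' \<and> path_like A}" "\<lambda>A. \<lparr>pverts = pverts G', parcs = A\<rparr>"
    by (rule G'.simplicial_path_poset)
  let ?f = "map_prod \<phi> \<phi>"
  have inj: "inj_on \<phi> (pverts G)" and mor: "?f ` parcs G \<subseteq> parcs G'"
    using assms(3) by (auto simp: regular_morphism_def digraph_morphism_def)
  have V: "parcs G \<subseteq> pverts G \<times> pverts G"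
    using G.wellformed' by auto
  have inj': "inj_on ?f (parcs G)"
    using map_prod_inj_on[OF inj inj] V by (rule inj_on_subset)
  have map: "path_poset_map G' \<phi> \<lparr>pverts = pverts G, parcs = A\<rparr> = \<lparr>pverts = pverts G', parcs = ?f ` A\<rparr>" for A
    by (simp add: path_poset_map_def)
  have mem: "?f ` A \<subseteq> parcs G'" "path_like (?f ` A)" if "A \<subseteq> parcs G" "path_like A" for A
    using that mor path_like_image[OF that(2) _ inj] V by blast+
  show ?thesis
    unfolding lower_embedding_def
  proof (intro conjI ballI allI)
    show "inj_on (path_poset_map G' \<phi>) (Field (path_poset G))"
      unfolding r.Field_r using inj_on_image_eq_iff[OF inj']
      by (auto intro!: inj_onI simp: map)
  next
    fix y assume "y \<in> Field (path_poset G)"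
    then obtain A where A: "A \<subseteq> parcs G" "path_like A" "y = \<lparr>pverts = pverts G, parcs = A\<rparr>"
      unfolding r.Field_r by blast
    show "path_poset_map G' \<phi> y \<in> Field (path_poset G')"
      unfolding r'.Field_r A(3) map using mem[OF A(1,2)] by blast
    fix x
    show "(x, path_poset_map G' \<phi> y) \<in> path_poset G' \<longleftrightarrow>
        (\<exists>x'. (x', y) \<in> path_poset G \<and> x = path_poset_map G' \<phi> x')"
    proof
      assume "(x, path_poset_map G' \<phi> y) \<in> path_poset G'"
      then obtain B where B: "x = \<lparr>pverts = pverts G', parcs = B\<rparr>" "B \<subseteq> ?f ` A"
        unfolding r'.r_eq A(3) map by auto
      then obtain A' where A': "A' \<subseteq> A" "B = ?f ` A'"
        by (auto simp: subset_image_iff)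
      then have "A' \<subseteq> parcs G" "path_like A'"
        using A path_like_subset by auto
      then have "(\<lparr>pverts = pverts G, parcs = A'\<rparr>, y) \<in> path_poset G"
        using A A' r.h_le_iff[of A' A] by auto
      then show "\<exists>x'. (x', y) \<in> path_poset G \<and> x = path_poset_map G' \<phi> x'"
        using B(1) A'(2) map by metis
    next
      assume "\<exists>x'. (x', y) \<in> path_poset G \<and> x = path_poset_map G' \<phi> x'"
      then obtain A' where A': "A' \<subseteq> parcs G" "path_like A'" "A' \<subseteq> A"
        "x = path_poset_map G' \<phi> \<lparr>pverts = pverts G, parcs = A'\<rparr>"
        unfolding r.r_eq A(3) by auto
      then show "(x, path_poset_map G' \<phi> y) \<in> path_poset G'"
        unfolding A(3) map using mem[OF A'(1,2)] mem[OF A(1,2)] r'.h_le_iff[of "?f ` A'" "?f ` A"] by auto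
    qed
  qed
qed

section \<open>The Mayer--Vietoris sequence of a gluing\<close>

text \<open>The existence of the four sign assignments keeps the universal part from being vacuous;
  there they are chosen independently of each other. Exactness at the cohomology of the gluing is
  stated in degree n + 1, which covers all degrees because n runs over the integers.\<close>

theorem theorem4p4:
  fixes K :: "('k, 'm) ring_scheme"
    and G :: "'a pair_pre_digraph" and G\<^sub>1 :: "'b pair_pre_digraph" and G\<^sub>2 :: "'c pair_pre_digraph"
    and i\<^sub>1 :: "'a \<Rightarrow> 'b" and i\<^sub>2 :: "'a \<Rightarrow> 'c"
  assumes "field K"
    and "pair_digraph G" and "pair_digraph G\<^sub>1" and "pair_digraph G\<^sub>2"
    and "regular_morphism G G\<^sub>1 i\<^sub>1" and "regular_morphism G G\<^sub>2 i\<^sub>2"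
  shows
    "(\<exists>\<epsilon> \<epsilon>\<^sub>1 \<epsilon>\<^sub>2 \<epsilon>\<^sub>0.
        sign_assignment (path_poset_gluing G G\<^sub>1 G\<^sub>2 i\<^sub>1 i\<^sub>2) \<epsilon> \<and>
        sign_assignment (path_poset G\<^sub>1) \<epsilon>\<^sub>1 \<and> sign_assignment (path_poset G\<^sub>2) \<epsilon>\<^sub>2 \<and>
        sign_assignment (path_poset G) \<epsilon>\<^sub>0) \<and>
     (\<forall>\<epsilon> \<epsilon>\<^sub>1 \<epsilon>\<^sub>2 \<epsilon>\<^sub>0.
        sign_assignment (path_poset_gluing G G\<^sub>1 G\<^sub>2 i\<^sub>1 i\<^sub>2) \<epsilon> \<and>
        sign_assignment (path_poset G\<^sub>1) \<epsilon>\<^sub>1 \<and> sign_assignment (path_poset G\<^sub>2) \<epsilon>\<^sub>2 \<and>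
        sign_assignment (path_poset G) \<epsilon>\<^sub>0 \<longrightarrow>
        (let A = poset_cochains K (path_poset_gluing G G\<^sub>1 G\<^sub>2 i\<^sub>1 i\<^sub>2) \<epsilon>;
             B\<^sub>1 = poset_cochains K (path_poset G\<^sub>1) \<epsilon>\<^sub>1;
             B\<^sub>2 = poset_cochains K (path_poset G\<^sub>2) \<epsilon>\<^sub>2;
             C = poset_cochains K (path_poset G) \<epsilon>\<^sub>0
         in \<exists>f g \<delta>.
              short_exact_sequence K A (csum B\<^sub>1 B\<^sub>2) C f g \<and>
              connecting_hom K A (csum B\<^sub>1 B\<^sub>2) C f g \<delta> \<and>
              (\<forall>n.
                 exact_at K (cohomology A n)
                   (direct_sum (cohomology B\<^sub>1 n) (cohomology B\<^sub>2 n)) (cohomology C n)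
                   (coh_into_sum B\<^sub>1 B\<^sub>2 f n) (coh_from_sum B\<^sub>1 B\<^sub>2 C g n) \<and>
                 exact_at K (direct_sum (cohomology B\<^sub>1 n) (cohomology B\<^sub>2 n))
                   (cohomology C n) (cohomology A (n + 1))
                   (coh_from_sum B\<^sub>1 B\<^sub>2 C g n) (\<delta> n) \<and>
                 exact_at K (cohomology C n) (cohomology A (n + 1))
                   (direct_sum (cohomology B\<^sub>1 (n + 1)) (cohomology B\<^sub>2 (n + 1)))
                   (\<delta> n) (coh_into_sum B\<^sub>1 B\<^sub>2 f (n + 1)))))"
proof -
  interpret G: pair_digraph G by fact
  interpret G1: pair_digraph G\<^sub>1 by fact
  interpret G2: pair_digraph G\<^sub>2 by fact
  let ?r = "path_poset G" and ?r\<^sub>1 = "path_poset G\<^sub>1" and ?r\<^sub>2 = "path_poset G\<^sub>2"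
    and ?j\<^sub>1 = "path_poset_map G\<^sub>1 i\<^sub>1" and ?j\<^sub>2 = "path_poset_map G\<^sub>2 i\<^sub>2"
    and ?gl = "path_poset_gluing G G\<^sub>1 G\<^sub>2 i\<^sub>1 i\<^sub>2"
  note r = G.simplicial_path_poset and r\<^sub>1 = G1.simplicial_path_poset and r\<^sub>2 = G2.simplicial_path_poset
  have "lower_embedding_posets ?r ?r\<^sub>1 ?j\<^sub>1" "lower_embedding_posets ?r ?r\<^sub>2 ?j\<^sub>2"
    using r r\<^sub>1 r\<^sub>2 path_poset_embedding assms
    by (auto intro!: lower_embedding_posets.intro lower_embedding_posets_axioms.intro
        simplicial_poset.min_poset_r)
  then interpret glued_posets ?r ?r\<^sub>1 ?r\<^sub>2 ?j\<^sub>1 ?j\<^sub>2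
    by (rule glued_posets.intro)
  have gl: "gluing ?r ?r\<^sub>1 ?r\<^sub>2 ?j\<^sub>1 ?j\<^sub>2 = ?gl"
    by (simp add: path_poset_gluing_def)
  obtain \<epsilon>\<^sub>0 \<epsilon>\<^sub>1 \<epsilon>\<^sub>2 where signs: "sign_assignment ?r \<epsilon>\<^sub>0" "sign_assignment ?r\<^sub>1 \<epsilon>\<^sub>1" "sign_assignment ?r\<^sub>2 \<epsilon>\<^sub>2"
    using simplicial_poset.ex_sign_assignment[OF r] simplicial_poset.ex_sign_assignment[OF r\<^sub>1]
      simplicial_poset.ex_sign_assignment[OF r\<^sub>2] by blast
  obtain \<epsilon> where "sign_assignment ?gl \<epsilon>"
    using sign_assignment_gl[OF simplicial_poset.sign_assignment_unique[OF r] signs(2,3)] unfolding gl by blast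
  moreover have "\<exists>f g \<delta>.
      short_exact_sequence K A (csum B\<^sub>1 B\<^sub>2) C f g \<and>
      connecting_hom K A (csum B\<^sub>1 B\<^sub>2) C f g \<delta> \<and>
      (\<forall>n.
         exact_at K (cohomology A n)
           (direct_sum (cohomology B\<^sub>1 n) (cohomology B\<^sub>2 n)) (cohomology C n)
           (coh_into_sum B\<^sub>1 B\<^sub>2 f n) (coh_from_sum B\<^sub>1 B\<^sub>2 C g n) \<and>
         exact_at K (direct_sum (cohomology B\<^sub>1 n) (cohomology B\<^sub>2 n))
           (cohomology C n) (cohomology A (n + 1))
           (coh_from_sum B\<^sub>1 B\<^sub>2 C g n) (\<delta> n) \<and>
         exact_at K (cohomology C n) (cohomology A (n + 1))
           (direct_sum (cohomology B\<^sub>1 (n + 1)) (cohomology B\<^sub>2 (n + 1)))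
           (\<delta> n) (coh_into_sum B\<^sub>1 B\<^sub>2 f (n + 1)))"
    if \<epsilon>: "sign_assignment ?gl \<epsilon>" "sign_assignment ?r\<^sub>1 \<epsilon>\<^sub>1" "sign_assignment ?r\<^sub>2 \<epsilon>\<^sub>2" "sign_assignment ?r \<epsilon>\<^sub>0"
      and ABC: "A = poset_cochains K ?gl \<epsilon>" "B\<^sub>1 = poset_cochains K ?r\<^sub>1 \<epsilon>\<^sub>1" "B\<^sub>2 = poset_cochains K ?r\<^sub>2 \<epsilon>\<^sub>2"
        "C = poset_cochains K ?r \<epsilon>\<^sub>0"
    for \<epsilon> \<epsilon>\<^sub>1 \<epsilon>\<^sub>2 \<epsilon>\<^sub>0 A B\<^sub>1 B\<^sub>2 C
  proof -
    note \<epsilon>_gl = \<epsilon>(1)[folded gl]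
    obtain \<eta>\<^sub>1 where \<eta>\<^sub>1: "\<forall>x y. (x, y) \<in> covers ?r\<^sub>1 \<longrightarrow> \<epsilon>\<^sub>1 x y + \<eta>\<^sub>1 x = \<eta>\<^sub>1 y + \<epsilon> (q\<^sub>1 x) (q\<^sub>1 y)"
      using simplicial_poset.sign_assignment_unique[OF r\<^sub>1 \<epsilon>(2) f1.sign_assignment_j[OF \<epsilon>_gl]] ..
    obtain \<eta>\<^sub>2 where \<eta>\<^sub>2: "\<forall>x y. (x, y) \<in> covers ?r\<^sub>2 \<longrightarrow> \<epsilon>\<^sub>2 x y + \<eta>\<^sub>2 x = \<eta>\<^sub>2 y + \<epsilon> (q\<^sub>2 x) (q\<^sub>2 y)"
      using simplicial_poset.sign_assignment_unique[OF r\<^sub>2 \<epsilon>(3) f2.sign_assignment_j[OF \<epsilon>_gl]] ..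
    \<comment> \<open>The signs of the gluing are pulled back to P(G) by way of
      \<open>G\<^sub>1\<close>; the way through \<open>G\<^sub>2\<close> yields the same signs,
      because the two maps into the gluing agree on P(G).\<close>
    obtain \<eta>\<^sub>0 where \<eta>\<^sub>0: "\<forall>x y. (x, y) \<in> covers ?r \<longrightarrow>
        \<epsilon>\<^sub>0 x y + \<eta>\<^sub>0 x = \<eta>\<^sub>0 y + \<epsilon> (q\<^sub>1 (?j\<^sub>1 x)) (q\<^sub>1 (?j\<^sub>1 y))"
      using simplicial_poset.sign_assignment_unique[OF r \<epsilon>(4)
          e1.sign_assignment_j[OF f1.sign_assignment_j[OF \<epsilon>_gl]]] ..
    have complexes: "cochain_complex K B\<^sub>1" "cochain_complex K B\<^sub>2" "cochain_complex K C"
      unfolding ABC using simplicial_poset.poset_cochain_complex r r\<^sub>1 r\<^sub>2 assms(1) \<epsilon> by metis+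
    have "\<exists>f g. short_exact_sequence K A (csum B\<^sub>1 B\<^sub>2) C f g"
      unfolding ABC gl[symmetric]
      by (rule short_exact_sequence_gl[OF assms(1) complexes[unfolded ABC] \<eta>\<^sub>1[rule_format]
            \<eta>\<^sub>2[rule_format] \<eta>\<^sub>0[rule_format]])
    then obtain f g where ses: "short_exact_sequence K A (csum B\<^sub>1 B\<^sub>2) C f g"
      by blast
    interpret short_exact_csum K A B\<^sub>1 B\<^sub>2 C f g
      using ses complexes by (simp add: short_exact_csum_def short_exact_def complex_def)
    show ?thesis
      using ses connecting exact_at_A exact_at_B exact_at_C by blast
  qed
  ultimately show ?thesis
    using signs unfolding Let_def by blast
qed

end
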